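(* Let $(p,q)\in\mathcal{C}$ be a path in $T^*Q$, and for $\Delta\in\mathcal{M}_0(D)$ let $$D\mathcal{G}(\Delta)=\eta\int_0^x\Big(\tfrac{D}{Dt}\dot q+\eta\,\pi_q^*(\mathcal{U}(\Delta,q))\Big)dy .$$ A sufficient condition for optimality at $\Delta$ for the minimization of $\mathcal{F}(\cdot,p,q)$ over $\mathcal{M}_0(D)$ is that (1) there exists a function $g\in C_{1,0}(D)$ such that $g(1,x)=0$ for all $x\in[0,1]$ and $$\partial_tg+\frac1\eta g^2\le\eta\int_0^x\Big(\tfrac{D}{Dt}\dot q+\eta\,\pi_q^*(\mathcal{U}(\Delta,q))\Big)dy\quad\text{on }D,$$ (2) the following equality is satisfied: $$\langle-D\mathcal{G}(\Delta),\Delta\rangle=\mathrm{FR}_\eta(\Delta,\partial_t\Delta).$$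
   Context: $D=[0,1]^2$ with points $(t,x)$ (time, space); dots are time derivatives. $C_{1,0}(D)$ is the space of continuous real functions on $D$ which are $C^1$ with respect to $t$. For $q\in L^2([0,1])$ put $\eta(q)(x)=\exp(\int_0^xq(u)\,du)$, $\varphi(q)(x)=\int_0^x\eta(q)(y)\,dy$ (argument $q$ often omitted). $Q=\{q\in L^2([0,1]):\int_0^1q\,dx=0,\ \int_0^1\eta(q)\,dx=1\}$, with Riemannian metric $G(q)(X,X)=\int_0^1X^2/\eta(q)\,dx$. Write $\langle f,g\rangle_\eta=\int_0^1fg\,\eta\,dx$, $H_2=\begin{bmatrix}1&1/2\\1/2&1/3\end{bmatrix}$, $\pi_q^*(p)=p-\begin{bmatrix}1&\varphi\end{bmatrix}H_2^{-1}\begin{bmatrix}\langle p,1\rangle_\eta\\ \langle p,\varphi\rangle_\eta\end{bmatrix}$. $T_q^*Q$ is identified with the range of $\pi_q^*$, i.e. $\{p\in L^2:\langle p,1\rangle_\eta=\langle p,\varphi\rangle_\eta=0\}$, with norm $\|p\|_q^2=\int_0^1\eta\,p^2dx$; $X^\flat=X/\eta$ for $X\in T_qQ$. Given $q_0\in Q$, $p_0\in T_{q_0}^*Q$, $\mathcal{C}^0$ is the set of curves $(p(t),q(t))\in T^*Q$, $t\in[0,1]$, with $q\in H^2([0,1],L^2([0,1]))$, $\dot q=\eta(q)p$, $q(0)=q_0$, $p(0)=p_0$; $\mathcal{C}^{0,1}$ is the subset of those with in addition $q(1)=q_1$, $p(1)=p_1$ for given $q_1\in Q$, $p_1\in T_{q_1}^*Q$;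 $\mathcal{C}$ stands for either. $\frac{D}{Dt}\dot q$ is the covariant derivative of $\dot q$ along $q$ for $(Q,G)$; explicitly, with $\mathcal{U}(f,q)(x)=\frac12\int_x^1\eta(q)f\,dy$ and $b=\frac32\int_0^1(\int_0^xp\circ\varphi^{-1}dy)^2dx$, $$\Big(\tfrac{D}{Dt}\dot q\Big)^\flat=\dot p+\mathcal{U}(p^2,q)-\begin{bmatrix}1&\varphi\end{bmatrix}H_2^{-1}\begin{bmatrix}0\\ b\end{bmatrix}-(\mathrm{id}-\pi_q^* )(\mathcal{U}(p^2,q)).$$ For a measure $\Delta=\Delta_t\,dt$ on $D$, $\mathcal{U}(\Delta,q)(t,x)=\frac12\int_x^1\eta(q(t))\,d\Delta_t$, and $\langle w,\Delta\rangle=\int_0^1\int_0^1w(t,x)\,d\Delta_t(x)\,dt$. Fisher-Rao functional: $r(x,y)=\frac14\frac{y^2}{x}$ if $x>0$, $r(0,0)=0$, $r=+\infty$ otherwise; for finite signed Radon measures $\mu,\nu$ on $D$ and $f\in C^0(D,(0,\infty))$, $\mathrm{FR}_f(\mu,\nu)=\int_Dr(\frac{d\mu}{d\lambda},\frac{d\nu}{d\lambda})f\,d\lambda$ for any positive $\lambda$ dominating $\mu,\nu$. $\mathcal{M}_0(D)$ is the set of positive finite Radon measures $\Delta$ on $D$ with $\Delta_{t=0}=0$. The conditions $\Delta_{t=0}=0$ and $\partial_t\Delta=\delta$ are understood weakly: $\int_D\partial_tf\,d\Delta+\int_Df\,d\delta=0$ for all $f\in C_{1,0}(D)$ with $f(1,x)=0$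 for all $x$. The functional is $$\mathcal{F}(\Delta,p,q)=\mathrm{FR}_\eta(\Delta,\partial_t\Delta)+\mathcal{G}(\Delta),\qquad\mathcal{G}(\Delta)=\int_0^1\Big\|\Big(\tfrac{D}{Dt}\dot q\Big)^\flat+\pi_q^*(\mathcal{U}(\Delta,q))\Big\|_q^2dt+P(p(1),q(1)),$$ with $\mathrm{FR}_\eta(\Delta,\partial_t\Delta)$ and $\mathcal{F}$ equal to $+\infty$ if $\partial_t\Delta$ is not a finite Radon measure; $P$ is a real-valued functional on $T^*Q$. "Optimality at $\Delta$" means that $\Delta$ minimizes $\mathcal{F}(\cdot,p,q)$ over $\mathcal{M}_0(D)$. *)

theory Defs
  imports "HOL-Analysis.Analysis"
begin

section \<open>The spaces \<open>Q\<close> and \<open>T\<^sup>*Q\<close>\<close>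

text \<open>
  Elements of \<open>L\<^sup>2([0,1])\<close> are given by Borel representatives \<^typ>\<open>real \<Rightarrow> real\<close>, whose values
  outside \<open>[0,1]\<close> are irrelevant; equality in \<open>L\<^sup>2\<close> is equality almost everywhere.
\<close>

abbreviation I01 :: "real measure" where
  "I01 \<equiv> restrict_space lborel {0..1}"

definition L2 :: "(real \<Rightarrow> real) set" where
  "L2 = {f. f \<in> borel_measurable I01 \<and> integrable I01 (\<lambda>x. (f x)\<^sup>2)}"

definition eta :: "(real \<Rightarrow> real) \<Rightarrow> real \<Rightarrow> real" where
  "eta q x = exp (LINT u:{0..x}|lborel. q u)"

definition phi :: "(real \<Rightarrow> real) \<Rightarrow> real \<Rightarrow> real" where
  "phi q x = (LINT y:{0..x}|lborel. eta q y)"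

definition Q :: "(real \<Rightarrow> real) set" where
  "Q = {q \<in> L2. (LINT x:{0..1}|lborel. q x) = 0 \<and> (LINT x:{0..1}|lborel. eta q x) = 1}"

definition inner_eta :: "(real \<Rightarrow> real) \<Rightarrow> (real \<Rightarrow> real) \<Rightarrow> (real \<Rightarrow> real) \<Rightarrow> real" where
  "inner_eta q f g = (LINT x:{0..1}|lborel. f x * g x * eta q x)"

definition H2 :: "real^2^2" where
  "H2 = vector [vector [1, 1/2], vector [1/2, 1/3]]"

text \<open>The function \<open>[1 \<phi>] H\<^sub>2\<^sup>-\<^sup>1 [a, b]\<^sup>T\<close> of \<open>x\<close>.\<close>

definition row_H2 :: "(real \<Rightarrow> real) \<Rightarrow> real \<Rightarrow> real \<Rightarrow> real \<Rightarrow> real" where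
  "row_H2 q a b x = (vector [1, phi q x] :: real^2) \<bullet> (matrix_inv H2 *v vector [a, b])"

definition pi_star :: "(real \<Rightarrow> real) \<Rightarrow> (real \<Rightarrow> real) \<Rightarrow> real \<Rightarrow> real" where
  "pi_star q p x =
     p x - row_H2 q (inner_eta q p (\<lambda>_. 1)) (inner_eta q p (phi q)) x"

definition TstarQ :: "(real \<Rightarrow> real) \<Rightarrow> (real \<Rightarrow> real) set" where
  "TstarQ q = {p \<in> L2. inner_eta q p (\<lambda>_. 1) = 0 \<and> inner_eta q p (phi q) = 0}"

definition norm_sq :: "(real \<Rightarrow> real) \<Rightarrow> (real \<Rightarrow> real) \<Rightarrow> ennreal" where
  "norm_sq q p = (\<integral>\<^sup>+ x. ennreal (eta q x * (p x)\<^sup>2) \<partial>I01)"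


section \<open>Curves in \<open>T\<^sup>*Q\<close> and the covariant derivative\<close>

text \<open>
  \<open>u\<close> belongs to \<open>H\<^sup>1([0,1], L\<^sup>2([0,1]))\<close> with derivative \<open>v\<close>: \<open>v\<close> is in
  \<open>L\<^sup>2([0,1], L\<^sup>2([0,1])) = L\<^sup>2([0,1]\<^sup>2)\<close> and \<open>u(t) = u(0) + \<integral>\<^sub>0\<^sup>t v(s) ds\<close> in \<open>L\<^sup>2([0,1])\<close> for every \<open>t\<close>
  (so \<open>u\<close> is the continuous representative). The first argument of a curve is the time.
\<close>

definition has_H1_deriv :: "(real \<Rightarrow> real \<Rightarrow> real) \<Rightarrow> (real \<Rightarrow> real \<Rightarrow> real) \<Rightarrow> bool" where
  "has_H1_deriv u v \<longleftrightarrow>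
     (\<forall>t\<in>{0..1}. u t \<in> L2) \<and>
     (\<lambda>(t, x). v t x) \<in> borel_measurable (I01 \<Otimes>\<^sub>M I01) \<and>
     integrable (I01 \<Otimes>\<^sub>M I01) (\<lambda>(t, x). (v t x)\<^sup>2) \<and>
     (\<forall>t\<in>{0..1}. AE x in I01. u t x = u 0 x + (LINT s:{0..t}|lborel. v s x))"

definition H1_deriv :: "(real \<Rightarrow> real \<Rightarrow> real) \<Rightarrow> real \<Rightarrow> real \<Rightarrow> real" where
  "H1_deriv u = (SOME v. has_H1_deriv u v)"

text \<open>
  \<open>q \<in> H\<^sup>2([0,1], L\<^sup>2([0,1]))\<close>, where \<open>v\<close> is the (continuous) first derivative of \<open>q\<close>.
\<close>

definition has_H2_deriv :: "(real \<Rightarrow> real \<Rightarrow> real) \<Rightarrow> (real \<Rightarrow> real \<Rightarrow> real) \<Rightarrow> bool" where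
  "has_H2_deriv q v \<longleftrightarrow> has_H1_deriv q v \<and> (\<exists>w. has_H1_deriv v w)"

definition C0 :: "(real \<Rightarrow> real) \<Rightarrow> (real \<Rightarrow> real) \<Rightarrow>
    ((real \<Rightarrow> real \<Rightarrow> real) \<times> (real \<Rightarrow> real \<Rightarrow> real)) set" where
  "C0 q0 p0 = {(p, q).
     (\<forall>t\<in>{0..1}. q t \<in> Q \<and> p t \<in> TstarQ (q t)) \<and>
     (\<exists>v. has_H2_deriv q v \<and> (\<forall>t\<in>{0..1}. AE x in I01. v t x = eta (q t) x * p t x)) \<and>
     (AE x in I01. q 0 x = q0 x) \<and> (AE x in I01. p 0 x = p0 x)}"

definition C01 :: "(real \<Rightarrow> real) \<Rightarrow> (real \<Rightarrow> real) \<Rightarrow> (real \<Rightarrow> real) \<Rightarrow> (real \<Rightarrow> real) \<Rightarrow>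
    ((real \<Rightarrow> real \<Rightarrow> real) \<times> (real \<Rightarrow> real \<Rightarrow> real)) set" where
  "C01 q0 p0 q1 p1 = {(p, q) \<in> C0 q0 p0.
     (AE x in I01. q 1 x = q1 x) \<and> (AE x in I01. p 1 x = p1 x)}"

definition U :: "(real \<Rightarrow> real) \<Rightarrow> (real \<Rightarrow> real) \<Rightarrow> real \<Rightarrow> real" where
  "U f q x = 1/2 * (LINT y:{x..1}|lborel. eta q y * f y)"

definition b_coeff :: "(real \<Rightarrow> real) \<Rightarrow> (real \<Rightarrow> real) \<Rightarrow> real" where
  "b_coeff p q =
     3/2 * (LINT x:{0..1}|lborel. (LINT y:{0..x}|lborel. p (inv_into {0..1} (phi q) y))\<^sup>2)"

text \<open>
  The covariant derivative of the velocity of \<open>q\<close> along \<open>q\<close> in \<open>(Q, G)\<close>, given by its explicit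
  expression: \<open>cov_flat\<close> is its image under \<open>X \<mapsto> X\<^sup>\<flat> = X / \<eta>(q)\<close>. It is defined for
  almost every \<open>t\<close> only, since the time derivative of \<open>p\<close> is.
\<close>

definition cov_flat ::
    "(real \<Rightarrow> real \<Rightarrow> real) \<Rightarrow> (real \<Rightarrow> real \<Rightarrow> real) \<Rightarrow> real \<Rightarrow> real \<Rightarrow> real" where
  "cov_flat p q t x =
     (let u = U (\<lambda>y. (p t y)\<^sup>2) (q t)
      in H1_deriv p t x + u x - row_H2 (q t) 0 (b_coeff (p t) (q t)) x
         - (u x - pi_star (q t) u x))"

definition cov :: "(real \<Rightarrow> real \<Rightarrow> real) \<Rightarrow> (real \<Rightarrow> real \<Rightarrow> real) \<Rightarrow> real \<Rightarrow> real \<Rightarrow> real" where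
  "cov p q t x = eta (q t) x * cov_flat p q t x"


section \<open>Measures on the unit square\<close>

abbreviation D :: "(real \<times> real) set" where
  "D \<equiv> {0..1} \<times> {0..1}"

text \<open>Finite Borel measures on the compact metric space \<open>D\<close> are automatically Radon.\<close>

definition pos_measures :: "(real \<times> real) measure set" where
  "pos_measures = {\<Delta>. sets \<Delta> = sets (restrict_space borel D) \<and> finite_measure \<Delta>}"

text \<open>
  A finite signed Radon measure is given by a pair of positive ones, of which it is the difference.
\<close>

type_synonym signed = "(real \<times> real) measure \<times> (real \<times> real) measure"

definition signed_measures :: "signed set" where
  "signed_measures = pos_measures \<times> pos_measures"

definition of_pos :: "(real \<times> real) measure \<Rightarrow> signed" where
  "of_pos \<Delta> = (\<Delta>, null_measure \<Delta>)"

definition signed_integral :: "signed \<Rightarrow> (real \<times> real \<Rightarrow> real) \<Rightarrow> real" where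
  "signed_integral \<mu> f = integral\<^sup>L (fst \<mu>) f - integral\<^sup>L (snd \<mu>) f"

definition signed_density :: "(real \<times> real) measure \<Rightarrow> signed \<Rightarrow> real \<times> real \<Rightarrow> real" where
  "signed_density \<rho> \<mu> z =
     enn2real (RN_deriv \<rho> (fst \<mu>) z) - enn2real (RN_deriv \<rho> (snd \<mu>) z)"

definition r :: "real \<Rightarrow> real \<Rightarrow> ennreal" where
  "r x y = (if x > 0 then ennreal (1/4 * (y\<^sup>2 / x)) else if x = 0 \<and> y = 0 then 0 else \<infinity>)"

text \<open>
  Since \<open>r\<close> is positively homogeneous of degree one, the value of the Fisher-Rao functional does
  not depend on the dominating measure; we take the sum of all the measures involved.
\<close>

definition dominating :: "signed \<Rightarrow> signed \<Rightarrow> (real \<times> real) measure" where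
  "dominating \<mu> \<nu> = measure_of (space (fst \<mu>)) (sets (fst \<mu>))
     (\<lambda>A. emeasure (fst \<mu>) A + emeasure (snd \<mu>) A + emeasure (fst \<nu>) A + emeasure (snd \<nu>) A)"

definition FR :: "(real \<times> real \<Rightarrow> real) \<Rightarrow> signed \<Rightarrow> signed \<Rightarrow> ennreal" where
  "FR f \<mu> \<nu> = (let \<rho> = dominating \<mu> \<nu>
     in \<integral>\<^sup>+ z. r (signed_density \<rho> \<mu> z) (signed_density \<rho> \<nu> z) * ennreal (f z) \<partial>\<rho>)"

definition dt :: "(real \<times> real \<Rightarrow> real) \<Rightarrow> real \<times> real \<Rightarrow> real" where
  "dt f = (\<lambda>(t, x). vector_derivative (\<lambda>s. f (s, x)) (at t within {0..1}))"

definition C10 :: "(real \<times> real \<Rightarrow> real) set" where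
  "C10 = {f. continuous_on D f \<and>
     (\<forall>t\<in>{0..1}. \<forall>x\<in>{0..1}. (\<lambda>s. f (s, x)) differentiable (at t within {0..1})) \<and>
     continuous_on D (dt f)}"

text \<open>
  Weak form of \<open>\<Delta>\<^bsub>t=0\<^esub> = 0\<close> together with \<open>\<partial>\<^sub>t\<Delta> = \<delta>\<close>. The test functions vanish at \<open>t = 1\<close>, so
  that the integral identity leaves the part of \<open>\<delta>\<close> on \<open>{1} \<times> [0,1]\<close> undetermined; we take it to be
  zero (since \<open>\<Delta>\<close> has no mass there, any other choice has infinite Fisher-Rao energy).
\<close>

definition has_time_deriv :: "(real \<times> real) measure \<Rightarrow> signed \<Rightarrow> bool" where
  "has_time_deriv \<Delta> \<delta> \<longleftrightarrow>
     \<delta> \<in> signed_measures \<and>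
     emeasure (fst \<delta>) ({1} \<times> {0..1}) = 0 \<and> emeasure (snd \<delta>) ({1} \<times> {0..1}) = 0 \<and>
     (\<forall>f\<in>C10. (\<forall>x\<in>{0..1}. f (1, x) = 0) \<longrightarrow>
        integral\<^sup>L \<Delta> (dt f) + signed_integral \<delta> f = 0)"

definition time_deriv :: "(real \<times> real) measure \<Rightarrow> signed" where
  "time_deriv \<Delta> = (SOME \<delta>. has_time_deriv \<Delta> \<delta>)"

text \<open>
  The condition \<open>\<Delta>\<^bsub>t=0\<^esub> = 0\<close> alone: when the derivative of \<open>\<Delta>\<close> in the open time interval is a finite
  measure \<open>\<delta>\<close>, then the above identity holds without a boundary term at \<open>t = 0\<close>. Measures
  whose derivative is not a finite measure have no initial trace and are not restricted here.
\<close>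

definition zero_initial :: "(real \<times> real) measure \<Rightarrow> bool" where
  "zero_initial \<Delta> \<longleftrightarrow>
     (\<forall>\<delta>\<in>signed_measures.
        (\<forall>\<tau>\<in>{0, 1}. emeasure (fst \<delta>) ({\<tau>} \<times> {0..1}) = 0 \<and> emeasure (snd \<delta>) ({\<tau>} \<times> {0..1}) = 0) \<and>
        (\<forall>f\<in>C10. (\<forall>x\<in>{0..1}. f (0, x) = 0 \<and> f (1, x) = 0) \<longrightarrow>
           integral\<^sup>L \<Delta> (dt f) + signed_integral \<delta> f = 0)
        \<longrightarrow> has_time_deriv \<Delta> \<delta>)"

definition M0 :: "(real \<times> real) measure set" where
  "M0 = {\<Delta> \<in> pos_measures. zero_initial \<Delta>}"

text \<open>
  The disintegration \<open>\<Delta> = \<Delta>\<^sub>t dt\<close>. It is unique up to a null set of times, and it exists whenever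
  the time derivative of \<open>\<Delta>\<close> is a finite measure, with \<open>\<Delta>\<^sub>t = \<partial>\<^sub>t\<Delta>([0,t] \<times> _)\<close> for almost every \<open>t\<close>.
\<close>

definition disintegration :: "(real \<times> real) measure \<Rightarrow> (real \<Rightarrow> real measure) \<Rightarrow> bool" where
  "disintegration \<Delta> K \<longleftrightarrow>
     (\<forall>t\<in>{0..1}. sets (K t) = sets (restrict_space borel {0..1}) \<and> finite_measure (K t)) \<and>
     (\<forall>B\<in>sets (restrict_space borel {0..1}). (\<lambda>t. emeasure (K t) B) \<in> borel_measurable I01) \<and>
     (\<forall>A\<in>sets \<Delta>. emeasure \<Delta> A = (\<integral>\<^sup>+ t. emeasure (K t) {x. (t, x) \<in> A} \<partial>I01))"

definition slice :: "(real \<times> real) measure \<Rightarrow> real \<Rightarrow> real measure" where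
  "slice \<Delta> = (SOME K. disintegration \<Delta> K)"

definition pairing :: "(real \<times> real \<Rightarrow> real) \<Rightarrow> (real \<times> real) measure \<Rightarrow> real" where
  "pairing w \<Delta> = (LINT t:{0..1}|lborel. (LINT x|slice \<Delta> t. w (t, x)))"

definition U_meas ::
    "(real \<times> real) measure \<Rightarrow> (real \<Rightarrow> real \<Rightarrow> real) \<Rightarrow> real \<Rightarrow> real \<Rightarrow> real" where
  "U_meas \<Delta> q t x = 1/2 * (LINT y:{x..1}|slice \<Delta> t. eta (q t) y)"


section \<open>The functional\<close>

definition FR_time :: "(real \<Rightarrow> real \<Rightarrow> real) \<Rightarrow> (real \<times> real) measure \<Rightarrow> ennreal" where
  "FR_time q \<Delta> =
     (if \<exists>\<delta>. has_time_deriv \<Delta> \<delta>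
      then FR (\<lambda>(t, x). eta (q t) x) (of_pos \<Delta>) (time_deriv \<Delta>)
      else \<infinity>)"

definition G_fun :: "((real \<Rightarrow> real) \<Rightarrow> (real \<Rightarrow> real) \<Rightarrow> real) \<Rightarrow> (real \<times> real) measure \<Rightarrow>
    (real \<Rightarrow> real \<Rightarrow> real) \<Rightarrow> (real \<Rightarrow> real \<Rightarrow> real) \<Rightarrow> ereal" where
  "G_fun P \<Delta> p q =
     enn2ereal (\<integral>\<^sup>+ t. norm_sq (q t)
        (\<lambda>x. cov_flat p q t x + pi_star (q t) (U_meas \<Delta> q t) x) \<partial>I01)
     + ereal (P (p 1) (q 1))"

definition F_fun :: "((real \<Rightarrow> real) \<Rightarrow> (real \<Rightarrow> real) \<Rightarrow> real) \<Rightarrow> (real \<times> real) measure \<Rightarrow>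
    (real \<Rightarrow> real \<Rightarrow> real) \<Rightarrow> (real \<Rightarrow> real \<Rightarrow> real) \<Rightarrow> ereal" where
  "F_fun P \<Delta> p q = enn2ereal (FR_time q \<Delta>) + G_fun P \<Delta> p q"

definition DG :: "(real \<times> real) measure \<Rightarrow>
    (real \<Rightarrow> real \<Rightarrow> real) \<Rightarrow> (real \<Rightarrow> real \<Rightarrow> real) \<Rightarrow> real \<times> real \<Rightarrow> real" where
  "DG \<Delta> p q = (\<lambda>(t, x). eta (q t) x *
     (LINT y:{0..x}|lborel. cov p q t y + eta (q t) y * pi_star (q t) (U_meas \<Delta> q t) y))"

definition optimal :: "((real \<Rightarrow> real) \<Rightarrow> (real \<Rightarrow> real) \<Rightarrow> real) \<Rightarrow> (real \<times> real) measure \<Rightarrow>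
    (real \<Rightarrow> real \<Rightarrow> real) \<Rightarrow> (real \<Rightarrow> real \<Rightarrow> real) \<Rightarrow> bool" where
  "optimal P \<Delta> p q \<longleftrightarrow> \<Delta> \<in> M0 \<and> (\<forall>\<Delta>'\<in>M0. F_fun P \<Delta> p q \<le> F_fun P \<Delta>' p q)"

end

theory Submission
  imports Defs
begin

text \<open>
  The Fisher-Rao functional is a supremum of linear functionals: \<open>FR\<^sub>\<eta>(\<Delta>', \<partial>\<^sub>t\<Delta>') \<ge> - \<integral> (\<partial>\<^sub>tg + g\<^sup>2/\<eta>) d\<Delta>'\<close>
  for every admissible \<open>g\<close>, by AM-GM and integration by parts in time. Condition (1) bounds the
  right-hand side below by \<open>- \<langle>DG(\<Delta>), \<Delta>'\<rangle>\<close>, and by (2) this is an equality at \<open>\<Delta>' = \<Delta>\<close>. On the other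
  side, \<open>\<G>\<close> is convex and \<open>DG(\<Delta>)\<close> is its derivative: the residual \<open>(D/Dt q')\<^sup>\<flat> + \<pi>\<^sup>*(U(\<Delta>, q))\<close> lies in
  \<open>T\<^sup>*Q\<close>, so that its inner product with \<open>\<pi>\<^sup>*(U(\<Delta>' - \<Delta>, q))\<close> is the one with \<open>U(\<Delta>' - \<Delta>, q)\<close>, which
  Fubini turns into \<open>\<langle>DG(\<Delta>), \<Delta>' - \<Delta>\<rangle> / 2\<close>. Adding the two inequalities gives the claim.

  All of this uses that a measure with finite time derivative is \<open>h(t, x) dt m(dx)\<close> with \<open>0 \<le> h \<le> 1\<close> and
  \<open>m\<close> finite, whence everything depending on its slices is bounded and jointly measurable.
\<close>

section \<open>Integrals over the unit interval\<close>

text \<open>The residual lies in the cotangent space because \<open><p, 1>\<close> and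
  \<open><p, phi>\<close> vanish along the whole path and can be differentiated in time. Regularity
  is the obstacle: p is an H^1 curve with values in L^2, so it need not be jointly measurable or
  differentiable at a fixed x. The weights eta and phi, however, are built from space primitives and
  are Lipschitz in t for every single x. The time calculus is therefore a Leibniz rule for an L^2
  curve times a bounded weight (\<open>ac_mult\<close>). That rule and all integrations by parts in
  space rest on one Fubini identity, \<open>cum_mult_cum\<close>. The constants match: the 1/2 in
  \<open>U_meas\<close> cancels the 2 from differentiating a square, so \<open>DG\<close> carries no
  numerical factor; the 3/2 of \<open>b_coeff\<close> is 1 from the motion of phi plus 1/2 from the
  motion of eta. The representation of measures by densities is available on both sides of the
  comparison: condition (2) equates the Fisher-Rao energy of the given measure with a real number,
  so that measure has a time derivative, and a competitor without one has infinite energy.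
  \<open>slice\<close>, \<open>time_deriv\<close> and \<open>H1_deriv\<close> are choices, so
  statements about slices or residuals hold for almost every t.\<close>

lemma space_I01 [simp]: "space I01 = {0..1}"
  by simp

lemma sets_I01: "sets I01 = sets (restrict_space borel {0..1})"
  by (intro sets_restrict_space_cong) simp

lemma borel_measurable_ident_I01 [measurable]: "(\<lambda>x. x) \<in> borel_measurable I01"
  by (rule measurable_restrict_space1) simp

lemma finite_measure_I01: "finite_measure I01"
  by (rule finite_measureI) (simp add: emeasure_restrict_space)

interpretation I01: finite_measure I01
  by (rule finite_measure_I01)

interpretation I01I01: pair_sigma_finite I01 I01 ..

lemma emeasure_I01_UNIV: "emeasure I01 {0..1} = 1"
  by (subst emeasure_restrict_space) simp_all

lemma emeasure_I01_singleton: "emeasure I01 {a} = 0" if "a \<in> {0..1}"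
  using that by (subst emeasure_restrict_space) simp_all

lemma AE_I01_neq: "AE x in I01. x \<noteq> a"
proof (cases "a \<in> {0..1}")
  case True
  have "{a} \<in> null_sets I01"
    using emeasure_I01_singleton[OF True] True by (auto simp: null_sets_def sets_restrict_space_iff)
  from AE_not_in[OF this] show ?thesis by simp
qed (auto intro!: AE_I2)

section \<open>Primitives and integration by parts for integrable functions\<close>

abbreviation I01sq :: "(real \<times> real) measure" where
  "I01sq \<equiv> I01 \<Otimes>\<^sub>M I01"

text \<open>Writing the primitive as an integral over the fixed space \<open>I01\<close> with an
  indicator makes it jointly measurable in x and in any parameter of f. The same operator serves for
  primitives in space and in time.\<close>

definition cum :: "(real \<Rightarrow> real) \<Rightarrow> real \<Rightarrow> real" where
  "cum f x = (\<integral>y. indicator {0..x} y * f y \<partial>I01)"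

lemma integral_I01: "integral\<^sup>L I01 f = (LINT x:{0..1}|lborel. f x)" for f :: "real \<Rightarrow> real"
  by (simp add: integral_restrict_space set_lebesgue_integral_def)

lemma set_integral_eq_cum: "(LINT y:{0..x}|lborel. f y) = cum f x" if "x \<in> {0..1}"
proof -
  have *: "indicator {0..x} y * f y = indicator {0..1} y * (indicator {0..x} y * f y)" for y
    using that by (auto simp: indicator_def)
  show ?thesis
    using *[abs_def]
    by (simp add: cum_def integral_restrict_space set_lebesgue_integral_def)
qed

lemma set_integral_tail: "(LINT y:{x..1}|lborel. f y) = (\<integral>y. indicator {x..1} y * f y \<partial>I01)"
  if "x \<in> {0..1}" for f :: "real \<Rightarrow> real"
proof -
  have *: "indicator {x..1} y * f y = indicator {0..1} y * (indicator {x..1} y * f y)" for y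
    using that by (auto simp: indicator_def)
  show ?thesis
    using *[abs_def]
    by (simp add: integral_restrict_space set_lebesgue_integral_def)
qed

lemma cum_1: "cum f 1 = integral\<^sup>L I01 f"
  unfolding cum_def by (rule Bochner_Integration.integral_cong) (auto simp: indicator_def)

lemma cum_0: "cum f 0 = 0"
  unfolding cum_def
  by (rule integral_eq_zero_AE, rule eventually_mono[OF AE_I01_neq[of 0]]) (auto simp: indicator_def)

lemma measurable_indicator_Icc [measurable (raw)]:
  "(\<lambda>z. indicator {a z..b z} (c z) :: real) \<in> borel_measurable M"
  if [measurable]: "a \<in> borel_measurable M" "b \<in> borel_measurable M" "c \<in> borel_measurable M"
    for a b c :: "'a \<Rightarrow> real"
proof -
  have "(\<lambda>z. indicator {a z..b z} (c z) :: real) = (\<lambda>z. if a z \<le> c z \<and> c z \<le> b z then 1 else 0)"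
    by (auto simp: indicator_def fun_eq_iff)
  then show ?thesis by simp
qed

lemma integrable_indicator_mult:
  "integrable I01 (\<lambda>y. indicator {a..b} y * f y)" if "integrable I01 f" for f :: "real \<Rightarrow> real"
  using that by (rule Bochner_Integration.integrable_bound)
    (use that in \<open>auto simp: indicator_def intro!: AE_I2 borel_measurable_times\<close>)

lemma measurable_cum [measurable (raw)]:
  assumes [measurable]: "(\<lambda>(t, x). f t x) \<in> borel_measurable (M \<Otimes>\<^sub>M I01)" "g \<in> borel_measurable M"
  shows "(\<lambda>z. cum (f z) (g z)) \<in> borel_measurable M"
  unfolding cum_def by measurable

lemma cum_cong: "cum f x = cum g x" if "\<And>y. y \<in> {0..x} \<Longrightarrow> y \<le> 1 \<Longrightarrow> f y = g y"
  unfolding cum_def by (rule Bochner_Integration.integral_cong) (use that in \<open>auto simp: indicator_def\<close>)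

lemma cum_cong_AE:
  assumes "AE y in I01. f y = g y" "f \<in> borel_measurable I01" "g \<in> borel_measurable I01"
  shows "cum f x = cum g x"
  unfolding cum_def using assms by (intro integral_cong_AE) (auto intro!: borel_measurable_times)

lemma cum_add: "cum (\<lambda>y. f y + g y) x = cum f x + cum g x"
  if "integrable I01 f" "integrable I01 g"
  unfolding cum_def using that
  by (simp add: distrib_left integrable_indicator_mult)

lemma cum_cmult: "cum (\<lambda>y. c * f y) x = c * cum f x"
  unfolding cum_def by (simp add: mult.left_commute)

lemma abs_cum_le: "\<bar>cum f x\<bar> \<le> (\<integral>y. \<bar>f y\<bar> \<partial>I01)" if "integrable I01 f"
proof -
  have "\<bar>cum f x\<bar> \<le> (\<integral>y. \<bar>indicator {0..x} y * f y\<bar> \<partial>I01)"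
    unfolding cum_def by (rule integral_abs_bound)
  also have "\<dots> \<le> (\<integral>y. \<bar>f y\<bar> \<partial>I01)"
    using that integrable_indicator_mult[OF that, of 0 x]
    by (intro integral_mono integrable_abs) (auto simp: indicator_def)
  finally show ?thesis .
qed

lemma continuous_on_cum: "continuous_on {0..1} (cum f)" if "integrable I01 f"
proof -
  have "set_integrable lborel {0..1} f"
    using that by (simp add: set_integrable_def integrable_restrict_space)
  then have "set_integrable lebesgue {0..1} f"
    by (simp add: set_integrable_def integrable_completion)
  then have "integrable (lebesgue_on {0..1}) f"
    by (simp add: set_integrable_def integrable_restrict_space)
  from indefinite_integral_continuous_real[OF this]
  have "continuous_on {0..1} (\<lambda>x. LINT t:{0..x}|lebesgue. f t)"
    by (simp add: set_lebesgue_integral_def integral_restrict_space)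
  moreover have "cum f x = (LINT t:{0..x}|lebesgue. f t)" if "x \<in> {0..1}" for x
  proof -
    have "f \<in> borel_measurable I01" using \<open>integrable I01 f\<close> by auto
    then have [measurable]: "(\<lambda>y. indicator {0..1} y * f y) \<in> borel_measurable lborel"
      by (subst (asm) borel_measurable_restrict_space_iff) auto
    then have [measurable]: "(\<lambda>y. indicator {0..x} y * (indicator {0..1} y * f y)) \<in> borel_measurable lborel"
      by measurable
    have eq: "indicator {0..x} y * (indicator {0..1} y * f y) = indicator {0..x} y *\<^sub>R f y" for y
      using that by (auto simp: indicator_def)
    have "(\<lambda>y. indicator {0..x} y *\<^sub>R f y) \<in> borel_measurable lborel"
      unfolding eq[symmetric] by measurable
    then show ?thesis
      unfolding set_integral_eq_cum[OF that, symmetric] set_lebesgue_integral_def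
      by (simp add: integral_completion)
  qed
  ultimately show ?thesis
    by (subst continuous_on_cong[OF refl]) auto
qed

lemma integrable_mult_cum: "integrable I01 (\<lambda>s. a s * cum b s)"
  if "integrable I01 a" "integrable I01 b"
proof (rule Bochner_Integration.integrable_bound)
  have [measurable]: "a \<in> borel_measurable I01" "b \<in> borel_measurable I01" using that by auto
  show "integrable I01 (\<lambda>s. a s * (\<integral>y. \<bar>b y\<bar> \<partial>I01))" using that by simp
  show "(\<lambda>s. a s * cum b s) \<in> borel_measurable I01" by measurable
  show "AE s in I01. norm (a s * cum b s) \<le> norm (a s * (\<integral>y. \<bar>b y\<bar> \<partial>I01))"
    using abs_cum_le[OF that(2)] by (auto simp: abs_mult intro!: AE_I2 mult_left_mono)
qed

text \<open>
  Integration by parts for functions that are merely integrable: Fubini on the square, cut along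
  its diagonal.
\<close>

lemma cum_mult_cum:
  assumes f: "integrable I01 f" and g: "integrable I01 g" and x: "x \<in> {0..1}"
  shows "cum f x * cum g x = cum (\<lambda>s. f s * cum g s + cum f s * g s) x"
proof -
  have [measurable]: "f \<in> borel_measurable I01" "g \<in> borel_measurable I01" using f g by auto
  define F where "F = (\<lambda>s. indicator {0..x} s * f s)"
  define H where "H = (\<lambda>s. indicator {0..x} s * g s)"
  have [measurable]: "F \<in> borel_measurable I01" "H \<in> borel_measurable I01"
    unfolding F_def H_def by measurable
  have F: "integrable I01 F" and H: "integrable I01 H"
    unfolding F_def H_def using f g by (simp_all add: integrable_indicator_mult)
  have FH: "integrable I01sq (\<lambda>(s, r). F s * H r)"
    by (rule I01I01.Fubini_integrable) (use F H in \<open>auto simp: abs_mult intro!: AE_I2\<close>)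
  have i1: "integrable I01sq (\<lambda>(s, r). indicator {0..s} r * (F s * H r))"
    by (rule Bochner_Integration.integrable_bound[OF FH]) (auto simp: indicator_def intro!: AE_I2)
  have i2: "integrable I01sq (\<lambda>(s, r). (if s < r then 1 else 0) * (F s * H r))"
    by (rule Bochner_Integration.integrable_bound[OF FH]) (auto simp: indicator_def intro!: AE_I2)
  have "cum f x * cum g x = (\<integral>s. (\<integral>r. F s * H r \<partial>I01) \<partial>I01)"
    by (simp add: cum_def F_def H_def)
  also have "\<dots> = (\<integral>z. (\<lambda>(s, r). F s * H r) z \<partial>I01sq)"
    using I01I01.integral_fst[OF FH] by simp
  also have "\<dots> = (\<integral>z. (\<lambda>(s, r). indicator {0..s} r * (F s * H r)) z
                      + (\<lambda>(s, r). (if s < r then 1 else 0) * (F s * H r)) z \<partial>I01sq)"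
    by (rule Bochner_Integration.integral_cong) (auto simp: space_pair_measure indicator_def)
  also have "\<dots> = (\<integral>z. (\<lambda>(s, r). indicator {0..s} r * (F s * H r)) z \<partial>I01sq)
                  + (\<integral>z. (\<lambda>(s, r). (if s < r then 1 else 0) * (F s * H r)) z \<partial>I01sq)"
    by (rule Bochner_Integration.integral_add[OF i1 i2])
  also have "(\<integral>z. (\<lambda>(s, r). indicator {0..s} r * (F s * H r)) z \<partial>I01sq)
      = (\<integral>s. (\<integral>r. indicator {0..s} r * (F s * H r) \<partial>I01) \<partial>I01)"
    by (rule I01I01.integral_fst[OF i1, symmetric])
  also have "\<dots> = (\<integral>s. indicator {0..x} s * (f s * cum g s) \<partial>I01)"
  proof (rule Bochner_Integration.integral_cong[OF refl])
    fix s
    have "(\<integral>r. indicator {0..s} r * (F s * H r) \<partial>I01) = (\<integral>r. F s * (indicator {0..s} r * g r) \<partial>I01)"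
      by (rule Bochner_Integration.integral_cong) (auto simp: F_def H_def indicator_def)
    then show "(\<integral>r. indicator {0..s} r * (F s * H r) \<partial>I01) = indicator {0..x} s * (f s * cum g s)"
      by (simp add: cum_def F_def)
  qed
  also have "(\<integral>z. (\<lambda>(s, r). (if s < r then 1 else 0) * (F s * H r)) z \<partial>I01sq)
      = (\<integral>r. (\<integral>s. (if s < r then 1 else 0) * (F s * H r) \<partial>I01) \<partial>I01)"
    by (rule I01I01.integral_snd[OF i2, symmetric])
  also have "\<dots> = (\<integral>r. indicator {0..x} r * (cum f r * g r) \<partial>I01)"
  proof (rule Bochner_Integration.integral_cong[OF refl])
    fix r
    \<comment> \<open>The open half of the square gives the strict condition \<open>s < r\<close>,
      while \<open>cum f r\<close> includes s = r. The two differ on a null set.\<close>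
    have "(\<integral>s. (if s < r then 1 else 0) * (F s * H r) \<partial>I01)
        = (\<integral>s. H r * (indicator {0..r} s * f s) \<partial>I01)"
      by (rule integral_cong_AE, measurable, rule eventually_mono[OF AE_I01_neq[of r]])
         (auto simp: F_def H_def indicator_def)
    then show "(\<integral>s. (if s < r then 1 else 0) * (F s * H r) \<partial>I01) = indicator {0..x} r * (cum f r * g r)"
      by (simp add: cum_def H_def)
  qed
  also have "(\<integral>s. indicator {0..x} s * (f s * cum g s) \<partial>I01) + \<dots>
     = cum (\<lambda>s. f s * cum g s + cum f s * g s) x"
  proof -
    have "integrable I01 (\<lambda>s. cum f s * g s)"
      using integrable_mult_cum[OF g f] by (simp add: mult.commute)
    then show ?thesis
      using integrable_mult_cum[OF f g] by (subst cum_add) (simp_all add: cum_def)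
  qed
  finally show ?thesis .
qed

text \<open>The product rule in the form that fits absolutely continuous functions of time, which
  are given as an initial value plus a primitive.\<close>

lemma cum_product_rule:
  assumes f: "integrable I01 f" and g: "integrable I01 g" and x: "x \<in> {0..1}"
  shows "(a + cum f x) * (b + cum g x)
    = a * b + cum (\<lambda>s. f s * (b + cum g s) + (a + cum f s) * g s) x"
proof -
  have "cum (\<lambda>s. f s * (b + cum g s) + (a + cum f s) * g s) x
     = cum (\<lambda>s. (b * f s + a * g s) + (f s * cum g s + cum f s * g s)) x"
    by (rule cum_cong) (simp add: algebra_simps)
  also have "\<dots> = cum (\<lambda>s. b * f s + a * g s) x + cum (\<lambda>s. f s * cum g s + cum f s * g s) x"
    using f g integrable_mult_cum[OF f g] integrable_mult_cum[OF g f]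
    by (intro cum_add) (auto simp: mult.commute)
  also have "cum (\<lambda>s. b * f s + a * g s) x = b * cum f x + a * cum g x"
    using f g by (subst cum_add) (auto simp: cum_cmult)
  finally show ?thesis
    unfolding cum_mult_cum[OF f g x, symmetric] by (simp add: algebra_simps)
qed

text \<open>Fubini for the iterated primitives. It is the reason why taking space primitives
  commutes with time derivatives.\<close>

lemma cum_swap:
  assumes f: "integrable I01sq (\<lambda>(s, y). f s y)"
  shows "cum (\<lambda>y. cum (\<lambda>s. f s y) t) x = cum (\<lambda>s. cum (f s) x) t"
proof -
  have [measurable]: "(\<lambda>(s, y). f s y) \<in> borel_measurable I01sq" using f by auto
  have i: "integrable I01sq (\<lambda>(s, y). indicator {0..t} s * (indicator {0..x} y * f s y))"
    by (rule Bochner_Integration.integrable_bound[OF f]) (auto simp: indicator_def intro!: AE_I2)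
  have "cum (\<lambda>y. cum (\<lambda>s. f s y) t) x
      = (\<integral>y. (\<integral>s. indicator {0..t} s * (indicator {0..x} y * f s y) \<partial>I01) \<partial>I01)"
    by (simp add: cum_def flip: integral_mult_right_zero) (simp add: mult_ac)
  also have "\<dots> = (\<integral>s. (\<integral>y. indicator {0..t} s * (indicator {0..x} y * f s y) \<partial>I01) \<partial>I01)"
    by (rule I01I01.Fubini_integral[OF i])
  also have "\<dots> = cum (\<lambda>s. cum (f s) x) t"
    by (simp add: cum_def)
  finally show ?thesis .
qed

section \<open>A countable generator of the Borel sets of the unit interval\<close>

abbreviation half_lines :: "real set set" where
  "half_lines \<equiv> (\<lambda>b. {..b} \<inter> {0..1}) ` \<rat>"

text \<open>Rational endpoints keep the generator countable, so that almost-everywhere statements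
  about each of its members can be combined with a single exceptional set. The endpoint 1 is
  rational, so the whole interval belongs to it.\<close>

lemma sets_I01_generator:
  "sets I01 = sigma_sets {0..1} half_lines"
proof -
  have "sets I01 = (\<inter>) {0..1} ` sigma_sets UNIV (range (\<lambda>a::real. {..a}))"
    by (subst sets_I01, subst borel_eq_atMost, subst sets_restrict_space) simp
  also have "\<dots> = sigma_sets {0..1} ((\<inter>) {0..1} ` range (\<lambda>a::real. {..a}))"
    by (rule sigma_sets_Int) (auto simp: borel_eq_atMost[THEN arg_cong[where f=sets], simplified, symmetric])
  also have "\<dots> = sigma_sets {0..1} half_lines"
  proof (rule sigma_sets_eqI)
    fix A assume "A \<in> (\<inter>) {0..1} ` range (\<lambda>a::real. {..a})"
    then obtain a :: real where A: "A = {..a} \<inter> {0..1}" by blast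
    have eq: "{..a} \<inter> {0..1} = (\<Inter>r\<in>{r \<in> \<rat>. a < r}. {..r} \<inter> {0..1})"
    proof (intro equalityI subsetI)
      fix x assume x: "x \<in> (\<Inter>r\<in>{r \<in> \<rat>. a < r}. {..r} \<inter> {0..1})"
      obtain r0 where "r0 \<in> \<rat>" "a < r0" using Rats_dense_in_real[of a "a + 1"] by auto
      then have "x \<in> {0..1}" using x by auto
      moreover have "x \<le> a"
      proof (rule ccontr)
        assume "\<not> x \<le> a"
        then obtain r where "r \<in> \<rat>" "a < r" "r < x" using Rats_dense_in_real[of a x] by auto
        then show False using x by force
      qed
      ultimately show "x \<in> {..a} \<inter> {0..1}" by simp
    qed auto
    have "(\<Inter>r\<in>{r \<in> \<rat>. a < r}. {..r} \<inter> {0..1}) \<in> sets (sigma {0..1} half_lines)"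
    proof (rule sets.countable_INT')
      show "countable {r \<in> \<rat>. a < r}" by (rule countable_subset[OF _ countable_rat]) auto
      show "{r \<in> \<rat>. a < r} \<noteq> {}" using Rats_dense_in_real[of a "a + 1"] by auto
      show "(\<lambda>r. {..r} \<inter> {0..1}) ` {r \<in> \<rat>. a < r} \<subseteq> sets (sigma {0..1} half_lines)"
        by (subst sets_measure_of) (auto intro!: sigma_sets.Basic)
    qed
    then show "A \<in> sigma_sets {0..1} half_lines"
      unfolding A eq by (subst (asm) sets_measure_of) auto
  next
    fix A assume "A \<in> half_lines"
    then show "A \<in> sigma_sets {0..1} ((\<inter>) {0..1} ` range (\<lambda>a::real. {..a}))"
      by (auto intro!: sigma_sets.Basic simp: image_image Int_commute)
  qed
  finally show ?thesis .
qed

lemma Int_stable_I01_generator: "Int_stable half_lines"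
proof (rule Int_stableI)
  fix A B :: "real set"
  assume "A \<in> half_lines" "B \<in> half_lines"
  then obtain a b where "A = {..a} \<inter> {0..1}" "B = {..b} \<inter> {0..1}" "a \<in> \<rat>" "b \<in> \<rat>" by auto
  then have "A \<inter> B = {..min a b} \<inter> {0..1}" "min a b \<in> \<rat>" by (auto simp: min_def)
  then show "A \<inter> B \<in> half_lines" by blast
qed

lemma measure_eqI_I01:
  assumes M: "sets M = sets I01" "finite_measure M" and N: "sets N = sets I01"
    and eq: "\<And>b. b \<in> \<rat> \<Longrightarrow> b \<in> {0..1} \<Longrightarrow> emeasure M {0..b} = emeasure N {0..b}"
  shows "M = N"
proof (rule measure_eqI_generator_eq[OF Int_stable_I01_generator, where \<Omega> = "{0..1}" and A = "\<lambda>_. {0..1}"])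
  show "emeasure M X = emeasure N X" if X': "X \<in> half_lines" for X
  proof -
    obtain b where X: "X = {..b} \<inter> {0..1}" and b: "b \<in> \<rat>" using X' by blast
    show ?thesis
    proof (cases "b \<ge> 0")
      case True
      then have "X = {0..min b 1}" using X by auto
      then show ?thesis using eq[of "min b 1"] True b by (auto simp: min_def split: if_splits)
    qed (use X in auto)
  qed
  show "range (\<lambda>_. {0..1::real}) \<subseteq> half_lines"
    by (auto intro!: image_eqI[of _ _ 1])
  show "emeasure M {0..1} \<noteq> \<infinity>" for i :: nat
    using finite_measure.emeasure_finite[OF M(2)] by auto
qed (use M N sets_I01_generator in auto)

text \<open>The sets over which f integrates to 0 form a Dynkin system, and the hypothesis puts the
  generating half-lines into it.\<close>

lemma AE_zero_of_cum_zero: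
  assumes f: "integrable I01 f" and z: "\<And>t. t \<in> {0..1} \<Longrightarrow> cum f t = 0"
  shows "AE t in I01. f t = 0"
proof (rule I01.density_zero[OF f])
  have [measurable]: "f \<in> borel_measurable I01" using f by auto
  define G where "G = half_lines"
  have sets_G: "sets I01 = sigma_sets {0..1} G"
    unfolding G_def by (rule sets_I01_generator)
  show "set_lebesgue_integral I01 A f = 0" if "A \<in> sets I01" for A
  proof -
    have A: "A \<in> sigma_sets {0..1} G" using that sets_G by simp
    have stable: "Int_stable G"
      unfolding G_def by (rule Int_stable_I01_generator)
    have "G \<subseteq> Pow {0..1}" by (auto simp: G_def)
    with stable show ?thesis using A
    proof (induction rule: sigma_sets_induct_disjoint)
      case (basic A)
      then obtain b where A: "A = {..b} \<inter> {0..1}" by (auto simp: G_def)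
      show ?case
      proof (cases "b \<ge> 0")
        case True
        have "set_lebesgue_integral I01 A f = cum f (min b 1)"
          unfolding set_lebesgue_integral_def cum_def A
          by (rule Bochner_Integration.integral_cong) (auto simp: indicator_def)
        then show ?thesis using True z by simp
      next
        case False
        then have "A = {}" using A by auto
        then show ?thesis by (simp add: set_lebesgue_integral_def)
      qed
    next
      case empty
      then show ?case by (simp add: set_lebesgue_integral_def)
    next
      case (compl A)
      then have A: "A \<in> sets I01" using sets_G by simp
      have "set_lebesgue_integral I01 ({0..1} - A) f
          = (\<integral>y. indicator {0..1} y * f y - indicator A y * f y \<partial>I01)"
        unfolding set_lebesgue_integral_def
        by (rule Bochner_Integration.integral_cong) (auto simp: indicator_def)
      also have "\<dots> = cum f 1 - set_lebesgue_integral I01 A f"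
        using integrable_mult_indicator[OF A f] f unfolding cum_def set_lebesgue_integral_def
        by (subst Bochner_Integration.integral_diff) (auto intro!: integrable_indicator_mult)
      finally show ?case using compl z by simp
    next
      case (union A)
      then have "range A \<subseteq> sets I01" using sets_G by auto
      moreover from this have "(\<Union>i. A i) \<in> sets I01" by auto
      ultimately have "set_lebesgue_integral I01 (\<Union>i. A i) f = (\<Sum>i. set_lebesgue_integral I01 (A i) f)"
        using union f integrable_mult_indicator[OF \<open>(\<Union>i. A i) \<in> sets I01\<close> f]
        by (intro lebesgue_integral_countable_add)
           (auto simp: disjoint_family_on_def set_integrable_def)
      then show ?case using union by simp
    qed
  qed
qed

lemma integrable_of_square:
  fixes f :: "'a \<Rightarrow> real"
  assumes "finite_measure M" "f \<in> borel_measurable M" "integrable M (\<lambda>x. (f x)\<^sup>2)"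
  shows "integrable M f"
proof -
  interpret finite_measure M by fact
  show ?thesis
  proof (rule Bochner_Integration.integrable_bound)
    show "integrable M (\<lambda>x. 1 + (f x)\<^sup>2)" using assms by simp
    have "\<bar>a\<bar> \<le> 1 + a\<^sup>2" for a :: real
      using zero_le_power2[of "\<bar>a\<bar> - 1"] by (simp add: power2_eq_square algebra_simps)
    then show "AE x in M. norm (f x) \<le> norm (1 + (f x)\<^sup>2)"
      by (auto intro!: AE_I2)
  qed fact
qed

section \<open>Curves in \<open>L\<^sup>2\<close> and bounded multipliers\<close>

lemma has_H1_derivD:
  assumes "has_H1_deriv u w"
  shows "\<And>t. t \<in> {0..1} \<Longrightarrow> u t \<in> L2"
    and "\<And>t. t \<in> {0..1} \<Longrightarrow> u t \<in> borel_measurable I01"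
    and "\<And>t. t \<in> {0..1} \<Longrightarrow> integrable I01 (u t)"
    and "\<And>t. t \<in> {0..1} \<Longrightarrow> integrable I01 (\<lambda>x. (u t x)\<^sup>2)"
    and "case_prod w \<in> borel_measurable I01sq"
    and "integrable I01sq (\<lambda>(t, x). (w t x)\<^sup>2)"
    and "integrable I01sq (case_prod w)"
    and "\<And>t. t \<in> {0..1} \<Longrightarrow> AE x in I01. u t x = u 0 x + cum (\<lambda>s. w s x) t"
proof -
  show u: "u t \<in> L2" if "t \<in> {0..1}" for t
    using assms that by (auto simp: has_H1_deriv_def)
  then show u1: "u t \<in> borel_measurable I01" and u2: "integrable I01 (\<lambda>x. (u t x)\<^sup>2)" if "t \<in> {0..1}" for t
    using that by (auto simp: L2_def)
  show "integrable I01 (u t)" if "t \<in> {0..1}" for t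
    by (rule integrable_of_square[OF finite_measure_I01 u1[OF that] u2[OF that]])
  show w1: "case_prod w \<in> borel_measurable I01sq"
    and w2: "integrable I01sq (\<lambda>(t, x). (w t x)\<^sup>2)"
    using assms by (auto simp: has_H1_deriv_def)
  have "integrable I01sq (\<lambda>z. (case_prod w z)\<^sup>2)"
    using w2 by (simp add: case_prod_unfold)
  then show "integrable I01sq (case_prod w)"
    by (rule integrable_of_square[OF finite_measure_pair_measure[OF finite_measure_I01 finite_measure_I01] w1])
  show "AE x in I01. u t x = u 0 x + cum (\<lambda>s. w s x) t" if "t \<in> {0..1}" for t
    using assms that by (auto simp: has_H1_deriv_def set_integral_eq_cum)
qed

lemma integrable_abs_section:
  fixes w :: "real \<Rightarrow> real \<Rightarrow> real"
  assumes "integrable I01sq (case_prod w)"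
  shows "integrable I01 (\<lambda>x. \<integral>s. \<bar>w s x\<bar> \<partial>I01)"
    and "AE x in I01. integrable I01 (\<lambda>s. w s x)"
    and "AE s in I01. integrable I01 (w s)"
proof -
  have "integrable I01sq (\<lambda>z. \<bar>case_prod w z\<bar>)"
    using assms by (rule integrable_abs)
  then have "integrable I01sq (\<lambda>(s, x). \<bar>w s x\<bar>)"
    by (simp add: case_prod_unfold)
  from I01I01.integrable_snd[OF this] show "integrable I01 (\<lambda>x. \<integral>s. \<bar>w s x\<bar> \<partial>I01)" .
  show "AE x in I01. integrable I01 (\<lambda>s. w s x)"
    using I01I01.AE_integrable_snd[of w] assms by simp
  show "AE s in I01. integrable I01 (w s)"
    using I01I01.AE_integrable_fst[of w] assms by simp
qed

lemma measurable_section: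
  assumes "case_prod f \<in> borel_measurable I01sq" "a \<in> {0..1}"
  shows "f a \<in> borel_measurable I01" "(\<lambda>t. f t a) \<in> borel_measurable I01"
proof -
  have "a \<in> space I01" using assms by simp
  from measurable_Pair2[OF assms(1) this] measurable_Pair1[OF assms(1) this]
  show "f a \<in> borel_measurable I01" "(\<lambda>t. f t a) \<in> borel_measurable I01" by simp_all
qed

text \<open>
  A curve is measurable in \<open>x\<close> for each fixed \<open>t\<close> only; this version of it is jointly measurable.
\<close>

definition representative ::
    "(real \<Rightarrow> real \<Rightarrow> real) \<Rightarrow> (real \<Rightarrow> real \<Rightarrow> real) \<Rightarrow> real \<Rightarrow> real \<Rightarrow> real" where
  "representative u w t x = u 0 x + cum (\<lambda>s. w s x) t"

text \<open>The majorant in the fourth claim does not depend on t. It is what later bounds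
  \<open>U\<close> of the square of p uniformly in time, although p itself is only in L^2 in
  x.\<close>

lemma representative_props:
  assumes H: "has_H1_deriv u w"
  shows "case_prod (representative u w) \<in> borel_measurable I01sq"
    and "\<And>t. t \<in> {0..1} \<Longrightarrow> AE x in I01. u t x = representative u w t x"
    and "\<And>t. t \<in> {0..1} \<Longrightarrow> representative u w t \<in> borel_measurable I01"
    and "\<exists>B. integrable I01 B \<and> (\<forall>t\<in>{0..1}. AE x in I01. (representative u w t x)\<^sup>2 \<le> B x)"
    and "integrable I01sq (\<lambda>(t, x). (representative u w t x)\<^sup>2)"
proof -
  note D = has_H1_derivD[OF H]
  have [measurable]: "u 0 \<in> borel_measurable I01" "case_prod w \<in> borel_measurable I01sq"
    using D by auto
  show m: "case_prod (representative u w) \<in> borel_measurable I01sq"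
    unfolding representative_def[abs_def] by measurable
  show ae: "AE x in I01. u t x = representative u w t x" if "t \<in> {0..1}" for t
    using D(8)[OF that] by (simp add: representative_def)
  show meas: "representative u w t \<in> borel_measurable I01" if "t \<in> {0..1}" for t
    using measurable_section(1)[OF m that] .
  \<comment> \<open>From \<open>(a + b)^2 <= 2 a^2 + 2 b^2\<close>, with Cauchy-Schwarz in time for
    the primitive of w.\<close>
  define B where "B = (\<lambda>x. 2 * (u 0 x)\<^sup>2 + 2 * (\<integral>s. (w s x)\<^sup>2 \<partial>I01))"
  have B: "integrable I01 B"
    unfolding B_def using I01I01.integrable_snd[OF D(6)] D(4)[of 0] by simp
  have "AE x in I01. integrable I01 (\<lambda>s. (w s x)\<^sup>2)"
    using I01I01.AE_integrable_snd[OF D(6)] .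
  moreover have "AE x in I01. integrable I01 (\<lambda>s. w s x)"
    using integrable_abs_section(2)[OF D(7)] .
  ultimately have bd: "AE x in I01. \<forall>t. (representative u w t x)\<^sup>2 \<le> B x"
  proof eventually_elim
    case (elim x)
    show ?case
    proof
      fix t
      let ?I = "\<integral>s. \<bar>w s x\<bar> \<partial>I01"
      \<comment> \<open>Cauchy-Schwarz on an interval of length one, obtained by expanding the
        nonnegative variance of \<open>\<bar>w s x\<bar>\<close> in s.\<close>
      have "?I\<^sup>2 \<le> (\<integral>s. (w s x)\<^sup>2 \<partial>I01)"
      proof -
        have "0 \<le> (\<integral>s. (\<bar>w s x\<bar> - ?I)\<^sup>2 \<partial>I01)" by simp
        also have "\<dots> = (\<integral>s. (w s x)\<^sup>2 - 2 * ?I * \<bar>w s x\<bar> + ?I\<^sup>2 \<partial>I01)"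
          by (simp add: power2_diff algebra_simps)
        also have "\<dots> = (\<integral>s. (w s x)\<^sup>2 \<partial>I01) - 2 * ?I * ?I + ?I\<^sup>2"
          using elim by (simp add: measure_def emeasure_I01_UNIV)
        finally show ?thesis by (simp add: power2_eq_square)
      qed
      moreover have "\<bar>cum (\<lambda>s. w s x) t\<bar> \<le> ?I" using abs_cum_le[OF elim(2)] .
      then have "(cum (\<lambda>s. w s x) t)\<^sup>2 \<le> ?I\<^sup>2" by (rule abs_le_square_iff[THEN iffD1, OF order_trans]) simp
      moreover have "(representative u w t x)\<^sup>2 \<le> 2 * (u 0 x)\<^sup>2 + 2 * (cum (\<lambda>s. w s x) t)\<^sup>2"
        unfolding representative_def using zero_le_power2[of "u 0 x - cum (\<lambda>s. w s x) t"]
        by (simp add: power2_eq_square algebra_simps)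
      ultimately show "(representative u w t x)\<^sup>2 \<le> B x" by (simp add: B_def)
    qed
  qed
  show "\<exists>B. integrable I01 B \<and> (\<forall>t\<in>{0..1}. AE x in I01. (representative u w t x)\<^sup>2 \<le> B x)"
    using B bd by (intro exI[of _ B] conjI ballI) auto
  show "integrable I01sq (\<lambda>(t, x). (representative u w t x)\<^sup>2)"
  proof (rule I01I01.Fubini_integrable)
    show "(\<lambda>(t, x). (representative u w t x)\<^sup>2) \<in> borel_measurable I01sq"
      using m by measurable
    have i: "integrable I01 (\<lambda>x. (representative u w t x)\<^sup>2)" if t: "t \<in> {0..1}" for t
    proof (rule Bochner_Integration.integrable_bound[OF B])
      show "(\<lambda>x. (representative u w t x)\<^sup>2) \<in> borel_measurable I01"
        using meas[OF t] by measurable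
      show "AE x in I01. norm ((representative u w t x)\<^sup>2) \<le> norm (B x)"
        using bd by eventually_elim (simp, meson abs_ge_self order_trans)
    qed
    then show "AE t in I01. integrable I01 (\<lambda>x. case (t, x) of (t, x) \<Rightarrow> (representative u w t x)\<^sup>2)"
      by (auto intro!: AE_I2)
    show "integrable I01 (\<lambda>t. \<integral>x. norm (case (t, x) of (t, x) \<Rightarrow> (representative u w t x)\<^sup>2) \<partial>I01)"
    proof (rule I01.integrable_const_bound)
      show "AE t in I01. norm (\<integral>x. norm (case (t, x) of (t, x) \<Rightarrow> (representative u w t x)\<^sup>2) \<partial>I01)
          \<le> (\<integral>x. B x \<partial>I01)"
      proof (rule AE_I2)
        fix t assume "t \<in> space I01"
        then have t: "t \<in> {0..1}" by simp
        have "(\<integral>x. (representative u w t x)\<^sup>2 \<partial>I01) \<le> (\<integral>x. B x \<partial>I01)"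
          using bd by (intro integral_mono_AE i t B) auto
        then show "norm (\<integral>x. norm (case (t, x) of (t, x) \<Rightarrow> (representative u w t x)\<^sup>2) \<partial>I01)
          \<le> (\<integral>x. B x \<partial>I01)" by simp
      qed
      show "(\<lambda>t. \<integral>x. norm (case (t, x) of (t, x) \<Rightarrow> (representative u w t x)\<^sup>2) \<partial>I01) \<in> borel_measurable I01"
        using m by measurable
    qed
  qed
qed

text \<open>Weights that are Lipschitz in time at every x, with no exceptional set. Boundedness of
  both m and m' is what keeps the product with an H^1 curve in L^2 an H^1 curve.\<close>

definition ac_mult :: "(real \<Rightarrow> real \<Rightarrow> real) \<Rightarrow> (real \<Rightarrow> real \<Rightarrow> real) \<Rightarrow> bool" where
  "ac_mult m m' \<longleftrightarrow>
     case_prod m \<in> borel_measurable I01sq \<and>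
     case_prod m' \<in> borel_measurable I01sq \<and>
     (\<exists>C. \<forall>t\<in>{0..1}. \<forall>x\<in>{0..1}. \<bar>m t x\<bar> \<le> C \<and> \<bar>m' t x\<bar> \<le> C) \<and>
     (\<forall>t\<in>{0..1}. \<forall>x\<in>{0..1}. m t x = m 0 x + cum (\<lambda>s. m' s x) t)"

lemma ac_multD:
  assumes "ac_mult m m'"
  shows "case_prod m \<in> borel_measurable I01sq"
    and "case_prod m' \<in> borel_measurable I01sq"
    and "\<And>t x. t \<in> {0..1} \<Longrightarrow> x \<in> {0..1} \<Longrightarrow> m t x = m 0 x + cum (\<lambda>s. m' s x) t"
    and "\<And>x. x \<in> {0..1} \<Longrightarrow> integrable I01 (\<lambda>s. m' s x)"
    and "\<And>x. x \<in> {0..1} \<Longrightarrow> integrable I01 (\<lambda>s. m s x)"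
    and "\<And>t. t \<in> {0..1} \<Longrightarrow> m t \<in> borel_measurable I01"
    and "\<And>t. t \<in> {0..1} \<Longrightarrow> m' t \<in> borel_measurable I01"
    and "\<And>t. t \<in> {0..1} \<Longrightarrow> integrable I01 (m t)"
    and "\<And>t. t \<in> {0..1} \<Longrightarrow> integrable I01 (m' t)"
    and "integrable I01sq (case_prod m')"
proof -
  show [measurable]: "case_prod m \<in> borel_measurable I01sq"
    and [measurable]: "case_prod m' \<in> borel_measurable I01sq"
    and "\<And>t x. t \<in> {0..1} \<Longrightarrow> x \<in> {0..1} \<Longrightarrow> m t x = m 0 x + cum (\<lambda>s. m' s x) t"
    using assms unfolding ac_mult_def by blast+
  obtain C where C: "\<And>t x. t \<in> {0..1} \<Longrightarrow> x \<in> {0..1} \<Longrightarrow> \<bar>m t x\<bar> \<le> C"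
    "\<And>t x. t \<in> {0..1} \<Longrightarrow> x \<in> {0..1} \<Longrightarrow> \<bar>m' t x\<bar> \<le> C"
    using assms unfolding ac_mult_def by blast
  show 1: "m t \<in> borel_measurable I01" "m' t \<in> borel_measurable I01" if "t \<in> {0..1}" for t
    using measurable_section(1) that by auto
  show "integrable I01 (\<lambda>s. m' s x)" "integrable I01 (\<lambda>s. m s x)" if "x \<in> {0..1}" for x
    by (rule I01.integrable_const_bound[of _ C];
        use that in \<open>auto intro!: AE_I2 C measurable_section(2)[of m] measurable_section(2)[of m']\<close>)+
  show "integrable I01 (m t)" "integrable I01 (m' t)" if "t \<in> {0..1}" for t
    by (rule I01.integrable_const_bound[of _ C]; use that 1 in \<open>auto intro!: AE_I2 C\<close>)+
  interpret P: finite_measure "I01sq"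
    by (intro finite_measure_pair_measure finite_measure_I01)
  show "integrable I01sq (case_prod m')"
    by (rule P.integrable_const_bound[of _ C]) (auto intro!: AE_I2 C simp: space_pair_measure)
qed

lemma ac_mult_mult:
  assumes "ac_mult m m'" "ac_mult n n'"
  shows "ac_mult (\<lambda>t x. m t x * n t x) (\<lambda>t x. m' t x * n t x + m t x * n' t x)"
  unfolding ac_mult_def
proof (intro conjI ballI)
  note M = ac_multD[OF assms(1)] and N = ac_multD[OF assms(2)]
  note [measurable] = M(1,2) N(1,2)
  show "(\<lambda>(t, x). m t x * n t x) \<in> borel_measurable I01sq"
    "(\<lambda>(t, x). m' t x * n t x + m t x * n' t x) \<in> borel_measurable I01sq"
    by measurable
  obtain B where B: "\<And>t x. t \<in> {0..1} \<Longrightarrow> x \<in> {0..1} \<Longrightarrow> \<bar>m t x\<bar> \<le> B \<and> \<bar>m' t x\<bar> \<le> B"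
    using assms(1) unfolding ac_mult_def by blast
  obtain C where C: "\<And>t x. t \<in> {0..1} \<Longrightarrow> x \<in> {0..1} \<Longrightarrow> \<bar>n t x\<bar> \<le> C \<and> \<bar>n' t x\<bar> \<le> C"
    using assms(2) unfolding ac_mult_def by blast
  have le: "\<bar>a * b\<bar> \<le> B * C" if "\<bar>a\<bar> \<le> B" "\<bar>b\<bar> \<le> C" for a b
    using that by (auto simp: abs_mult intro!: mult_mono)
  have nn: "0 \<le> B * C" using le[of "m 0 0" "n 0 0"] B[of 0 0] C[of 0 0] by simp
  show "\<exists>A. \<forall>t\<in>{0..1}. \<forall>x\<in>{0..1}. \<bar>m t x * n t x\<bar> \<le> A \<and> \<bar>m' t x * n t x + m t x * n' t x\<bar> \<le> A"
  proof (intro exI ballI conjI)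
    fix t x :: real assume "t \<in> {0..1}" "x \<in> {0..1}"
    note b = B[OF this] C[OF this]
    show "\<bar>m t x * n t x\<bar> \<le> 2 * (B * C)" using le[of "m t x" "n t x"] nn b by linarith
    show "\<bar>m' t x * n t x + m t x * n' t x\<bar> \<le> 2 * (B * C)"
      using le[of "m' t x" "n t x"] le[of "m t x" "n' t x"] b by linarith
  qed
  fix t x :: real assume t: "t \<in> {0..1}" and x: "x \<in> {0..1}"
  have "m t x * n t x = m 0 x * n 0 x + cum (\<lambda>s. m' s x * (n 0 x + cum (\<lambda>s. n' s x) s)
      + (m 0 x + cum (\<lambda>s. m' s x) s) * n' s x) t"
    unfolding M(3)[OF t x] N(3)[OF t x] by (rule cum_product_rule[OF M(4)[OF x] N(4)[OF x] t])
  also have "cum (\<lambda>s. m' s x * (n 0 x + cum (\<lambda>s. n' s x) s)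
      + (m 0 x + cum (\<lambda>s. m' s x) s) * n' s x) t = cum (\<lambda>s. m' s x * n s x + m s x * n' s x) t"
    by (rule cum_cong) (simp add: M(3)[OF _ x, symmetric] N(3)[OF _ x, symmetric])
  finally show "m t x * n t x = m 0 x * n 0 x + cum (\<lambda>s. m' s x * n s x + m s x * n' s x) t" .
qed

text \<open>\<open>cum_swap\<close> moves the space primitive inside the time primitive, and
  primitives over a space of total mass one keep the bounds.\<close>

lemma ac_mult_cum:
  assumes "ac_mult m m'"
  shows "ac_mult (\<lambda>t. cum (m t)) (\<lambda>t. cum (m' t))"
  unfolding ac_mult_def
proof (intro conjI ballI)
  note M = ac_multD[OF assms(1)]
  note [measurable] = M(1,2)
  show "case_prod (\<lambda>t. cum (m t)) \<in> borel_measurable I01sq"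
    "case_prod (\<lambda>t. cum (m' t)) \<in> borel_measurable I01sq"
    by measurable
  obtain B where B: "\<And>t x. t \<in> {0..1} \<Longrightarrow> x \<in> {0..1} \<Longrightarrow> \<bar>m t x\<bar> \<le> B \<and> \<bar>m' t x\<bar> \<le> B"
    using assms(1) unfolding ac_mult_def by blast
  have le: "\<bar>cum f x\<bar> \<le> B" if "integrable I01 f" "\<And>x. x \<in> {0..1} \<Longrightarrow> \<bar>f x\<bar> \<le> B" for f x
  proof -
    have "(\<integral>y. \<bar>f y\<bar> \<partial>I01) \<le> (\<integral>y. B \<partial>I01)" using that by (intro integral_mono) auto
    then show ?thesis using abs_cum_le[OF that(1), of x] by (simp add: measure_def emeasure_I01_UNIV)
  qed
  show "\<exists>A. \<forall>t\<in>{0..1}. \<forall>x\<in>{0..1}. \<bar>cum (m t) x\<bar> \<le> A \<and> \<bar>cum (m' t) x\<bar> \<le> A"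
    by (intro exI[of _ B] ballI conjI le M) (use B in auto)
  fix t x :: real assume t: "t \<in> {0..1}" and x: "x \<in> {0..1}"
  have "cum (m t) x = cum (\<lambda>y. m 0 y + cum (\<lambda>s. m' s y) t) x"
    by (rule cum_cong) (simp add: M(3)[OF t, symmetric])
  also have "\<dots> = cum (m 0) x + cum (\<lambda>y. cum (\<lambda>s. m' s y) t) x"
  proof (rule cum_add)
    show "integrable I01 (m 0)" using M(8) by simp
    have "integrable I01 (\<lambda>y. m t y - m 0 y)" using M(8)[OF t] M(8)[of 0] by simp
    then show "integrable I01 (\<lambda>y. cum (\<lambda>s. m' s y) t)"
      by (subst Bochner_Integration.integrable_cong[OF refl, of _ _ "\<lambda>y. m t y - m 0 y"])
         (simp_all add: M(3)[OF t])
  qed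
  also have "cum (\<lambda>y. cum (\<lambda>s. m' s y) t) x = cum (\<lambda>s. cum (m' s) x) t"
    by (rule cum_swap) (use M(10) in simp)
  finally show "cum (m t) x = cum (m 0) x + cum (\<lambda>s. cum (m' s) x) t" .
qed

lemma cum_FTC:
  assumes f': "continuous_on {0..1} f'"
    and D: "\<And>t. t \<in> {0..1} \<Longrightarrow> (F has_vector_derivative f' t) (at t within {0..1})"
    and t: "t \<in> {0..1}"
  shows "F t = F 0 + cum f' t"
proof -
  have "(f' has_integral (F t - F 0)) {0..t}"
    by (rule fundamental_theorem_of_calculus)
       (use t in \<open>auto intro!: has_vector_derivative_within_subset[OF D]\<close>)
  moreover have "set_integrable lborel {0..t} f'"
    using t by (intro borel_integrable_atLeastAtMost' continuous_on_subset[OF f']) auto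
  ultimately have "(LINT s:{0..t}|lborel. f' s) = F t - F 0"
    by (simp add: set_borel_integral_eq_integral integral_unique)
  then show ?thesis using set_integral_eq_cum[OF t, of f'] by simp
qed

lemma cum_has_vector_derivative:
  assumes f: "continuous_on {0..1} f" and t: "t \<in> {0..1}"
  shows "(cum f has_vector_derivative f t) (at t within {0..1})"
proof -
  have eq: "integral {0..s} f = cum f s" if "s \<in> {0..1}" for s
  proof -
    have "set_integrable lborel {0..s} f"
      using that by (intro borel_integrable_atLeastAtMost' continuous_on_subset[OF f]) auto
    then show ?thesis using set_integral_eq_cum[OF that, of f] by (simp add: set_borel_integral_eq_integral)
  qed
  have "((\<lambda>u. integral {0..u} f) has_vector_derivative f t) (at t within {0..1})"
    by (rule integral_has_vector_derivative[OF f t])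
  from has_vector_derivative_transform[OF t _ this, of "cum f"] show ?thesis
    by (simp add: eq)
qed

lemma continuous_imp_integrable_I01: "integrable I01 f" if "continuous_on {0..1} f" for f :: "real \<Rightarrow> real"
  using borel_integrable_atLeastAtMost'[OF that]
  by (simp add: set_integrable_def integrable_restrict_space)

text \<open>Continuity of V in t makes E continuously differentiable in time at each x, so the chain
  rule is the classical one and \<open>cum_FTC\<close> brings the result back to primitive form. For
  eta this continuity comes from the velocity of q being itself an H^1 curve.\<close>

lemma ac_mult_exp:
  assumes E: "ac_mult E V" and V: "\<And>x. x \<in> {0..1} \<Longrightarrow> continuous_on {0..1} (\<lambda>t. V t x)"
  shows "ac_mult (\<lambda>t x. exp (c * E t x)) (\<lambda>t x. c * V t x * exp (c * E t x))"
  unfolding ac_mult_def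
proof (intro conjI ballI)
  note M = ac_multD[OF assms(1)]
  note [measurable] = M(1,2)
  show "(\<lambda>(t, x). exp (c * E t x)) \<in> borel_measurable I01sq"
    "(\<lambda>(t, x). c * V t x * exp (c * E t x)) \<in> borel_measurable I01sq"
    by measurable
  obtain B where B: "\<And>t x. t \<in> {0..1} \<Longrightarrow> x \<in> {0..1} \<Longrightarrow> \<bar>E t x\<bar> \<le> B \<and> \<bar>V t x\<bar> \<le> B"
    using assms(1) unfolding ac_mult_def by blast
  show "\<exists>A. \<forall>t\<in>{0..1}. \<forall>x\<in>{0..1}. \<bar>exp (c * E t x)\<bar> \<le> A \<and> \<bar>c * V t x * exp (c * E t x)\<bar> \<le> A"
  proof (intro exI ballI)
    fix t x :: real assume "t \<in> {0..1}" "x \<in> {0..1}"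
    note b = B[OF this]
    have "c * E t x \<le> \<bar>c\<bar> * \<bar>E t x\<bar>" by (metis abs_ge_self abs_mult)
    also have "\<dots> \<le> \<bar>c\<bar> * B" using b by (intro mult_left_mono) auto
    finally have "c * E t x \<le> \<bar>c\<bar> * B" .
    then have e: "exp (c * E t x) \<le> exp (\<bar>c\<bar> * B)" by simp
    have "\<bar>c * V t x\<bar> \<le> \<bar>c\<bar> * B" using b by (simp add: abs_mult mult_left_mono)
    then have "\<bar>c * V t x * exp (c * E t x)\<bar> \<le> (\<bar>c\<bar> * B) * exp (\<bar>c\<bar> * B)"
      unfolding abs_mult[of "c * V t x"] using e by (intro mult_mono) auto
    moreover have "0 \<le> (\<bar>c\<bar> * B) * exp (\<bar>c\<bar> * B)" using b by auto
    ultimately show "\<bar>exp (c * E t x)\<bar> \<le> exp (\<bar>c\<bar> * B) + (\<bar>c\<bar> * B) * exp (\<bar>c\<bar> * B)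
        \<and> \<bar>c * V t x * exp (c * E t x)\<bar> \<le> exp (\<bar>c\<bar> * B) + (\<bar>c\<bar> * B) * exp (\<bar>c\<bar> * B)"
      using e exp_gt_zero[of "c * E t x"] exp_gt_zero[of "\<bar>c\<bar> * B"] by (intro conjI) linarith+
  qed
  fix t x :: real assume t: "t \<in> {0..1}" and x: "x \<in> {0..1}"
  have E': "((\<lambda>t. E t x) has_vector_derivative V s x) (at s within {0..1})" if s: "s \<in> {0..1}" for s
  proof -
    have "((\<lambda>t. E 0 x + cum (\<lambda>s. V s x) t) has_vector_derivative 0 + V s x) (at s within {0..1})"
      by (intro has_vector_derivative_add has_vector_derivative_const
            cum_has_vector_derivative[OF V[OF x]] s)
    from has_vector_derivative_transform[OF s _ this, of "\<lambda>t. E t x"] show ?thesis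
      by (simp add: M(3)[OF _ x, symmetric])
  qed
  then have "continuous_on {0..1} (\<lambda>t. E t x)"
    by (meson continuous_on_vector_derivative)
  then have "continuous_on {0..1} (\<lambda>s. c * V s x * exp (c * E s x))"
    by (intro continuous_intros V x)
  moreover have "((\<lambda>t. exp (c * E t x)) has_vector_derivative c * V s x * exp (c * E s x)) (at s within {0..1})"
    if s: "s \<in> {0..1}" for s
    using E'[OF s] unfolding has_real_derivative_iff_has_vector_derivative[symmetric]
    by (auto intro!: derivative_eq_intros)
  ultimately show "exp (c * E t x) = exp (c * E 0 x) + cum (\<lambda>s. c * V s x * exp (c * E s x)) t"
    using t by (intro cum_FTC)
qed

lemma abs_mult_le: "\<bar>a * b\<bar> \<le> \<bar>a\<bar> * C" if "\<bar>b\<bar> \<le> C" for a b C :: real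
  using that by (auto simp: abs_mult intro!: mult_left_mono)

lemma integrable_mult_bounded:
  fixes f g :: "'a \<Rightarrow> real"
  assumes "integrable M f" "g \<in> borel_measurable M" "\<And>x. x \<in> space M \<Longrightarrow> \<bar>g x\<bar> \<le> C"
  shows "integrable M (\<lambda>x. f x * g x)"
proof (rule Bochner_Integration.integrable_bound)
  show "integrable M (\<lambda>x. \<bar>f x\<bar> * C)" using assms by (intro integrable_mult_left integrable_abs)
  show "(\<lambda>x. f x * g x) \<in> borel_measurable M"
    using assms by (intro borel_measurable_times) auto
  show "AE x in M. norm (f x * g x) \<le> norm (\<bar>f x\<bar> * C)"
  proof (rule AE_I2)
    fix x assume "x \<in> space M"
    from abs_mult_le[OF assms(3)[OF this], of "f x"] show "norm (f x * g x) \<le> norm (\<bar>f x\<bar> * C)"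
      by simp
  qed
qed

lemma ac_mult_bound:
  assumes "ac_mult m m'"
  obtains C where "0 \<le> C" "\<And>t x. t \<in> {0..1} \<Longrightarrow> x \<in> {0..1} \<Longrightarrow> \<bar>m t x\<bar> \<le> C"
    "\<And>t x. t \<in> {0..1} \<Longrightarrow> x \<in> {0..1} \<Longrightarrow> \<bar>m' t x\<bar> \<le> C"
proof -
  obtain C where C: "\<forall>t\<in>{0..1}. \<forall>x\<in>{0..1}. \<bar>m t x\<bar> \<le> C \<and> \<bar>m' t x\<bar> \<le> C"
    using assms unfolding ac_mult_def by blast
  then have "\<bar>m 0 0\<bar> \<le> C" by simp
  then have "0 \<le> C" by linarith
  with C show thesis by (intro that[of C]) auto
qed

section \<open>The Leibniz rule for an L^2 curve times a bounded weight\<close>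

lemma has_H1_derivI:
  assumes "\<And>t. t \<in> {0..1} \<Longrightarrow> u t \<in> L2"
    and "case_prod w \<in> borel_measurable I01sq"
    and "integrable I01sq (\<lambda>(t, x). (w t x)\<^sup>2)"
    and "\<And>t. t \<in> {0..1} \<Longrightarrow> AE x in I01. u t x = u 0 x + cum (\<lambda>s. w s x) t"
  shows "has_H1_deriv u w"
  using assms by (simp add: has_H1_deriv_def set_integral_eq_cum)

lemma has_H1_deriv_cong_AE:
  assumes H: "has_H1_deriv u w" and u': "\<And>t. t \<in> {0..1} \<Longrightarrow> u' t \<in> L2"
    and eq: "\<And>t. t \<in> {0..1} \<Longrightarrow> AE x in I01. u t x = u' t x"
  shows "has_H1_deriv u' w"
proof (rule has_H1_derivI)
  note D = has_H1_derivD[OF H]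
  show "case_prod w \<in> borel_measurable I01sq"
    "integrable I01sq (\<lambda>(t, x). (w t x)\<^sup>2)" by fact+
  show "u' t \<in> L2" if "t \<in> {0..1}" for t by (rule u'[OF that])
  show "AE x in I01. u' t x = u' 0 x + cum (\<lambda>s. w s x) t" if t: "t \<in> {0..1}" for t
  proof -
    have "AE x in I01. u 0 x = u' 0 x" by (rule eq) simp
    with D(8)[OF t] eq[OF t] show ?thesis by eventually_elim simp
  qed
qed

text \<open>For almost every x both factors are primitives in time, so
  \<open>cum_product_rule\<close> applies. The derivative is written with
  \<open>representative u w\<close> since it has to be jointly measurable, which u itself need not
  be.\<close>

lemma has_H1_deriv_mult:
  assumes H: "has_H1_deriv u w" and M: "ac_mult m m'"
  shows "has_H1_deriv (\<lambda>t x. u t x * m t x)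
    (\<lambda>t x. w t x * m t x + representative u w t x * m' t x)"
proof (rule has_H1_derivI)
  note D = has_H1_derivD[OF H] and R = representative_props[OF H] and N = ac_multD[OF M]
  note [measurable] = D(5) R(1) N(1,2)
  obtain C where C: "0 \<le> C" "\<And>t x. t \<in> {0..1} \<Longrightarrow> x \<in> {0..1} \<Longrightarrow> \<bar>m t x\<bar> \<le> C"
    "\<And>t x. t \<in> {0..1} \<Longrightarrow> x \<in> {0..1} \<Longrightarrow> \<bar>m' t x\<bar> \<le> C"
    using ac_mult_bound[OF M] by blast
  have sq: "(a * b)\<^sup>2 \<le> a\<^sup>2 * C\<^sup>2" if "\<bar>b\<bar> \<le> C" for a b
    using power_mono[OF that, of 2] by (simp add: power_mult_distrib mult_left_mono)
  show "(\<lambda>x. u t x * m t x) \<in> L2" if t: "t \<in> {0..1}" for t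
  proof -
    have m: "(\<lambda>x. u t x * m t x) \<in> borel_measurable I01"
      using D(2)[OF t] N(6)[OF t] by (rule borel_measurable_times)
    have "integrable I01 (\<lambda>x. (u t x * m t x)\<^sup>2)"
    proof (rule Bochner_Integration.integrable_bound)
      show "integrable I01 (\<lambda>x. (u t x)\<^sup>2 * C\<^sup>2)" using D(4)[OF t] by simp
      show "(\<lambda>x. (u t x * m t x)\<^sup>2) \<in> borel_measurable I01" using m by (rule borel_measurable_power)
      show "AE x in I01. norm ((u t x * m t x)\<^sup>2) \<le> norm ((u t x)\<^sup>2 * C\<^sup>2)"
        using sq C(2)[OF t] by (auto intro!: AE_I2)
    qed
    with m show ?thesis by (simp add: L2_def)
  qed
  show m: "(\<lambda>(t, x). w t x * m t x + representative u w t x * m' t x) \<in> borel_measurable I01sq"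
    by measurable
  show "integrable I01sq (\<lambda>(t, x). (w t x * m t x + representative u w t x * m' t x)\<^sup>2)"
  proof (rule Bochner_Integration.integrable_bound)
    show "integrable I01sq (\<lambda>z. (2 * C\<^sup>2) * (\<lambda>(t, x). (w t x)\<^sup>2) z
        + (2 * C\<^sup>2) * (\<lambda>(t, x). (representative u w t x)\<^sup>2) z)"
      using D(6) R(5) by (intro Bochner_Integration.integrable_add integrable_mult_right) auto
    show "(\<lambda>(t, x). (w t x * m t x + representative u w t x * m' t x)\<^sup>2) \<in> borel_measurable I01sq"
      by measurable
    have "(w t x * m t x + representative u w t x * m' t x)\<^sup>2
        \<le> 2 * C\<^sup>2 * (w t x)\<^sup>2 + 2 * C\<^sup>2 * (representative u w t x)\<^sup>2"
      if "t \<in> {0..1}" "x \<in> {0..1}" for t x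
      using sq[OF C(2)[OF that], of "w t x"] sq[OF C(3)[OF that], of "representative u w t x"]
        zero_le_power2[of "w t x * m t x - representative u w t x * m' t x"]
      unfolding power2_sum power2_diff by (simp add: algebra_simps)
    then show "AE z in I01sq. norm (case z of (t, x) \<Rightarrow> (w t x * m t x + representative u w t x * m' t x)\<^sup>2)
      \<le> norm ((2 * C\<^sup>2) * (\<lambda>(t, x). (w t x)\<^sup>2) z
        + (2 * C\<^sup>2) * (\<lambda>(t, x). (representative u w t x)\<^sup>2) z)"
      by (intro AE_I2) (auto simp: space_pair_measure)
  qed
  show "AE x in I01. u t x * m t x = u 0 x * m 0 x
      + cum (\<lambda>s. w s x * m s x + representative u w s x * m' s x) t" if t: "t \<in> {0..1}" for t
    using D(8)[OF t] integrable_abs_section(2)[OF D(7)] AE_space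
  proof eventually_elim
    case (elim x)
    then have x: "x \<in> {0..1}" by simp
    have "u t x * m t x = (u 0 x + cum (\<lambda>s. w s x) t) * (m 0 x + cum (\<lambda>s. m' s x) t)"
      using elim(1) N(3)[OF t x] by presburger
    also have "\<dots> = u 0 x * m 0 x + cum (\<lambda>s. w s x * (m 0 x + cum (\<lambda>s. m' s x) s)
      + (u 0 x + cum (\<lambda>s. w s x) s) * m' s x) t"
      by (rule cum_product_rule[OF elim(2) N(4)[OF x] t])
    also have "cum (\<lambda>s. w s x * (m 0 x + cum (\<lambda>s. m' s x) s)
        + (u 0 x + cum (\<lambda>s. w s x) s) * m' s x) t
      = cum (\<lambda>s. w s x * m s x + representative u w s x * m' s x) t"
      by (rule cum_cong) (simp add: N(3)[OF _ x, symmetric] representative_def)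
    finally show ?case .
  qed
qed

text \<open>At each time the curve equals its primitive only for almost every x. Integrating in
  space removes this exception, so the identity holds for every x.\<close>

lemma cum_H1:
  assumes H: "has_H1_deriv u w" and t: "t \<in> {0..1}"
  shows "cum (u t) x = cum (u 0) x + cum (\<lambda>s. cum (w s) x) t"
proof -
  note D = has_H1_derivD[OF H] and R = representative_props[OF H]
  have i: "integrable I01 (\<lambda>y. cum (\<lambda>s. w s y) t)"
  proof (rule integrable_cong_AE_imp)
    show "integrable I01 (\<lambda>y. u t y - u 0 y)" using D(3)[OF t] D(3)[of 0] by simp
    show "(\<lambda>y. cum (\<lambda>s. w s y) t) \<in> borel_measurable I01" using D(5) by measurable
    show "AE y in I01. u t y - u 0 y = cum (\<lambda>s. w s y) t" using D(8)[OF t] by eventually_elim simp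
  qed
  have "cum (u t) x = cum (\<lambda>y. u 0 y + cum (\<lambda>s. w s y) t) x"
    using D(2)[OF t] D(2)[of 0] i by (intro cum_cong_AE D(8)[OF t]) auto
  also have "\<dots> = cum (u 0) x + cum (\<lambda>y. cum (\<lambda>s. w s y) t) x"
    using D(3)[of 0] i by (intro cum_add) auto
  also have "cum (\<lambda>y. cum (\<lambda>s. w s y) t) x = cum (\<lambda>s. cum (w s) x) t"
    by (rule cum_swap) (use D(7) in simp)
  finally show ?thesis .
qed

lemma cum_H1_props:
  assumes H: "has_H1_deriv u w"
  shows "case_prod (\<lambda>t. cum (u t)) \<in> borel_measurable I01sq"
    and "case_prod (\<lambda>t. cum (w t)) \<in> borel_measurable I01sq"
    and "\<exists>C. \<forall>t\<in>{0..1}. \<forall>x\<in>{0..1}. \<bar>cum (u t) x\<bar> \<le> C"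
    and "continuous_on {0..1} (\<lambda>t. cum (u t) x)"
proof -
  note D = has_H1_derivD[OF H] and R = representative_props[OF H]
  note [measurable] = D(5)
  show m: "case_prod (\<lambda>t. cum (w t)) \<in> borel_measurable I01sq"
    by measurable
  have [measurable]: "u 0 \<in> borel_measurable I01" using D(2) by simp
  have "(\<lambda>(t, x). cum (u 0) x + cum (\<lambda>s. cum (w s) x) t) \<in> borel_measurable I01sq"
    by measurable
  then show "case_prod (\<lambda>t. cum (u t)) \<in> borel_measurable I01sq"
    by (rule measurable_cong[THEN iffD1, rotated])
       (auto simp: space_pair_measure intro: cum_H1[OF H, symmetric])
  have b: "AE s in I01. \<forall>x. \<bar>cum (w s) x\<bar> \<le> (\<integral>y. \<bar>w s y\<bar> \<partial>I01)"
    using integrable_abs_section(3)[OF D(7)] by eventually_elim (simp add: abs_cum_le)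
  have ib: "integrable I01 (\<lambda>s. \<integral>y. \<bar>w s y\<bar> \<partial>I01)"
  proof -
    have "integrable I01sq (\<lambda>z. \<bar>case_prod w z\<bar>)" using D(7) by (rule integrable_abs)
    then have "integrable I01sq (\<lambda>(s, x). \<bar>w s x\<bar>)" by (simp add: case_prod_unfold)
    from I01I01.integrable_fst[OF this] show ?thesis .
  qed
  have iw: "integrable I01 (\<lambda>s. cum (w s) x)" for x
  proof (rule Bochner_Integration.integrable_bound[OF ib])
    show "(\<lambda>s. cum (w s) x) \<in> borel_measurable I01" by measurable
    show "AE s in I01. norm (cum (w s) x) \<le> norm (\<integral>y. \<bar>w s y\<bar> \<partial>I01)"
      using b by eventually_elim simp
  qed
  show "\<exists>C. \<forall>t\<in>{0..1}. \<forall>x\<in>{0..1}. \<bar>cum (u t) x\<bar> \<le> C"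
  proof (intro exI ballI)
    fix t x :: real assume t: "t \<in> {0..1}" and x: "x \<in> {0..1}"
    have "\<bar>cum (\<lambda>s. cum (w s) x) t\<bar> \<le> (\<integral>s. \<bar>cum (w s) x\<bar> \<partial>I01)" by (rule abs_cum_le[OF iw])
    also have "\<dots> \<le> (\<integral>s. (\<integral>y. \<bar>w s y\<bar> \<partial>I01) \<partial>I01)"
    proof (rule integral_mono_AE)
      show "integrable I01 (\<lambda>s. \<bar>cum (w s) x\<bar>)" using iw by (rule integrable_abs)
      show "AE s in I01. \<bar>cum (w s) x\<bar> \<le> (\<integral>y. \<bar>w s y\<bar> \<partial>I01)"
        using b by eventually_elim simp
    qed (rule ib)
    moreover have "\<bar>cum (u 0) x\<bar> \<le> (\<integral>y. \<bar>u 0 y\<bar> \<partial>I01)" using D(3)[of 0] by (intro abs_cum_le) simp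
    ultimately show "\<bar>cum (u t) x\<bar> \<le> (\<integral>y. \<bar>u 0 y\<bar> \<partial>I01) + (\<integral>s. (\<integral>y. \<bar>w s y\<bar> \<partial>I01) \<partial>I01)"
      unfolding cum_H1[OF H t, of x] by linarith
  qed
  have "continuous_on {0..1} (\<lambda>t. cum (u 0) x + cum (\<lambda>s. cum (w s) x) t)"
    by (intro continuous_intros continuous_on_cum iw)
  then show "continuous_on {0..1} (\<lambda>t. cum (u t) x)"
    by (rule continuous_on_cong[THEN iffD1, rotated 2]) (auto intro: cum_H1[OF H, symmetric])
qed

lemma AE_integral_deriv_eq_0:
  assumes H: "has_H1_deriv u w" and z: "\<And>t. t \<in> {0..1} \<Longrightarrow> integral\<^sup>L I01 (u t) = 0"
  shows "AE t in I01. integral\<^sup>L I01 (w t) = 0"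
proof (rule AE_zero_of_cum_zero)
  note D = has_H1_derivD[OF H]
  show "integrable I01 (\<lambda>t. integral\<^sup>L I01 (w t))"
    using I01I01.integrable_fst[of w] D(7) by simp
  fix t :: real assume t: "t \<in> {0..1}"
  show "cum (\<lambda>t. integral\<^sup>L I01 (w t)) t = 0"
    using cum_H1[OF H t, of 1] z[OF t] z[of 0] by (simp add: cum_1)
qed

text \<open>Differentiates in time a linear constraint that holds at all times. The representative
  can be replaced by u again, because at a fixed t the two agree almost everywhere and only
  integrals in x remain.\<close>

lemma AE_integral_mult_deriv:
  assumes H: "has_H1_deriv u w" and M: "ac_mult m m'"
    and z: "\<And>t. t \<in> {0..1} \<Longrightarrow> (\<integral>x. u t x * m t x \<partial>I01) = 0"
  shows "AE t in I01. (\<integral>x. w t x * m t x \<partial>I01) + (\<integral>x. u t x * m' t x \<partial>I01) = 0"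
proof -
  have "AE t in I01. (\<integral>x. w t x * m t x + representative u w t x * m' t x \<partial>I01) = 0"
    by (rule AE_integral_deriv_eq_0[OF has_H1_deriv_mult[OF H M]]) (rule z)
  then show ?thesis
    using integrable_abs_section(3)[OF has_H1_derivD(7)[OF H]] AE_space
proof eventually_elim
  case (elim t)
  note D = has_H1_derivD[OF H] and R = representative_props[OF H] and N = ac_multD[OF M]
  have t: "t \<in> {0..1}" using elim by simp
  obtain C where C: "0 \<le> C" "\<And>t x. t \<in> {0..1} \<Longrightarrow> x \<in> {0..1} \<Longrightarrow> \<bar>m t x\<bar> \<le> C"
    "\<And>t x. t \<in> {0..1} \<Longrightarrow> x \<in> {0..1} \<Longrightarrow> \<bar>m' t x\<bar> \<le> C"
    using ac_mult_bound[OF M] by blast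
  have i1: "integrable I01 (\<lambda>x. w t x * m t x)"
    by (rule integrable_mult_bounded[OF elim(2) N(6)[OF t], of C]) (use C t in auto)
  have i2: "integrable I01 (\<lambda>x. u t x * m' t x)"
    by (rule integrable_mult_bounded[OF D(3)[OF t] N(7)[OF t], of C]) (use C t in auto)
  note [measurable] = R(3)[OF t] N(7)[OF t] D(2)[OF t] N(6)[OF t]
  have wt[measurable]: "w t \<in> borel_measurable I01" using elim(2) by auto
  have "(\<integral>x. w t x * m t x + representative u w t x * m' t x \<partial>I01)
      = (\<integral>x. w t x * m t x + u t x * m' t x \<partial>I01)"
  proof (rule integral_cong_AE)
    show "AE x in I01. w t x * m t x + representative u w t x * m' t x = w t x * m t x + u t x * m' t x"
      using R(2)[OF t] by eventually_elim simp
  qed measurable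
  also have "\<dots> = (\<integral>x. w t x * m t x \<partial>I01) + (\<integral>x. u t x * m' t x \<partial>I01)"
    by (rule Bochner_Integration.integral_add[OF i1 i2])
  finally show ?case using elim(1) by simp
qed
qed

section \<open>The projection onto \<open>T\<^sup>*Q\<close>\<close>

lemma phi_eq_cum: "phi q x = cum (eta q) x" if "x \<in> {0..1}"
  using that by (simp add: phi_def set_integral_eq_cum)

lemma eta_eq_exp: "eta q x = exp (cum q x)" if "x \<in> {0..1}"
  using that by (simp add: eta_def set_integral_eq_cum)

lemma eta_pos [simp]: "0 < eta q x"
  by (simp add: eta_def)

lemma inner_eta_eq: "inner_eta q f g = (\<integral>x. f x * g x * eta q x \<partial>I01)"
  by (simp add: inner_eta_def integral_I01)

lemma L2_integrable: "integrable I01 f" "f \<in> borel_measurable I01" if "f \<in> L2"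
proof -
  have *: "f \<in> borel_measurable I01" "integrable I01 (\<lambda>x. (f x)\<^sup>2)"
    using that by (auto simp: L2_def)
  show "integrable I01 f" by (rule integrable_of_square[OF finite_measure_I01 *])
  show "f \<in> borel_measurable I01" by (rule *(1))
qed

lemma QD:
  assumes "q \<in> Q"
  shows "integrable I01 q" "continuous_on {0..1} (eta q)" "integrable I01 (eta q)"
    "continuous_on {0..1} (phi q)" "phi q 0 = 0" "phi q 1 = 1" "integral\<^sup>L I01 (eta q) = 1"
    "eta q \<in> borel_measurable I01" "phi q \<in> borel_measurable I01"
proof -
  show q: "integrable I01 q" using assms L2_integrable by (auto simp: Q_def)
  have "continuous_on {0..1} (\<lambda>x. exp (cum q x))"
    by (intro continuous_intros continuous_on_cum q)
  then show e: "continuous_on {0..1} (eta q)"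
    by (rule continuous_on_cong[THEN iffD1, rotated 2]) (simp_all add: eta_eq_exp)
  then show i: "integrable I01 (eta q)" by (rule continuous_imp_integrable_I01)
  have "continuous_on {0..1} (cum (eta q))" by (rule continuous_on_cum[OF i])
  then show p: "continuous_on {0..1} (phi q)"
    by (rule continuous_on_cong[THEN iffD1, rotated 2]) (simp_all add: phi_eq_cum)
  show "integral\<^sup>L I01 (eta q) = 1" using assms by (simp add: Q_def integral_I01)
  then show "phi q 1 = 1" by (simp add: phi_eq_cum cum_1)
  show "phi q 0 = 0" by (simp add: phi_eq_cum cum_0)
  show "eta q \<in> borel_measurable I01" using i by auto
  show "phi q \<in> borel_measurable I01" using continuous_imp_integrable_I01[OF p] by auto
qed

text \<open>phi is the primitive of eta and runs from 0 to 1, so the integral of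
  \<open>eta * phi^k\<close> is 1/(k+1). With the normalisation of eta, these are the entries of
  \<open>H2\<close>: it is the Gram matrix of 1 and phi for \<open>inner_eta\<close>.\<close>

lemma eta_moments:
  assumes q: "q \<in> Q"
  shows "(\<integral>x. eta q x * phi q x \<partial>I01) = 1/2" "(\<integral>x. eta q x * (phi q x)\<^sup>2 \<partial>I01) = 1/3"
proof -
  note e = QD(3)[OF q]
  have s: "phi q x * phi q x = cum (\<lambda>s. 2 * (eta q s * phi q s)) x" if x: "x \<in> {0..1}" for x
  proof -
    have "phi q x * phi q x = cum (\<lambda>s. eta q s * cum (eta q) s + cum (eta q) s * eta q s) x"
      using cum_mult_cum[OF e e x] x by (simp add: phi_eq_cum)
    also have "\<dots> = cum (\<lambda>s. 2 * (eta q s * phi q s)) x"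
      by (rule cum_cong) (use x in \<open>auto simp: phi_eq_cum\<close>)
    finally show ?thesis .
  qed
  have i: "integrable I01 (\<lambda>s. eta q s * phi q s)"
    by (rule continuous_imp_integrable_I01) (intro continuous_intros QD(2,4)[OF q])
  show m1: "(\<integral>x. eta q x * phi q x \<partial>I01) = 1/2"
    using s[of 1] QD(6)[OF q] by (simp add: cum_cmult cum_1)
  have "phi q 1 * phi q 1 * phi q 1
      = cum (\<lambda>s. 2 * (eta q s * phi q s)) 1 * cum (eta q) 1"
    using s[of 1] by (simp add: phi_eq_cum)
  also have "\<dots> = cum (\<lambda>s. 2 * (eta q s * phi q s) * cum (eta q) s
      + cum (\<lambda>s. 2 * (eta q s * phi q s)) s * eta q s) 1"
    by (rule cum_mult_cum) (use i e in auto)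
  also have "\<dots> = cum (\<lambda>s. 3 * (eta q s * (phi q s)\<^sup>2)) 1"
    by (rule cum_cong) (simp add: s[symmetric] phi_eq_cum[symmetric] power2_eq_square)
  finally show "(\<integral>x. eta q x * (phi q x)\<^sup>2 \<partial>I01) = 1/3"
    using QD(6)[OF q] by (simp add: cum_cmult cum_1)
qed

lemma matrix_inv_H2: "matrix_inv H2 = vector [vector [4, -6], vector [-6, 12]]"
proof -
  let ?B = "vector [vector [4, -6], vector [-6, 12]] :: real^2^2"
  have B: "H2 ** ?B = mat 1" "?B ** H2 = mat 1"
    by (simp_all add: H2_def matrix_matrix_mult_def vec_eq_iff sum_2 forall_2 mat_def vector_2)
  show ?thesis
    unfolding matrix_inv_def
  proof (rule some_equality)
    fix A assume "H2 ** A = mat 1 \<and> A ** H2 = mat 1"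
    then show "A = ?B" using B by (metis matrix_mul_assoc matrix_mul_lid matrix_mul_rid)
  qed (use B in simp)
qed

lemma row_H2_eq: "row_H2 q a b x = (4 * a - 6 * b) + phi q x * (12 * b - 6 * a)"
  by (simp add: row_H2_def matrix_inv_H2 inner_vec_def matrix_vector_mult_def sum_2 vector_2)

lemma integrable_mult_continuous:
  fixes f g :: "real \<Rightarrow> real"
  assumes f: "integrable I01 f" and g: "continuous_on {0..1} g"
  shows "integrable I01 (\<lambda>x. f x * g x)"
proof -
  have "compact (g ` {0..1})" by (intro compact_continuous_image g) simp
  then obtain C where "\<And>y. y \<in> g ` {0..1} \<Longrightarrow> \<bar>y\<bar> \<le> C"
    using compact_imp_bounded bounded_real by metis
  then show ?thesis
    using continuous_imp_integrable_I01[OF g] by (intro integrable_mult_bounded[OF f, of _ C]) auto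
qed

text \<open>Since \<open>H2\<close> is the Gram matrix of 1 and phi, applying its inverse solves for
  the combination of 1 and phi with the prescribed inner products a and b.\<close>

lemma inner_eta_row_H2:
  assumes q: "q \<in> Q"
  shows "inner_eta q (row_H2 q a b) (\<lambda>_. 1) = a" "inner_eta q (row_H2 q a b) (phi q) = b"
    and "continuous_on {0..1} (row_H2 q a b)"
proof -
  note e = QD(3)[OF q]
  have i: "integrable I01 (\<lambda>s. eta q s * phi q s)" "integrable I01 (\<lambda>s. eta q s * (phi q s)\<^sup>2)"
    by (auto intro!: continuous_imp_integrable_I01 continuous_intros QD(2,4)[OF q])
  have "inner_eta q (row_H2 q a b) (\<lambda>_. 1)
      = (\<integral>x. (4 * a - 6 * b) * eta q x + (12 * b - 6 * a) * (eta q x * phi q x) \<partial>I01)"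
    unfolding inner_eta_eq row_H2_eq
    by (rule Bochner_Integration.integral_cong) (simp_all add: algebra_simps)
  also have "\<dots> = (4 * a - 6 * b) * 1 + (12 * b - 6 * a) * (1/2)"
    using i e eta_moments[OF q] QD(7)[OF q] by simp
  also have "\<dots> = a" by (simp add: algebra_simps)
  finally show "inner_eta q (row_H2 q a b) (\<lambda>_. 1) = a" .
  have "inner_eta q (row_H2 q a b) (phi q)
      = (\<integral>x. (4 * a - 6 * b) * (eta q x * phi q x) + (12 * b - 6 * a) * (eta q x * (phi q x)\<^sup>2) \<partial>I01)"
    unfolding inner_eta_eq row_H2_eq
    by (rule Bochner_Integration.integral_cong) (simp_all add: algebra_simps power2_eq_square)
  also have "\<dots> = (4 * a - 6 * b) * (1/2) + (12 * b - 6 * a) * (1/3)"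
    using i by (simp add: eta_moments[OF q] del: times_divide_eq_right)
  also have "\<dots> = b" by (simp add: algebra_simps)
  finally show "inner_eta q (row_H2 q a b) (phi q) = b" .
  show "continuous_on {0..1} (row_H2 q a b)"
    unfolding row_H2_eq[abs_def] by (intro continuous_intros QD(4)[OF q])
qed

lemma integrable_inner_eta:
  assumes q: "q \<in> Q" and f: "integrable I01 f" and g: "continuous_on {0..1} g"
  shows "integrable I01 (\<lambda>x. f x * g x * eta q x)"
  by (intro integrable_mult_continuous f g QD(2)[OF q])

lemma inner_eta_diff:
  assumes "integrable I01 (\<lambda>x. f x * h x * eta q x)" "integrable I01 (\<lambda>x. g x * h x * eta q x)"
  shows "inner_eta q (\<lambda>x. f x - g x) h = inner_eta q f h - inner_eta q g h"
    "inner_eta q (\<lambda>x. f x + g x) h = inner_eta q f h + inner_eta q g h"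
  using assms by (simp_all add: inner_eta_eq algebra_simps flip: Bochner_Integration.integral_diff Bochner_Integration.integral_add)

lemma inner_eta_pi_star:
  assumes q: "q \<in> Q" and f: "integrable I01 f"
  shows "inner_eta q (pi_star q f) (\<lambda>_. 1) = 0" "inner_eta q (pi_star q f) (phi q) = 0"
    and "integrable I01 (pi_star q f)"
proof -
  let ?r = "row_H2 q (inner_eta q f (\<lambda>_. 1)) (inner_eta q f (phi q))"
  have r: "integrable I01 ?r"
    by (intro continuous_imp_integrable_I01 inner_eta_row_H2(3)[OF q])
  show "inner_eta q (pi_star q f) (\<lambda>_. 1) = 0"
    unfolding pi_star_def[abs_def]
    by (subst inner_eta_diff(1)[OF integrable_inner_eta[OF q f] integrable_inner_eta[OF q r]])
       (auto simp: inner_eta_row_H2[OF q])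
  show "inner_eta q (pi_star q f) (phi q) = 0"
    unfolding pi_star_def[abs_def]
    by (subst inner_eta_diff(1)[OF integrable_inner_eta[OF q f] integrable_inner_eta[OF q r]])
       (auto simp: inner_eta_row_H2[OF q] QD(4)[OF q])
  show "integrable I01 (pi_star q f)"
    unfolding pi_star_def[abs_def] using f r by simp
qed

text \<open>\<open>pi_star\<close> changes f only by a combination of 1 and phi, and a is orthogonal
  to both.\<close>

lemma inner_eta_pi_star_orthogonal:
  assumes q: "q \<in> Q" and a: "integrable I01 a"
    and o: "inner_eta q a (\<lambda>_. 1) = 0" "inner_eta q a (phi q) = 0"
    and i: "integrable I01 (\<lambda>x. a x * f x * eta q x)"
  shows "inner_eta q a (pi_star q f) = inner_eta q a f"
proof -
  define A where "A = 4 * inner_eta q f (\<lambda>_. 1) - 6 * inner_eta q f (phi q)"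
  define B where "B = 12 * inner_eta q f (phi q) - 6 * inner_eta q f (\<lambda>_. 1)"
  have i1: "integrable I01 (\<lambda>x. a x * 1 * eta q x)" and i2: "integrable I01 (\<lambda>x. a x * phi q x * eta q x)"
    by (rule integrable_inner_eta[OF q a]; simp add: QD(4)[OF q])+
  have "inner_eta q a (pi_star q f) = (\<integral>x. a x * f x * eta q x - A * (a x * 1 * eta q x)
      - B * (a x * phi q x * eta q x) \<partial>I01)"
    unfolding inner_eta_eq[of q a] pi_star_def row_H2_eq A_def B_def
    by (rule Bochner_Integration.integral_cong) (simp_all add: algebra_simps)
  also have "\<dots> = inner_eta q a f - A * inner_eta q a (\<lambda>_. 1) - B * inner_eta q a (phi q)"
    using i i1 i2 by (simp add: inner_eta_eq)
  finally show ?thesis using o by simp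
qed

section \<open>Substitution by phi and the coefficient b\<close>

lemma phi_strict_mono:
  assumes q: "q \<in> Q"
  shows "strict_mono_on {0..1} (phi q)" "phi q ` {0..1} = {0..1}" "inj_on (phi q) {0..1}"
proof -
  have "(cum (eta q) has_real_derivative eta q x) (at x within {0..1})" if "x \<in> {0..1}" for x
    using cum_has_vector_derivative[OF QD(2)[OF q] that]
    by (simp add: has_real_derivative_iff_has_vector_derivative)
  then have d: "(cum (eta q) has_real_derivative eta q x) (at x)" if "0 < x" "x < 1" for x
    using that by (metis at_within_Icc_at atLeastAtMost_iff less_imp_le)
  have "cum (eta q) x < cum (eta q) y" if "x < y" "x \<in> {0..1}" "y \<in> {0..1}" for x y
  proof (rule DERIV_pos_imp_increasing_open[OF \<open>x < y\<close>])
    fix z assume "x < z" "z < y"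
    then show "\<exists>l. (cum (eta q) has_real_derivative l) (at z) \<and> 0 < l"
      using d[of z] that by (intro exI[of _ "eta q z"]) auto
  next
    show "continuous_on {x..y} (cum (eta q))"
      using that by (intro continuous_on_subset[OF continuous_on_cum[OF QD(3)[OF q]]]) auto
  qed
  then show m: "strict_mono_on {0..1} (phi q)"
    by (auto simp: strict_mono_on_def phi_eq_cum)
  show "inj_on (phi q) {0..1}" by (rule strict_mono_on_imp_inj_on[OF m])
  show "phi q ` {0..1} = {0..1}"
  proof
    show "phi q ` {0..1} \<subseteq> {0..1}"
      using strict_mono_on_leD[OF m, of 0] strict_mono_on_leD[OF m, of _ 1] QD(5,6)[OF q] by auto
    show "{0..1} \<subseteq> phi q ` {0..1}"
    proof
      fix y :: real assume "y \<in> {0..1}"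
      with IVT'[of "phi q" 0 y 1] QD(4-6)[OF q] obtain x where "0 \<le> x" "x \<le> 1" "phi q x = y" by auto
      then show "y \<in> phi q ` {0..1}" by (intro image_eqI[of _ _ x]) auto
    qed
  qed
qed

text \<open>The substitution \<open>y = phi x\<close>, \<open>dy = eta dx\<close>, as an identity of
  measures, so that it applies to integrands without any continuity. It is checked on the intervals
  from 0 to b, whose preimages are again intervals from 0 by monotonicity.\<close>

lemma distr_phi:
  assumes q: "q \<in> Q"
  shows "distr (density I01 (\<lambda>x. ennreal (eta q x))) I01 (phi q) = I01"
    and "phi q \<in> I01 \<rightarrow>\<^sub>M I01"
proof -
  note [measurable] = QD(8)[OF q]
  note P = phi_strict_mono[OF q]
  show ph[measurable]: "phi q \<in> I01 \<rightarrow>\<^sub>M I01"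
    using QD(9)[OF q] P(2) by (auto intro!: measurable_restrict_space2)
  have fin: "finite_measure (density I01 (\<lambda>x. ennreal (eta q x)))"
  proof (rule finite_measureI)
    have "emeasure (density I01 (\<lambda>x. ennreal (eta q x))) (space I01)
        = (\<integral>\<^sup>+x. ennreal (eta q x) * indicator (space I01) x \<partial>I01)"
      by (rule emeasure_density) measurable
    also have "\<dots> = (\<integral>\<^sup>+x. ennreal (eta q x) \<partial>I01)"
      by (rule nn_integral_cong) simp
    also have "\<dots> = ennreal (integral\<^sup>L I01 (eta q))"
      by (rule nn_integral_eq_integral[OF QD(3)[OF q]]) (auto intro!: AE_I2 simp: less_imp_le)
    finally show "emeasure (density I01 (\<lambda>x. ennreal (eta q x))) (space (density I01 (\<lambda>x. ennreal (eta q x)))) \<noteq> \<infinity>"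
      by simp
  qed
  show "distr (density I01 (\<lambda>x. ennreal (eta q x))) I01 (phi q) = I01"
  proof (rule measure_eqI_I01)
    show "finite_measure (distr (density I01 (\<lambda>x. ennreal (eta q x))) I01 (phi q))"
      by (rule finite_measure.finite_measure_distr[OF fin]) (simp add: ph)
    fix b :: real assume b: "b \<in> {0..1}"
    then have "b \<in> phi q ` {0..1}" by (simp only: P(2))
    then obtain a where a: "a \<in> {0..1}" "phi q a = b" by (elim imageE) simp
    have s: "{0..b} \<in> sets I01" "{0..a} \<in> sets I01" using b a(1) by (auto simp: sets_restrict_space_iff)
    have "phi q -` {0..b} \<inter> {0..1} = {0..a}"
    proof -
      have "phi q x \<le> b \<longleftrightarrow> x \<le> a" if "x \<in> {0..1}" for x
        using strict_mono_on_less_eq[OF P(1) that a(1)] a(2) by simp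
      moreover have "0 \<le> phi q x" if "x \<in> {0..1}" for x
        using imageI[OF that, of "phi q"] unfolding P(2) by simp
      ultimately show ?thesis using a(1) by force
    qed
    then have "emeasure (distr (density I01 (\<lambda>x. ennreal (eta q x))) I01 (phi q)) {0..b}
        = emeasure (density I01 (\<lambda>x. ennreal (eta q x))) {0..a}"
      using s by (subst emeasure_distr) (auto simp: ph)
    also have "\<dots> = (\<integral>\<^sup>+x. ennreal (indicator {0..a} x * eta q x) \<partial>I01)"
      using s by (subst emeasure_density) (auto intro!: nn_integral_cong simp: indicator_def)
    also have "\<dots> = ennreal (cum (eta q) a)"
      unfolding cum_def using integrable_indicator_mult[OF QD(3)[OF q]]
      by (intro nn_integral_eq_integral) (auto simp: less_imp_le intro!: AE_I2)
    also have "\<dots> = emeasure I01 {0..b}"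
      using a b s by (simp add: phi_eq_cum emeasure_restrict_space)
    finally show "emeasure (distr (density I01 (\<lambda>x. ennreal (eta q x))) I01 (phi q)) {0..b}
        = emeasure I01 {0..b}" .
  qed simp_all
qed

lemma integral_subst_phi:
  fixes f :: "real \<Rightarrow> real"
  assumes q: "q \<in> Q" and f[measurable]: "f \<in> borel_measurable I01"
  shows "integral\<^sup>L I01 f = (\<integral>x. eta q x * f (phi q x) \<partial>I01)"
proof -
  note [measurable] = QD(8)[OF q] distr_phi(2)[OF q]
  have "integral\<^sup>L I01 f = integral\<^sup>L (distr (density I01 (\<lambda>x. ennreal (eta q x))) I01 (phi q)) f"
    by (simp add: distr_phi(1)[OF q])
  also have "\<dots> = (\<integral>x. f (phi q x) \<partial>density I01 (\<lambda>x. ennreal (eta q x)))"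
    by (rule integral_distr) (simp_all add: distr_phi(2)[OF q] f)
  also have "\<dots> = (\<integral>x. eta q x * f (phi q x) \<partial>I01)"
    by (subst integral_density) (auto simp: less_imp_le intro!: AE_I2)
  finally show ?thesis .
qed

text \<open>The substitution is used twice, in the inner primitive and in the outer integral, and
  eliminates the inverse of phi. With \<open>V\<close> as the primitive of \<open>eta * p\<close>,
  the coefficient becomes 3/2 times the integral of \<open>eta * V^2\<close>.\<close>

lemma b_coeff_eq:
  assumes q: "q \<in> Q" and p: "p \<in> L2"
  shows "b_coeff p q = 3/2 * (\<integral>x. eta q x * (cum (\<lambda>y. eta q y * p y) x)\<^sup>2 \<partial>I01)"
proof -
  note [measurable] = QD(8)[OF q] distr_phi(2)[OF q] L2_integrable(2)[OF p]
  note P = phi_strict_mono[OF q]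
  define i where "i = inv_into {0..1} (phi q)"
  \<comment> \<open>Continuity of the inverse is wanted only for the measurability of its
    composition with p.\<close>
  have ci: "continuous_on {0..1} i"
  proof -
    have "continuous_on {0..1} (the_inv_into {0..1} (phi q))"
      using continuous_on_inv_into[OF QD(4)[OF q] _ P(3)] by (simp add: P(2))
    moreover have "the_inv_into {0..1} (phi q) y = i y" if "y \<in> {0..1}" for y
    proof -
      have y: "y \<in> phi q ` {0..1}" using that by (simp only: P(2))
      show ?thesis
        unfolding i_def using the_inv_into_f_f[OF P(3) inv_into_into[OF y]] f_inv_into_f[OF y] by simp
    qed
    ultimately show ?thesis by (rule continuous_on_eq)
  qed
  have i01: "i x \<in> {0..1}" if "x \<in> {0..1}" for x
    unfolding i_def by (rule inv_into_into) (use that in \<open>simp only: P(2)\<close>)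
  have iphi: "i (phi q x) = x" if "x \<in> {0..1}" for x
    unfolding i_def by (rule inv_into_f_f[OF P(3) that])
  have [measurable]: "i \<in> I01 \<rightarrow>\<^sub>M I01"
    using continuous_imp_integrable_I01[OF ci] i01 by (intro measurable_restrict_space2) auto
  have pi[measurable]: "(\<lambda>x. p (i x)) \<in> borel_measurable I01" by measurable
  have phi01: "phi q x \<in> {0..1}" if "x \<in> {0..1}" for x
    using imageI[OF that, of "phi q"] unfolding P(2) .
  have *: "cum (\<lambda>y. p (i y)) (phi q x) = cum (\<lambda>y. eta q y * p y) x" if x: "x \<in> {0..1}" for x
  proof -
    have "cum (\<lambda>y. p (i y)) (phi q x)
        = (\<integral>y. eta q y * (indicator {0..phi q x} (phi q y) * p (i (phi q y))) \<partial>I01)"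
      unfolding cum_def by (rule integral_subst_phi[OF q]) measurable
    also have "\<dots> = cum (\<lambda>y. eta q y * p y) x"
      unfolding cum_def
    proof (rule Bochner_Integration.integral_cong[OF refl])
      fix y assume "y \<in> space I01"
      then have y: "y \<in> {0..1}" by simp
      have "(indicator {0..phi q x} (phi q y) :: real) = indicator {0..x} y"
        using strict_mono_on_less_eq[OF P(1) y x] phi01[OF y] y by (auto simp: indicator_def)
      then show "eta q y * (indicator {0..phi q x} (phi q y) * p (i (phi q y)))
          = indicator {0..x} y * (eta q y * p y)"
        using iphi[OF y] by simp
    qed
    finally show ?thesis .
  qed
  have "b_coeff p q = 3/2 * (\<integral>x. (cum (\<lambda>y. p (i y)) x)\<^sup>2 \<partial>I01)"
    unfolding b_coeff_def integral_I01[symmetric] i_def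
    by (intro arg_cong2[of _ _ _ _ "(*)"] refl Bochner_Integration.integral_cong)
       (simp_all add: set_integral_eq_cum)
  also have "(\<integral>x. (cum (\<lambda>y. p (i y)) x)\<^sup>2 \<partial>I01)
      = (\<integral>x. eta q x * (cum (\<lambda>y. p (i y)) (phi q x))\<^sup>2 \<partial>I01)"
    by (rule integral_subst_phi[OF q]) measurable
  also have "\<dots> = (\<integral>x. eta q x * (cum (\<lambda>y. eta q y * p y) x)\<^sup>2 \<partial>I01)"
    by (rule Bochner_Integration.integral_cong) (simp_all add: *)
  finally show ?thesis .
qed

lemma ac_mult_cong:
  assumes M: "ac_mult m m'"
    and eq: "\<And>t x. t \<in> {0..1} \<Longrightarrow> x \<in> {0..1} \<Longrightarrow> m t x = n t x"
      "\<And>t x. t \<in> {0..1} \<Longrightarrow> x \<in> {0..1} \<Longrightarrow> m' t x = n' t x"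
  shows "ac_mult n n'"
  unfolding ac_mult_def
proof (intro conjI ballI)
  note N = ac_multD[OF M]
  show "case_prod n \<in> borel_measurable I01sq"
    using N(1) by (rule measurable_cong[THEN iffD1, rotated]) (auto simp: space_pair_measure eq)
  show "case_prod n' \<in> borel_measurable I01sq"
    using N(2) by (rule measurable_cong[THEN iffD1, rotated]) (auto simp: space_pair_measure eq)
  obtain C where C: "0 \<le> C" "\<And>t x. t \<in> {0..1} \<Longrightarrow> x \<in> {0..1} \<Longrightarrow> \<bar>m t x\<bar> \<le> C"
    "\<And>t x. t \<in> {0..1} \<Longrightarrow> x \<in> {0..1} \<Longrightarrow> \<bar>m' t x\<bar> \<le> C"
    using ac_mult_bound[OF M] by blast
  show "\<exists>C. \<forall>t\<in>{0..1}. \<forall>x\<in>{0..1}. \<bar>n t x\<bar> \<le> C \<and> \<bar>n' t x\<bar> \<le> C"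
    using C(2,3) eq by (intro exI[of _ C]) auto
  fix t x :: real assume t: "t \<in> {0..1}" and x: "x \<in> {0..1}"
  have "cum (\<lambda>s. m' s x) t = cum (\<lambda>s. n' s x) t"
    by (rule cum_cong, rule eq(2)) (use x in auto)
  then show "n t x = n 0 x + cum (\<lambda>s. n' s x) t"
    using N(3)[OF t x] eq(1)[OF t x] eq(1)[OF _ x, of 0] by simp
qed

section \<open>The covariant derivative lies in \<open>T\<^sup>*Q\<close>\<close>

text \<open>\<open>v\<close> is the velocity of q and \<open>w\<close> its time derivative.
  \<open>v\<close> is kept apart from \<open>eta * p\<close>, with which it agrees at each time only
  up to a null set of x; the space primitive \<open>V\<close> removes that ambiguity.\<close>

locale curve =
  fixes p q v w :: "real \<Rightarrow> real \<Rightarrow> real"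
  assumes q_H1: "has_H1_deriv q v" and v_H1: "has_H1_deriv v w"
    and q_Q: "\<And>t. t \<in> {0..1} \<Longrightarrow> q t \<in> Q"
    and p_TQ: "\<And>t. t \<in> {0..1} \<Longrightarrow> p t \<in> TstarQ (q t)"
    and v_eq: "\<And>t. t \<in> {0..1} \<Longrightarrow> AE x in I01. v t x = eta (q t) x * p t x"
begin

abbreviation V :: "real \<Rightarrow> real \<Rightarrow> real" where
  "V t \<equiv> cum (v t)"

lemma p_L2: "p t \<in> L2" if "t \<in> {0..1}"
  using p_TQ[OF that] by (simp add: TstarQ_def)

lemma ac_mult_log_eta: "ac_mult (\<lambda>t. cum (q t)) V"
  unfolding ac_mult_def
proof (intro conjI ballI)
  show "case_prod (\<lambda>t. cum (q t)) \<in> borel_measurable I01sq"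
    "case_prod V \<in> borel_measurable I01sq"
    using cum_H1_props(1,2)[OF q_H1] .
  obtain A B where "\<forall>t\<in>{0..1}. \<forall>x\<in>{0..1}. \<bar>cum (q t) x\<bar> \<le> A"
    "\<forall>t\<in>{0..1}. \<forall>x\<in>{0..1}. \<bar>V t x\<bar> \<le> B"
    using cum_H1_props(3)[OF q_H1] cum_H1_props(3)[OF v_H1] by blast
  then show "\<exists>C. \<forall>t\<in>{0..1}. \<forall>x\<in>{0..1}. \<bar>cum (q t) x\<bar> \<le> C \<and> \<bar>V t x\<bar> \<le> C"
    by (intro exI[of _ "max A B"]) (simp add: le_max_iff_disj)
  fix t x :: real assume t: "t \<in> {0..1}" and x: "x \<in> {0..1}"
  show "cum (q t) x = cum (q 0) x + cum (\<lambda>s. V s x) t"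
    by (rule cum_H1[OF q_H1 t])
qed

lemma V_cont: "continuous_on {0..1} (\<lambda>t. V t x)"
  by (rule cum_H1_props(4)[OF v_H1])

lemma ac_mult_eta: "ac_mult (\<lambda>t. eta (q t)) (\<lambda>t x. V t x * eta (q t) x)"
  by (rule ac_mult_cong[OF ac_mult_exp[OF ac_mult_log_eta V_cont, of 1]]) (simp_all add: eta_eq_exp)

lemma ac_mult_inverse_eta:
  "ac_mult (\<lambda>t x. inverse (eta (q t) x)) (\<lambda>t x. - V t x * inverse (eta (q t) x))"
  by (rule ac_mult_cong[OF ac_mult_exp[OF ac_mult_log_eta V_cont, of "-1"]])
     (simp_all add: eta_eq_exp exp_minus)

lemma ac_mult_phi: "ac_mult (\<lambda>t. phi (q t)) (\<lambda>t. cum (\<lambda>y. V t y * eta (q t) y))"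
  by (rule ac_mult_cong[OF ac_mult_cum[OF ac_mult_eta]]) (simp_all add: phi_eq_cum)

lemma eta_bounds:
  obtains C where "0 < C" "\<And>t x. t \<in> {0..1} \<Longrightarrow> x \<in> {0..1} \<Longrightarrow> eta (q t) x \<le> C"
    "\<And>t x. t \<in> {0..1} \<Longrightarrow> x \<in> {0..1} \<Longrightarrow> inverse (eta (q t) x) \<le> C"
proof -
  obtain A where A: "0 \<le> A" "\<And>t x. t \<in> {0..1} \<Longrightarrow> x \<in> {0..1} \<Longrightarrow> \<bar>eta (q t) x\<bar> \<le> A"
    "\<And>t x. t \<in> {0..1} \<Longrightarrow> x \<in> {0..1} \<Longrightarrow> \<bar>V t x * eta (q t) x\<bar> \<le> A"
    using ac_mult_bound[OF ac_mult_eta] by blast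
  obtain B where B: "0 \<le> B" "\<And>t x. t \<in> {0..1} \<Longrightarrow> x \<in> {0..1} \<Longrightarrow> \<bar>inverse (eta (q t) x)\<bar> \<le> B"
    "\<And>t x. t \<in> {0..1} \<Longrightarrow> x \<in> {0..1} \<Longrightarrow> \<bar>- V t x * inverse (eta (q t) x)\<bar> \<le> B"
    using ac_mult_bound[OF ac_mult_inverse_eta] by blast
  show thesis
  proof (rule that[of "A + B + 1"])
    fix t x :: real assume "t \<in> {0..1}" "x \<in> {0..1}"
    from A(2)[OF this] B(2)[OF this] A(1) B(1)
    show "eta (q t) x \<le> A + B + 1" "inverse (eta (q t) x) \<le> A + B + 1" by linarith+
  qed (use A B in simp)
qed

lemma eta_le:
  obtains C where "0 < C" "\<And>t x. t \<in> {0..1} \<Longrightarrow> x \<in> {0..1} \<Longrightarrow> eta (q t) x \<le> C"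
proof -
  obtain C where "0 < C" "\<And>t x. t \<in> {0..1} \<Longrightarrow> x \<in> {0..1} \<Longrightarrow> eta (q t) x \<le> C"
    "\<And>t x. t \<in> {0..1} \<Longrightarrow> x \<in> {0..1} \<Longrightarrow> inverse (eta (q t) x) \<le> C"
    using eta_bounds by blast
  from that[OF this(1,2)] show thesis .
qed

text \<open>\<open>H1_deriv\<close> is a choice and means something only once a derivative exists.
  Here it does: p is the H^1 curve v times the weight 1/eta, which is where the second time
  derivative of q enters.\<close>

lemma p_H1: "has_H1_deriv p (H1_deriv p)"
proof -
  have "has_H1_deriv p (\<lambda>t x. w t x * inverse (eta (q t) x)
      + representative v w t x * (- V t x * inverse (eta (q t) x)))"
  proof (rule has_H1_deriv_cong_AE[OF has_H1_deriv_mult[OF v_H1 ac_mult_inverse_eta] p_L2])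
    show "AE x in I01. v t x * inverse (eta (q t) x) = p t x" if "t \<in> {0..1}" for t
      using v_eq[OF that]
    proof eventually_elim
      case (elim x)
      have "eta (q t) x \<noteq> 0" using eta_pos[of "q t" x] by linarith
      then have "eta (q t) x * inverse (eta (q t) x) = 1" by simp
      then show ?case unfolding elim by (metis mult.commute mult.left_commute mult_1_right)
    qed
  qed
  then show ?thesis unfolding H1_deriv_def by (rule someI[where P = "has_H1_deriv p"])
qed

lemma V_eq: "V t x = cum (\<lambda>y. eta (q t) y * p t y) x" if "t \<in> {0..1}"
proof (rule cum_cong_AE[OF v_eq[OF that]])
  show "v t \<in> borel_measurable I01" by (rule has_H1_derivD(2)[OF v_H1 that])
  show "(\<lambda>y. eta (q t) y * p t y) \<in> borel_measurable I01"
    by (intro borel_measurable_times QD(8)[OF q_Q[OF that]] L2_integrable(2)[OF p_L2[OF that]])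
qed

text \<open>The constraint \<open><p, 1> = 0\<close> says that the velocity has mean zero. It kills
  the boundary terms at x = 1 in the integrations by parts below.\<close>

lemma V_1: "V t 1 = 0" if "t \<in> {0..1}"
proof -
  have "inner_eta (q t) (p t) (\<lambda>_. 1) = 0" using p_TQ[OF that] by (simp add: TstarQ_def)
  then show ?thesis unfolding V_eq[OF that] by (simp add: cum_1 inner_eta_eq mult.commute)
qed

lemma v_integrable: "integrable I01 (v t)" if "t \<in> {0..1}"
  by (rule has_H1_derivD(3)[OF v_H1 that])

lemma V_x_cont: "continuous_on {0..1} (V t)" if "t \<in> {0..1}"
  by (rule continuous_on_cum[OF v_integrable[OF that]])

lemma integral_p_mult:
  assumes t: "t \<in> {0..1}" and f: "f \<in> borel_measurable I01"
  shows "(\<integral>x. p t x * (eta (q t) x * f x) \<partial>I01) = (\<integral>x. v t x * f x \<partial>I01)"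
proof (rule integral_cong_AE)
  note [measurable] = f L2_integrable(2)[OF p_L2[OF t]] QD(8)[OF q_Q[OF t]] has_H1_derivD(2)[OF v_H1 t]
  show "(\<lambda>x. p t x * (eta (q t) x * f x)) \<in> borel_measurable I01" by measurable
  show "(\<lambda>x. v t x * f x) \<in> borel_measurable I01" by measurable
  show "AE x in I01. p t x * (eta (q t) x * f x) = v t x * f x"
    using v_eq[OF t] by eventually_elim simp
qed

lemma V_squared: "(V t x)\<^sup>2 = cum (\<lambda>y. 2 * (v t y * V t y)) x" if "t \<in> {0..1}" "x \<in> {0..1}"
proof -
  have "V t x * V t x = cum (\<lambda>y. v t y * V t y + V t y * v t y) x"
    by (rule cum_mult_cum) (use v_integrable that in auto)
  then show ?thesis by (simp add: power2_eq_square mult.commute)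
qed

lemma integrable_v_mult: "integrable I01 (\<lambda>x. v t x * f x)"
  if "t \<in> {0..1}" "continuous_on {0..1} f" for f
  using integrable_mult_continuous[OF v_integrable[OF that(1)] that(2)] .

text \<open>Differentiating \<open><p, 1> = 0\<close> leaves the extra term
  \<open>\<integral> v V\<close>, which is half the square of \<open>V\<close> at 1 and so vanishes.
  This is why the first entry of the correction in the covariant derivative is 0.\<close>

lemma AE_inner_eta_deriv_1:
  "AE t in I01. inner_eta (q t) (H1_deriv p t) (\<lambda>_. 1) = 0"
proof -
  have z: "(\<integral>x. p t x * eta (q t) x \<partial>I01) = 0" if "t \<in> {0..1}" for t
    using p_TQ[OF that] by (simp add: TstarQ_def inner_eta_eq)
  have "AE t in I01. (\<integral>x. H1_deriv p t x * eta (q t) x \<partial>I01)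
      + (\<integral>x. p t x * (V t x * eta (q t) x) \<partial>I01) = 0"
    by (rule AE_integral_mult_deriv[OF p_H1 ac_mult_eta z])
  then show ?thesis
    using AE_space
  proof eventually_elim
    case (elim t)
    then have t: "t \<in> {0..1}" by simp
    have "(\<integral>x. p t x * (V t x * eta (q t) x) \<partial>I01) = (\<integral>x. v t x * V t x \<partial>I01)"
      using integral_p_mult[OF t, of "V t"] continuous_imp_integrable_I01[OF V_x_cont[OF t]]
      by (simp add: mult.commute borel_measurable_integrable)
    also have "\<dots> = 0"
      using V_squared[OF t, of 1] V_1[OF t] by (simp add: cum_1)
    finally show ?case using elim(1) by (simp add: inner_eta_eq)
  qed
qed

text \<open>
  Obtained by differentiating \<open>\<langle>p, \<phi>\<rangle>\<^sub>\<eta> = 0\<close> in time: the coefficient \<open>b\<close> of the covariant derivative is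
  what compensates the motion of \<open>\<phi>\<close> and of the weight.
\<close>

lemma AE_inner_eta_deriv_phi:
  "AE t in I01. inner_eta (q t) (H1_deriv p t) (phi (q t)) = b_coeff (p t) (q t)"
proof -
  have z: "(\<integral>x. p t x * (eta (q t) x * phi (q t) x) \<partial>I01) = 0" if "t \<in> {0..1}" for t
    using p_TQ[OF that] by (simp add: TstarQ_def inner_eta_eq mult_ac)
  have "AE t in I01. (\<integral>x. H1_deriv p t x * (eta (q t) x * phi (q t) x) \<partial>I01)
      + (\<integral>x. p t x * (V t x * eta (q t) x * phi (q t) x
          + eta (q t) x * cum (\<lambda>y. V t y * eta (q t) y) x) \<partial>I01) = 0"
    by (rule AE_integral_mult_deriv[OF p_H1 ac_mult_mult[OF ac_mult_eta ac_mult_phi] z])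
  then show ?thesis
    using AE_space
  proof eventually_elim
    case (elim t)
    then have t: "t \<in> {0..1}" by simp
    note cont = V_x_cont[OF t] QD(2,4)[OF q_Q[OF t]]
    define K where "K = cum (\<lambda>y. V t y * eta (q t) y)"
    have iVe: "integrable I01 (\<lambda>y. V t y * eta (q t) y)"
      by (intro continuous_imp_integrable_I01 continuous_intros cont)
    have K: "continuous_on {0..1} K"
      unfolding K_def by (rule continuous_on_cum[OF iVe])
    define J where "J = (\<integral>x. eta (q t) x * (V t x)\<^sup>2 \<partial>I01)"
    have iJ: "integrable I01 (\<lambda>x. eta (q t) x * (V t x)\<^sup>2)"
      by (intro continuous_imp_integrable_I01 continuous_intros cont)
    have i1: "integrable I01 (\<lambda>x. v t x * (V t x * phi (q t) x))"
      by (intro integrable_v_mult t continuous_intros cont)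
    have i2: "integrable I01 (\<lambda>x. v t x * K x)"
      by (rule integrable_v_mult[OF t K])
    have i3: "integrable I01 (\<lambda>x. 2 * (v t x * V t x))"
      using integrable_v_mult[OF t cont(1)] by simp
    have "(\<integral>x. p t x * (V t x * eta (q t) x * phi (q t) x + eta (q t) x * K x) \<partial>I01)
        = (\<integral>x. p t x * (eta (q t) x * (V t x * phi (q t) x + K x)) \<partial>I01)"
      by (simp add: algebra_simps)
    also have "\<dots> = (\<integral>x. v t x * (V t x * phi (q t) x + K x) \<partial>I01)"
      by (rule integral_p_mult[OF t])
         (intro borel_measurable_integrable continuous_imp_integrable_I01 continuous_intros cont K)
    also have "\<dots> = (\<integral>x. v t x * (V t x * phi (q t) x) \<partial>I01) + (\<integral>x. v t x * K x \<partial>I01)"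
      using i1 i2 by (simp add: distrib_left)
    \<comment> \<open>The contribution of the moving phi. \<open>K\<close> is the time derivative of
      phi, and the boundary term of the integration by parts vanishes because
      \<open>V t 1 = 0\<close>.\<close>
    also have "(\<integral>x. v t x * K x \<partial>I01) = - J"
    proof -
      have "0 = V t 1 * K 1" using V_1[OF t] by simp
      also have "\<dots> = cum (\<lambda>s. v t s * K s + V t s * (V t s * eta (q t) s)) 1"
        unfolding K_def by (rule cum_mult_cum[OF v_integrable[OF t] iVe]) simp
      also have "\<dots> = cum (\<lambda>s. v t s * K s + eta (q t) s * (V t s)\<^sup>2) 1"
        by (simp add: power2_eq_square mult_ac)
      also have "\<dots> = (\<integral>x. v t x * K x \<partial>I01) + J"
        using i2 iJ by (simp add: cum_1 J_def)
      finally show ?thesis by simp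
    qed
    \<comment> \<open>The contribution of the moving weight eta: the product
      \<open>V^2 * phi\<close> vanishes at 1, and its derivative is
      \<open>2 v V phi + eta V^2\<close>. Together with the previous term this makes -3/2 J, the
      negative of b.\<close>
    also have "(\<integral>x. v t x * (V t x * phi (q t) x) \<partial>I01) = - J / 2"
    proof -
      have "0 = cum (\<lambda>y. 2 * (v t y * V t y)) 1 * cum (eta (q t)) 1"
        using V_squared[OF t, of 1] V_1[OF t] by simp
      also have "\<dots> = cum (\<lambda>s. 2 * (v t s * V t s) * cum (eta (q t)) s
          + cum (\<lambda>y. 2 * (v t y * V t y)) s * eta (q t) s) 1"
        by (rule cum_mult_cum[OF i3 QD(3)[OF q_Q[OF t]]]) simp
      also have "\<dots> = cum (\<lambda>s. 2 * (v t s * (V t s * phi (q t) s)) + eta (q t) s * (V t s)\<^sup>2) 1"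
        by (rule cum_cong) (simp add: V_squared[OF t, symmetric] phi_eq_cum)
      also have "\<dots> = 2 * (\<integral>x. v t x * (V t x * phi (q t) x) \<partial>I01) + J"
        using i1 iJ by (simp add: cum_1 J_def)
      finally show ?thesis by simp
    qed
    finally have "(\<integral>x. p t x * (V t x * eta (q t) x * phi (q t) x + eta (q t) x * K x) \<partial>I01)
        = - (3/2 * J)" by simp
    moreover have "b_coeff (p t) (q t) = 3/2 * J"
      unfolding J_def by (simp add: b_coeff_eq[OF q_Q[OF t] p_L2[OF t]] V_eq[OF t])
    ultimately show ?case
      using elim(1) unfolding K_def by (simp add: inner_eta_eq mult_ac)
  qed
qed

end

section \<open>Measures with a finite time derivative\<close>

lemma sets_D: "sets (restrict_space borel D) = sets I01sq"
proof
  have 1: "(\<lambda>z. z) \<in> I01sq \<rightarrow>\<^sub>M restrict_space borel D"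
  proof (rule measurable_restrict_space2)
    have "(\<lambda>z. (fst z, snd z)) \<in> I01sq \<rightarrow>\<^sub>M borel \<Otimes>\<^sub>M borel"
      by (intro measurable_Pair measurable_compose[OF measurable_fst] measurable_compose[OF measurable_snd]
            borel_measurable_ident_I01)
    then show "(\<lambda>z. z) \<in> borel_measurable I01sq" by (simp add: borel_prod)
  qed (auto simp: space_pair_measure)
  have "(\<lambda>z. (fst z, snd z)) \<in> restrict_space borel D \<rightarrow>\<^sub>M I01sq"
  proof (intro measurable_Pair measurable_restrict_space2)
    have "fst \<in> borel_measurable (borel :: (real \<times> real) measure)"
      "snd \<in> borel_measurable (borel :: (real \<times> real) measure)"
      by (simp_all add: borel_prod[symmetric])
    then show "fst \<in> restrict_space borel D \<rightarrow>\<^sub>M lborel" "snd \<in> restrict_space borel D \<rightarrow>\<^sub>M lborel"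
      by (auto intro!: measurable_restrict_space1)
  qed (auto simp: space_restrict_space)
  then have 2: "(\<lambda>z. z) \<in> restrict_space borel D \<rightarrow>\<^sub>M I01sq" by simp
  show "sets (restrict_space borel D) \<subseteq> sets I01sq"
  proof
    fix A assume A: "A \<in> sets (restrict_space borel D)"
    then have "A \<subseteq> D" using sets.sets_into_space[OF A] by (simp add: space_restrict_space)
    then show "A \<in> sets I01sq"
      using measurable_sets[OF 1 A] by (simp add: space_pair_measure Int_absorb2)
  qed
  show "sets I01sq \<subseteq> sets (restrict_space borel D)"
  proof
    fix A assume A: "A \<in> sets I01sq"
    then have "A \<subseteq> D" using sets.sets_into_space[OF A] by (simp add: space_pair_measure)
    then show "A \<in> sets (restrict_space borel D)"
      using measurable_sets[OF 2 A] by (simp add: Int_absorb2 space_restrict_space)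
  qed
qed

lemma measurable_fst_snd_D:
  assumes "sets M = sets I01sq"
  shows "fst \<in> M \<rightarrow>\<^sub>M I01" "snd \<in> M \<rightarrow>\<^sub>M I01"
  unfolding measurable_cong_sets[OF assms refl] by (rule measurable_fst measurable_snd)+

lemma pos_measuresD:
  assumes "\<Delta> \<in> pos_measures"
  shows "sets \<Delta> = sets I01sq" "space \<Delta> = D" "finite_measure \<Delta>"
  using assms sets_eq_imp_space_eq[of \<Delta> "restrict_space borel D"]
  by (auto simp: pos_measures_def sets_D space_restrict_space)

definition rect_generator :: "(real \<times> real) set set" where
  "rect_generator = {a \<times> b |a b. a \<in> half_lines \<and> b \<in> half_lines}"

lemma rect_generator:
  "sets I01sq = sigma_sets D rect_generator"
  "Int_stable rect_generator" "rect_generator \<subseteq> Pow D" "D \<in> rect_generator"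
proof -
  have e1: "{0..1} \<in> half_lines" by (intro image_eqI[of _ _ 1]) auto
  show P: "rect_generator \<subseteq> Pow D" by (auto simp: rect_generator_def)
  have "sets I01sq = sets (sigma (space I01 \<times> space I01) {a \<times> b |a b. a \<in> half_lines \<and> b \<in> half_lines})"
    by (rule sets_pair_eq[where Ca = "{{0..1}}" and Cb = "{{0..1}}"])
       (use sets_I01_generator e1 in auto)
  then show "sets I01sq = sigma_sets D rect_generator"
    using P by (simp add: rect_generator_def)
  show "Int_stable rect_generator"
  proof (rule Int_stableI)
    fix A B assume "A \<in> rect_generator" "B \<in> rect_generator"
    then obtain a b c d where AB: "A = a \<times> b" "B = c \<times> d" and E: "a \<in> half_lines" "b \<in> half_lines" "c \<in> half_lines" "d \<in> half_lines"
      unfolding rect_generator_def by blast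
    have "a \<inter> c \<in> half_lines" "b \<inter> d \<in> half_lines"
      using Int_stable_I01_generator E unfolding Int_stable_def by blast+
    then show "A \<inter> B \<in> rect_generator"
      unfolding AB Times_Int_Times rect_generator_def by blast
  qed
  show "D \<in> rect_generator" unfolding rect_generator_def using e1 by blast
qed

text \<open>A uniqueness theorem for a signed identity, written with a sum so that only positive
  finite measures occur. Finiteness allows the passage to complements.\<close>

lemma measure_add_eqI:
  assumes E: "sets M = sigma_sets \<Omega> E" "Int_stable E" "E \<subseteq> Pow \<Omega>" "\<Omega> \<in> E"
    and s: "sets L = sets M" "sets N = sets M"
    and f: "finite_measure L" "finite_measure M" "finite_measure N"
    and eq: "\<And>A. A \<in> E \<Longrightarrow> measure L A + measure M A = measure N A"
    and A: "A \<in> sets M"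
  shows "measure L A + measure M A = measure N A"
proof -
  interpret L: finite_measure L by fact
  interpret M: finite_measure M by fact
  interpret N: finite_measure N by fact
  have sp: "space M = \<Omega>"
  proof
    have "\<Omega> \<in> sets M" using E by auto
    then show "\<Omega> \<subseteq> space M" by (rule sets.sets_into_space)
    have "space M \<in> sigma_sets \<Omega> E" using sets.top[of M] E(1) by simp
    then show "space M \<subseteq> \<Omega>" using sigma_sets_into_sp[OF E(3)] by blast
  qed
  then have sp': "space L = \<Omega>" "space N = \<Omega>" using s sets_eq_imp_space_eq by metis+
  have A': "A \<in> sigma_sets \<Omega> E" using A E(1) by simp
  from E(2,3) show ?thesis using A'
  proof (induction rule: sigma_sets_induct_disjoint)
    case (basic A)
    then show ?case by (rule eq)
  next
    case empty
    then show ?case by simp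
  next
    case (compl A)
    then have A: "A \<in> sets M" "A \<in> sets L" "A \<in> sets N" using E(1) s by auto
    show ?case
      using L.finite_measure_compl[OF A(2)] M.finite_measure_compl[OF A(1)] N.finite_measure_compl[OF A(3)]
        compl.IH eq[OF E(4)] by (simp add: sp sp')
  next
    case (union A)
    then have A: "range A \<subseteq> sets M" "range A \<subseteq> sets L" "range A \<subseteq> sets N" using E(1) s by auto
    have "(\<lambda>i. measure L (A i) + measure M (A i)) sums (measure L (\<Union>i. A i) + measure M (\<Union>i. A i))"
      by (intro sums_add L.finite_measure_UNION M.finite_measure_UNION A union)
    moreover have "(\<lambda>i. measure N (A i)) sums measure N (\<Union>i. A i)"
      by (intro N.finite_measure_UNION A union)
    ultimately show ?case using union.IH sums_unique2 by simp
  qed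
qed

text \<open>The measure \<open>\<mu>([0, s) \<times> dx) ds\<close>.\<close>

definition time_primitive :: "(real \<times> real) measure \<Rightarrow> (real \<times> real) measure" where
  "time_primitive \<mu> =
     distr (density (I01 \<Otimes>\<^sub>M \<mu>) (\<lambda>(s, z). ennreal (if fst z < s then 1 else 0)))
       I01sq (\<lambda>(s, z). (s, snd z))"

text \<open>The bound by a product measure comes from dropping the cut-off \<open>fst z < s\<close>:
  what remains is Lebesgue measure in time times the spatial marginal.\<close>

lemma time_primitive_props:
  assumes \<mu>: "\<mu> \<in> pos_measures"
  shows "sets (time_primitive \<mu>) = sets I01sq" "finite_measure (time_primitive \<mu>)"
    and "A \<in> sets I01sq \<Longrightarrow>
      emeasure (time_primitive \<mu>) A \<le> emeasure (I01 \<Otimes>\<^sub>M distr \<mu> I01 snd) A"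
proof -
  note P = pos_measuresD[OF \<mu>]
  interpret \<mu>: finite_measure \<mu> by (rule P)
  interpret m: finite_measure "distr \<mu> I01 snd"
    by (rule \<mu>.finite_measure_distr) (rule measurable_fst_snd_D[OF P(1)])
  interpret X: pair_sigma_finite I01 \<mu> ..
  have [measurable]: "fst \<in> \<mu> \<rightarrow>\<^sub>M I01" "snd \<in> \<mu> \<rightarrow>\<^sub>M I01"
    by (rule measurable_fst_snd_D[OF P(1)])+
  have proj[measurable]: "(\<lambda>(s, z). (s, snd z)) \<in> I01 \<Otimes>\<^sub>M \<mu> \<rightarrow>\<^sub>M I01sq" by measurable
  have ind[measurable]: "(\<lambda>(s, z). if fst z < s then 1 else 0 :: real) \<in> borel_measurable (I01 \<Otimes>\<^sub>M \<mu>)"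
    by measurable
  show "sets (time_primitive \<mu>) = sets I01sq" by (simp add: time_primitive_def)
  have em: "emeasure (time_primitive \<mu>) A
      = (\<integral>\<^sup>+ y. ennreal (if fst (snd y) < fst y then 1 else 0) * indicator A (fst y, snd (snd y)) \<partial>(I01 \<Otimes>\<^sub>M \<mu>))"
    if [measurable]: "A \<in> sets I01sq" for A
  proof -
    have "emeasure (time_primitive \<mu>) A = (\<integral>\<^sup>+ z. indicator A z \<partial>time_primitive \<mu>)"
      using that by (simp add: time_primitive_def)
    also have "\<dots> = (\<integral>\<^sup>+ y. indicator A (case y of (s, z) \<Rightarrow> (s, snd z))
        \<partial>density (I01 \<Otimes>\<^sub>M \<mu>) (\<lambda>(s, z). ennreal (if fst z < s then 1 else 0)))"
      unfolding time_primitive_def by (rule nn_integral_distr) measurable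
    also have "\<dots> = (\<integral>\<^sup>+ y. ennreal (if fst (snd y) < fst y then 1 else 0) * indicator A (fst y, snd (snd y)) \<partial>(I01 \<Otimes>\<^sub>M \<mu>))"
      by (subst nn_integral_density) (auto simp: case_prod_unfold)
    finally show ?thesis .
  qed
  show le: "emeasure (time_primitive \<mu>) A \<le> emeasure (I01 \<Otimes>\<^sub>M distr \<mu> I01 snd) A"
    if A[measurable]: "A \<in> sets I01sq" for A
  proof -
    have A2: "A \<in> sets (I01 \<Otimes>\<^sub>M distr \<mu> I01 snd)"
      using A by (simp cong: sets_pair_measure_cong)
    have "emeasure (time_primitive \<mu>) A \<le> (\<integral>\<^sup>+ y. indicator A (fst y, snd (snd y)) \<partial>(I01 \<Otimes>\<^sub>M \<mu>))"
      unfolding em[OF A] by (intro nn_integral_mono) (auto simp: indicator_def)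
    also have "\<dots> = (\<integral>\<^sup>+ s. \<integral>\<^sup>+ z. indicator A (s, snd z) \<partial>\<mu> \<partial>I01)"
      by (subst \<mu>.nn_integral_fst[symmetric]) auto
    also have "\<dots> = (\<integral>\<^sup>+ s. \<integral>\<^sup>+ x. indicator A (s, x) \<partial>distr \<mu> I01 snd \<partial>I01)"
      by (intro nn_integral_cong nn_integral_distr[symmetric]) auto
    also have "\<dots> = (\<integral>\<^sup>+ y. indicator A y \<partial>(I01 \<Otimes>\<^sub>M distr \<mu> I01 snd))"
      by (rule m.nn_integral_fst) (use A2 in simp)
    also have "\<dots> = emeasure (I01 \<Otimes>\<^sub>M distr \<mu> I01 snd) A" using A2 by simp
    finally show ?thesis .
  qed
  show "finite_measure (time_primitive \<mu>)"
  proof (rule finite_measureI)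
    have "space (time_primitive \<mu>) = space I01sq" by (simp add: time_primitive_def)
    then have "emeasure (time_primitive \<mu>) (space (time_primitive \<mu>))
        \<le> emeasure (I01 \<Otimes>\<^sub>M distr \<mu> I01 snd) (space I01sq)"
      using le[of "space I01sq"] by simp
    also have "\<dots> < \<infinity>"
    proof -
      interpret Y: finite_measure "I01 \<Otimes>\<^sub>M distr \<mu> I01 snd"
        by (rule finite_measure_pair_measure) (unfold_locales)
      have "emeasure (I01 \<Otimes>\<^sub>M distr \<mu> I01 snd) (space I01sq) \<noteq> top"
        by (rule Y.emeasure_finite)
      then show ?thesis unfolding infinity_ennreal_def by (rule top.not_eq_extremum[THEN iffD1])
    qed
    finally show "emeasure (time_primitive \<mu>) (space (time_primitive \<mu>)) \<noteq> \<infinity>"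
      by (rule less_imp_neq)
  qed
qed

lemma integral_time_primitive:
  fixes F :: "real \<times> real \<Rightarrow> real"
  assumes \<mu>: "\<mu> \<in> pos_measures" and F: "F \<in> borel_measurable I01sq"
    and C: "\<And>z. z \<in> D \<Longrightarrow> \<bar>F z\<bar> \<le> C"
  shows "integral\<^sup>L (time_primitive \<mu>) F
    = (\<integral>z. (\<integral>s. (if fst z < s then 1 else 0) * F (s, snd z) \<partial>I01) \<partial>\<mu>)"
proof -
  note P = pos_measuresD[OF \<mu>]
  interpret \<mu>: finite_measure \<mu> by (rule P)
  interpret X: pair_sigma_finite I01 \<mu> ..
  have [measurable]: "fst \<in> \<mu> \<rightarrow>\<^sub>M I01" "snd \<in> \<mu> \<rightarrow>\<^sub>M I01"
    by (rule measurable_fst_snd_D[OF P(1)])+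
  have proj[measurable]: "(\<lambda>(s, z). (s, snd z)) \<in> I01 \<Otimes>\<^sub>M \<mu> \<rightarrow>\<^sub>M I01sq" by measurable
  have ind[measurable]: "(\<lambda>(s, z). if fst z < s then 1 else 0 :: real) \<in> borel_measurable (I01 \<Otimes>\<^sub>M \<mu>)"
    by measurable
  let ?\<rho> = "density (I01 \<Otimes>\<^sub>M \<mu>) (\<lambda>y. ennreal (case y of (s, z) \<Rightarrow> if fst z < s then 1 else 0))"
  have \<rho>: "(\<lambda>(s, z). ennreal (if fst z < s then 1 else 0)) = (\<lambda>y. ennreal (case y of (s, z) \<Rightarrow> if fst z < s then 1 else 0))"
    by (simp add: fun_eq_iff)
  have proj': "(\<lambda>(s, z). (s, snd z)) \<in> ?\<rho> \<rightarrow>\<^sub>M I01sq"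
    using proj by (simp only: measurable_density_eq1)
  have "integral\<^sup>L (time_primitive \<mu>) F = (\<integral>y. F (case y of (s, z) \<Rightarrow> (s, snd z)) \<partial>?\<rho>)"
    unfolding time_primitive_def \<rho> by (rule integral_distr[OF proj' F])
  also have "\<dots> = (\<integral>y. (case y of (s, z) \<Rightarrow> if fst z < s then 1 else 0) *\<^sub>R F (case y of (s, z) \<Rightarrow> (s, snd z)) \<partial>(I01 \<Otimes>\<^sub>M \<mu>))"
    by (rule integral_density[OF measurable_compose[OF proj F] ind]) (auto intro!: AE_I2)
  also have "\<dots> = (\<integral>y. (case y of (s, z) \<Rightarrow> (if fst z < s then 1 else 0) * F (s, snd z)) \<partial>(I01 \<Otimes>\<^sub>M \<mu>))"
    by (rule Bochner_Integration.integral_cong) auto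
    also have "\<dots> = (\<integral>z. (\<integral>s. (if fst z < s then 1 else 0) * F (s, snd z) \<partial>I01) \<partial>\<mu>)"
    proof (rule X.integral_snd[symmetric])
      interpret Y: finite_measure "I01 \<Otimes>\<^sub>M \<mu>"
        by (rule finite_measure_pair_measure) (unfold_locales)
      show "integrable (I01 \<Otimes>\<^sub>M \<mu>) (\<lambda>(s, z). (if fst z < s then 1 else 0) * F (s, snd z))"
      proof (rule Y.integrable_const_bound[of _ C])
        have "0 \<le> C" using C[of "(0, 0)"] by simp
        then show "AE y in I01 \<Otimes>\<^sub>M \<mu>. norm (case y of (s, z) \<Rightarrow> (if fst z < s then 1 else 0) * F (s, snd z)) \<le> C"
          by (intro AE_I2) (auto simp: space_pair_measure P(2) intro!: C)
        show "(\<lambda>(s, z). (if fst z < s then 1 else 0) * F (s, snd z)) \<in> borel_measurable (I01 \<Otimes>\<^sub>M \<mu>)"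
          by (rule measurable_cong[THEN iffD1, OF _ borel_measurable_times[OF ind measurable_compose[OF proj F]]]) auto
      qed
    qed
    finally show ?thesis .
  qed

text \<open>The test function is \<open>(cum \<alpha> t - cum \<alpha> 1) * \<beta> x\<close>. It
  vanishes at t = 1, its time derivative is the product of alpha and beta, and its negative is the
  integral of that product over later times, which is what \<open>time_primitive\<close> integrates.
  The negative part of the derivative is moved to the left to keep all measures positive.\<close>

lemma time_deriv_product:
  fixes \<alpha> \<beta> :: "real \<Rightarrow> real"
  assumes \<Delta>: "\<Delta> \<in> pos_measures" and d: "has_time_deriv \<Delta> \<delta>"
    and a: "continuous_on UNIV \<alpha>" "\<And>x. 0 \<le> \<alpha> x" "\<And>x. \<alpha> x \<le> 1"
    and b: "continuous_on UNIV \<beta>" "\<And>x. 0 \<le> \<beta> x" "\<And>x. \<beta> x \<le> 1"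
  shows "(\<integral>z. \<alpha> (fst z) * \<beta> (snd z) \<partial>\<Delta>) + (\<integral>z. \<alpha> (fst z) * \<beta> (snd z) \<partial>time_primitive (snd \<delta>))
    = (\<integral>z. \<alpha> (fst z) * \<beta> (snd z) \<partial>time_primitive (fst \<delta>))"
proof -
  have \<delta>: "fst \<delta> \<in> pos_measures" "snd \<delta> \<in> pos_measures"
    using d by (auto simp: has_time_deriv_def signed_measures_def)
  have a01: "continuous_on {0..1} \<alpha>" and b01: "continuous_on {0..1} \<beta>"
    using a(1) b(1) by (auto intro: continuous_on_subset)
  note ia = continuous_imp_integrable_I01[OF a01] and ib = continuous_imp_integrable_I01[OF b01]
  have [measurable]: "\<alpha> \<in> borel_measurable I01" "\<beta> \<in> borel_measurable I01" using ia ib by auto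
  define f where "f = (\<lambda>z :: real \<times> real. (cum \<alpha> (fst z) - cum \<alpha> 1) * \<beta> (snd z))"
  have deriv: "((\<lambda>s. f (s, x)) has_vector_derivative \<alpha> t * \<beta> x) (at t within {0..1})" if "t \<in> {0..1}" for t x
  proof -
    have "(cum \<alpha> has_real_derivative \<alpha> t) (at t within {0..1})"
      using cum_has_vector_derivative[OF a01 that] by (simp add: has_real_derivative_iff_has_vector_derivative)
    then show ?thesis
      unfolding f_def has_real_derivative_iff_has_vector_derivative[symmetric]
      by (auto intro!: derivative_eq_intros)
  qed
  have dtf: "dt f z = \<alpha> (fst z) * \<beta> (snd z)" if "z \<in> D" for z
    using that vector_derivative_within_closed_interval[OF _ _ deriv, of "fst z" "snd z"]
    by (auto simp: dt_def split: prod.splits)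
  have cD: "continuous_on D (\<lambda>z. \<alpha> (fst z) * \<beta> (snd z))"
    by (intro continuous_intros continuous_on_compose2[OF a(1)] continuous_on_compose2[OF b(1)]) auto
  have "f \<in> C10"
    unfolding C10_def
  proof (intro CollectI conjI ballI)
    show "continuous_on D f"
      unfolding f_def
      by (intro continuous_intros continuous_on_compose2[OF continuous_on_cum[OF ia]]
          continuous_on_compose2[OF b(1)]) auto
    show "(\<lambda>s. f (s, x)) differentiable at t within {0..1}" if "t \<in> {0..1}" for t x
      using deriv[OF that] by (rule differentiableI_vector)
    show "continuous_on D (dt f)"
      using cD by (rule continuous_on_eq) (simp add: dtf)
  qed
  moreover have "f (1, x) = 0" for x by (simp add: f_def)
  ultimately have eq: "integral\<^sup>L \<Delta> (dt f) + signed_integral \<delta> f = 0"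
    using d by (auto simp: has_time_deriv_def)
  have tail: "cum \<alpha> 1 - cum \<alpha> t = (\<integral>s. (if t < s then 1 else 0) * \<alpha> s \<partial>I01)" if "t \<in> {0..1}" for t
  proof -
    have "cum \<alpha> 1 - cum \<alpha> t = (\<integral>s. \<alpha> s - indicator {0..t} s * \<alpha> s \<partial>I01)"
      unfolding cum_1 unfolding cum_def using ia integrable_indicator_mult[OF ia] by simp
    also have "\<dots> = (\<integral>s. (if t < s then 1 else 0) * \<alpha> s \<partial>I01)"
      by (rule Bochner_Integration.integral_cong) (auto simp: indicator_def)
    finally show ?thesis .
  qed
  have prim: "integral\<^sup>L (time_primitive \<mu>) (\<lambda>z. \<alpha> (fst z) * \<beta> (snd z)) = - integral\<^sup>L \<mu> f"
    if \<mu>: "\<mu> \<in> pos_measures" for \<mu>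
  proof -
    have "\<bar>\<alpha> x * \<beta> y\<bar> \<le> 1" for x y
      using a(2,3)[of x] b(2,3)[of y] by (simp add: abs_mult mult_le_one)
    then have "integral\<^sup>L (time_primitive \<mu>) (\<lambda>z. \<alpha> (fst z) * \<beta> (snd z))
        = (\<integral>z. (\<integral>s. (if fst z < s then 1 else 0) * (\<alpha> s * \<beta> (snd z)) \<partial>I01) \<partial>\<mu>)"
      by (subst integral_time_primitive[OF \<mu>, of _ 1]) auto
    also have "\<dots> = (\<integral>z. - f z \<partial>\<mu>)"
    proof (rule Bochner_Integration.integral_cong[OF refl])
      fix z assume "z \<in> space \<mu>"
      then have z: "fst z \<in> {0..1}" using pos_measuresD(2)[OF \<mu>] by auto
      have "(\<integral>s. (if fst z < s then 1 else 0) * (\<alpha> s * \<beta> (snd z)) \<partial>I01)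
          = (\<integral>s. (if fst z < s then 1 else 0) * \<alpha> s \<partial>I01) * \<beta> (snd z)"
        unfolding mult.assoc[symmetric] by (rule integral_mult_left_zero)
      then show "(\<integral>s. (if fst z < s then 1 else 0) * (\<alpha> s * \<beta> (snd z)) \<partial>I01) = - f z"
        unfolding tail[OF z, symmetric] f_def by (simp add: algebra_simps)
    qed
    finally show ?thesis by simp
  qed
  have "integral\<^sup>L \<Delta> (dt f) = (\<integral>z. \<alpha> (fst z) * \<beta> (snd z) \<partial>\<Delta>)"
    by (rule Bochner_Integration.integral_cong) (use dtf pos_measuresD(2)[OF \<Delta>] in auto)
  with eq show ?thesis
    unfolding prim[OF \<delta>(1)] prim[OF \<delta>(2)] signed_integral_def by linarith
qed

text \<open>Continuous, equal to 1 up to a and to 0 beyond a + 1/n for positive n: continuous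
  functions that approximate the indicator of a closed half-line.\<close>

definition ramp :: "nat \<Rightarrow> real \<Rightarrow> real \<Rightarrow> real" where
  "ramp n a x = max 0 (min 1 (1 - real n * (x - a)))"

lemma ramp_props:
  "continuous_on UNIV (ramp n a)" "0 \<le> ramp n a x" "ramp n a x \<le> 1"
  "(\<lambda>n. ramp n a x) \<longlonglongrightarrow> indicator {..a} x"
proof -
  have "continuous_on UNIV (\<lambda>x. max 0 (min 1 (1 - real n * (x - a))))"
    by (intro continuous_intros)
  then show "continuous_on UNIV (ramp n a)" by (simp add: ramp_def[abs_def])
  show "0 \<le> ramp n a x" "ramp n a x \<le> 1" by (auto simp: ramp_def)
  show "(\<lambda>n. ramp n a x) \<longlonglongrightarrow> indicator {..a} x"
  proof (cases "x \<le> a")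
    case True
    then have "ramp n a x = 1" for n by (auto simp: ramp_def mult_nonneg_nonpos)
    then show ?thesis using True by simp
  next
    case False
    obtain N where N: "1 < real N * (x - a)" using ex_less_of_nat_mult[of "x - a" 1] False by auto
    have "ramp n a x = 0" if "N \<le> n" for n
    proof -
      have "real N * (x - a) \<le> real n * (x - a)" using that False by (intro mult_right_mono) auto
      then show ?thesis using N by (auto simp: ramp_def)
    qed
    then show ?thesis using False by (intro tendsto_eventually eventually_sequentiallyI[of N]) auto
  qed
qed

text \<open>Products of ramps converge to indicators of the generating rectangles, so dominated
  convergence turns \<open>time_deriv_product\<close> into an identity on rectangles, which
  \<open>measure_add_eqI\<close> extends. There is no initial term, since
  \<open>has_time_deriv\<close> admits test functions that do not vanish at t = 0.\<close>

lemma time_deriv_primitive: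
  assumes \<Delta>: "\<Delta> \<in> pos_measures" and d: "has_time_deriv \<Delta> \<delta>" and A: "A \<in> sets I01sq"
  shows "measure \<Delta> A + measure (time_primitive (snd \<delta>)) A = measure (time_primitive (fst \<delta>)) A"
proof -
  have \<delta>: "fst \<delta> \<in> pos_measures" "snd \<delta> \<in> pos_measures"
    using d by (auto simp: has_time_deriv_def signed_measures_def)
  note T1 = time_primitive_props(1,2)[OF \<delta>(1)] and T2 = time_primitive_props(1,2)[OF \<delta>(2)]
  note P = pos_measuresD[OF \<Delta>]
  have lim: "(\<lambda>n. \<integral>z. ramp n a (fst z) * ramp n b (snd z) \<partial>M) \<longlonglongrightarrow> measure M (({..a} \<inter> {0..1}) \<times> ({..b} \<inter> {0..1}))"
    if M: "sets M = sets I01sq" "finite_measure M" for M a b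
  proof -
    interpret M: finite_measure M by fact
    let ?R = "({..a} \<inter> {0..1}) \<times> ({..b} \<inter> {0..1})"
    have sp: "space M = D" using sets_eq_imp_space_eq[OF M(1)] by (simp add: space_pair_measure)
    have R: "?R \<in> sets M" unfolding M(1) by (intro pair_measureI) (auto simp: sets_restrict_space)
    have [measurable]: "fst \<in> M \<rightarrow>\<^sub>M I01" "snd \<in> M \<rightarrow>\<^sub>M I01"
      by (rule measurable_fst_snd_D[OF M(1)])+
    have [measurable]: "ramp n c \<in> borel_measurable I01" for n c
      by (intro borel_measurable_integrable continuous_imp_integrable_I01 continuous_on_subset[OF ramp_props(1)]) auto
    have "(\<lambda>n. \<integral>z. ramp n a (fst z) * ramp n b (snd z) \<partial>M) \<longlonglongrightarrow> (\<integral>z. indicator ?R z \<partial>M)"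
    proof (rule integral_dominated_convergence[where w = "\<lambda>_. 1"])
      show "AE z in M. (\<lambda>n. ramp n a (fst z) * ramp n b (snd z)) \<longlonglongrightarrow> indicator ?R z"
      proof (rule AE_I2)
        fix z assume "z \<in> space M"
        then have "indicator ?R z = indicator {..a} (fst z) * (indicator {..b} (snd z) :: real)"
          unfolding sp by (auto simp: indicator_def)
        then show "(\<lambda>n. ramp n a (fst z) * ramp n b (snd z)) \<longlonglongrightarrow> indicator ?R z"
          using tendsto_mult[OF ramp_props(4) ramp_props(4)] by metis
      qed
      show "AE z in M. norm (ramp n a (fst z) * ramp n b (snd z)) \<le> 1" for n
        by (intro AE_I2) (simp add: abs_mult mult_le_one ramp_props)
    qed (use R in auto)
    then show ?thesis using R by simp
  qed
  have eq: "measure \<Delta> R + measure (time_primitive (snd \<delta>)) R = measure (time_primitive (fst \<delta>)) R"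
    if R': "R \<in> rect_generator" for R
  proof -
    obtain a b where R: "R = ({..a} \<inter> {0..1}) \<times> ({..b} \<inter> {0..1})"
      using R' unfolding rect_generator_def by blast
    have "(\<lambda>n. \<integral>z. ramp n a (fst z) * ramp n b (snd z) \<partial>time_primitive (fst \<delta>))
        \<longlonglongrightarrow> measure \<Delta> R + measure (time_primitive (snd \<delta>)) R"
      unfolding R using tendsto_add[OF lim[OF P(1,3), of a b] lim[OF T2, of a b]]
      by (subst (asm) time_deriv_product[OF \<Delta> d ramp_props(1-3) ramp_props(1-3)])
    then show ?thesis
      using lim[OF T1, of a b] unfolding R by (rule LIMSEQ_unique)
  qed
  show ?thesis
    by (rule measure_add_eqI[OF _ rect_generator(2-4) _ _ _ _ _ eq])
       (use T1 T2 P A rect_generator(1) in simp_all)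
qed

text \<open>
  By the preceding identity \<open>\<Delta>\<close> is at most the primitive of the positive part of its derivative, and
  hence at most \<open>dt m\<close>, where \<open>m\<close> is the spatial marginal of that positive part.
\<close>

lemma time_deriv_density:
  assumes \<Delta>: "\<Delta> \<in> pos_measures" and d: "has_time_deriv \<Delta> \<delta>"
  obtains m h where "sets m = sets I01" "finite_measure m"
    "case_prod h \<in> borel_measurable (I01 \<Otimes>\<^sub>M m)" "\<And>t x. 0 \<le> h t x" "\<And>t x. h t x \<le> 1"
    "\<Delta> = density (I01 \<Otimes>\<^sub>M m) (\<lambda>(t, x). ennreal (h t x))"
proof -
  have \<delta>: "fst \<delta> \<in> pos_measures" "snd \<delta> \<in> pos_measures"
    using d by (auto simp: has_time_deriv_def signed_measures_def)
  note P = pos_measuresD[OF \<Delta>] and P1 = pos_measuresD[OF \<delta>(1)]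
  interpret \<Delta>: finite_measure \<Delta> by (rule P)
  interpret T: finite_measure "time_primitive (fst \<delta>)" by (rule time_primitive_props(2)[OF \<delta>(1)])
  define m where "m = distr (fst \<delta>) I01 snd"
  have snd: "snd \<in> fst \<delta> \<rightarrow>\<^sub>M I01" by (rule measurable_fst_snd_D[OF P1(1)])
  interpret m: finite_measure m
    unfolding m_def by (rule finite_measure.finite_measure_distr[OF P1(3) snd])
  have sm: "sets m = sets I01" by (simp add: m_def)
  let ?N = "I01 \<Otimes>\<^sub>M m"
  interpret N: finite_measure ?N by (rule finite_measure_pair_measure) unfold_locales
  have sN: "sets ?N = sets I01sq" using sm by (rule sets_pair_measure_cong[OF refl])
  have le: "measure \<Delta> A \<le> measure ?N A" if A: "A \<in> sets ?N" for A
  proof -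
    have A': "A \<in> sets I01sq" using A sN by simp
    have "measure \<Delta> A \<le> measure (time_primitive (fst \<delta>)) A"
      using time_deriv_primitive[OF \<Delta> d A'] by (metis le_add_same_cancel1 measure_nonneg)
    also have "\<dots> \<le> measure ?N A"
      using time_primitive_props(3)[OF \<delta>(1) A'] unfolding m_def[symmetric]
      by (simp add: T.emeasure_eq_measure N.emeasure_eq_measure)
    finally show ?thesis .
  qed
  have ac: "absolutely_continuous ?N \<Delta>"
    unfolding absolutely_continuous_def
  proof
    fix A assume A: "A \<in> null_sets ?N"
    then have "A \<in> sets ?N" "measure ?N A = 0" by (auto simp: null_sets_def measure_def)
    then have "measure \<Delta> A = 0" using le[of A] measure_nonneg[of \<Delta> A] by simp
    then show "A \<in> null_sets \<Delta>"
      using \<open>A \<in> sets ?N\<close> sN P(1) by (simp add: null_sets_def \<Delta>.emeasure_eq_measure)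
  qed
  obtain g where g[measurable]: "g \<in> borel_measurable ?N" and dg: "density ?N g = \<Delta>"
    using N.Radon_Nikodym[OF ac] P(1) sN by auto
  define k where "k = (\<lambda>z. enn2real (g z))"
  have gfin: "AE z in ?N. g z \<noteq> \<infinity>"
  proof (rule nn_integral_PInf_AE[OF g])
    have "(\<integral>\<^sup>+z. g z \<partial>?N) = (\<integral>\<^sup>+z. g z * indicator (space ?N) z \<partial>?N)"
      by (rule nn_integral_cong) simp
    also have "\<dots> = emeasure (density ?N g) (space ?N)"
      by (rule emeasure_density[symmetric]) auto
    finally show "(\<integral>\<^sup>+z. g z \<partial>?N) \<noteq> \<infinity>" by (simp add: dg)
  qed
  have [measurable]: "k \<in> borel_measurable ?N" unfolding k_def by measurable
  have gk: "AE z in ?N. g z = ennreal (k z)"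
    using gfin by eventually_elim (simp add: k_def less_top)
  have emk: "(\<integral>\<^sup>+z. ennreal (indicator A z * k z) \<partial>?N) = ennreal (measure \<Delta> A)" if A: "A \<in> sets ?N" for A
  proof -
    have "(\<integral>\<^sup>+z. ennreal (indicator A z * k z) \<partial>?N) = (\<integral>\<^sup>+z. g z * indicator A z \<partial>?N)"
      by (rule nn_integral_cong_AE, rule eventually_mono[OF gk]) (auto simp: indicator_def)
    also have "\<dots> = emeasure (density ?N g) A" by (rule emeasure_density[symmetric]) (use A in auto)
    finally show ?thesis by (simp add: dg \<Delta>.emeasure_eq_measure)
  qed
  have ik: "integrable ?N k"
  proof (rule integrableI_nonneg)
    have "(\<integral>\<^sup>+z. ennreal (k z) \<partial>?N) = (\<integral>\<^sup>+z. ennreal (indicator (space ?N) z * k z) \<partial>?N)"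
      by (rule nn_integral_cong) simp
    then show "(\<integral>\<^sup>+z. ennreal (k z) \<partial>?N) < \<infinity>" using emk[of "space ?N"] by simp
  qed (auto simp: k_def)
  have setk: "(\<integral>z. indicator A z * k z \<partial>?N) = measure \<Delta> A" if A: "A \<in> sets ?N" for A
    using integral_eq_nn_integral[of "\<lambda>z. indicator A z * k z" ?N] emk[OF A] A
    by (simp add: k_def)
  \<comment> \<open>\<open>1 - k\<close> is the density of the difference between the product
    measure and the given one, which is nonnegative on every set by \<open>le\<close>.\<close>
  have "AE z in ?N. 0 \<le> 1 - k z"
  proof (rule N.density_nonneg)
    show "integrable ?N (\<lambda>z. 1 - k z)" using ik by simp
    fix A assume A: "A \<in> sets ?N"
    have "set_lebesgue_integral ?N A (\<lambda>z. 1 - k z) = (\<integral>z. indicator A z - indicator A z * k z \<partial>?N)"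
      unfolding set_lebesgue_integral_def by (simp add: algebra_simps)
    also have "\<dots> = measure ?N A - measure \<Delta> A"
      using integrable_mult_indicator[OF A ik] A by (simp add: setk[OF A] N.emeasure_eq_measure)
    finally show "0 \<le> set_lebesgue_integral ?N A (\<lambda>z. 1 - k z)" using le[OF A] by simp
  qed
  \<comment> \<open>The density is at most 1 only almost everywhere. Truncating it gives the bound
    at every point without changing the measure.\<close>
  then have k1: "AE z in ?N. g z = ennreal (min 1 (k z))"
    using gk by eventually_elim (simp add: min_def)
  show thesis
  proof (rule that[of m "\<lambda>t x. min 1 (k (t, x))"])
    show "\<Delta> = density ?N (\<lambda>(t, x). ennreal (min 1 (k (t, x))))"
      unfolding dg[symmetric] by (rule density_cong) (use k1 in \<open>auto simp: case_prod_unfold\<close>)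
    show "(\<lambda>(t, x). min 1 (k (t, x))) \<in> borel_measurable ?N" by (simp add: case_prod_unfold)
  qed (use sm m.finite_measure_axioms in \<open>auto simp: k_def\<close>)
qed

section \<open>Disintegration into time slices\<close>

lemma disintegration_density:
  assumes m: "sets m = sets I01" "finite_measure m"
    and h: "case_prod h \<in> borel_measurable (I01 \<Otimes>\<^sub>M m)" "\<And>t x. h t x \<le> (1 :: real)"
  shows "disintegration (density (I01 \<Otimes>\<^sub>M m) (\<lambda>(t, x). ennreal (h t x)))
    (\<lambda>t. density m (\<lambda>x. ennreal (h t x)))"
proof -
  interpret m: finite_measure m by fact
  note [measurable] = h(1)
  have space: "space m = {0..1}" using sets_eq_imp_space_eq[OF m(1)] by simp
  have ht: "(\<lambda>x. ennreal (h t x)) \<in> borel_measurable m" if "t \<in> {0..1}" for t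
    using measurable_Pair2[OF h(1), of t] that by simp
  have fin: "finite_measure (density m (\<lambda>x. ennreal (h t x)))" if "t \<in> {0..1}" for t
  proof (rule finite_measureI)
    have "emeasure (density m (\<lambda>x. ennreal (h t x))) (space m)
        = (\<integral>\<^sup>+x. ennreal (h t x) * indicator (space m) x \<partial>m)"
      by (rule emeasure_density[OF ht[OF that]]) simp
    also have "\<dots> \<le> (\<integral>\<^sup>+x. 1 \<partial>m)"
      by (rule nn_integral_mono) (use h(2) in \<open>auto simp: ennreal_le_1 indicator_def\<close>)
    also have "\<dots> < \<infinity>" by (simp add: m.emeasure_finite less_top[symmetric])
    finally show "emeasure (density m (\<lambda>x. ennreal (h t x))) (space (density m (\<lambda>x. ennreal (h t x)))) \<noteq> \<infinity>"
      by simp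
  qed
  have meas: "(\<lambda>t. emeasure (density m (\<lambda>x. ennreal (h t x))) B) \<in> borel_measurable I01"
    if B: "B \<in> sets I01" for B
  proof -
    have [measurable]: "B \<in> sets m" using B m(1) by simp
    have "(\<lambda>t. \<integral>\<^sup>+x. ennreal (h t x) * indicator B x \<partial>m) \<in> borel_measurable I01" by measurable
    then show ?thesis
      by (rule measurable_cong[THEN iffD1, rotated]) (simp add: emeasure_density ht)
  qed
  have int: "emeasure (density (I01 \<Otimes>\<^sub>M m) (\<lambda>(t, x). ennreal (h t x))) A
      = (\<integral>\<^sup>+ t. emeasure (density m (\<lambda>x. ennreal (h t x))) {x. (t, x) \<in> A} \<partial>I01)"
    if A[measurable]: "A \<in> sets (I01 \<Otimes>\<^sub>M m)" for A
  proof -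
    have "emeasure (density (I01 \<Otimes>\<^sub>M m) (\<lambda>(t, x). ennreal (h t x))) A
        = (\<integral>\<^sup>+z. (case z of (t, x) \<Rightarrow> ennreal (h t x)) * indicator A z \<partial>(I01 \<Otimes>\<^sub>M m))"
      by (rule emeasure_density) auto
    also have "\<dots> = (\<integral>\<^sup>+z. (case z of (t, x) \<Rightarrow> ennreal (h t x) * indicator A (t, x)) \<partial>(I01 \<Otimes>\<^sub>M m))"
      by (rule nn_integral_cong) auto
    also have "\<dots> = (\<integral>\<^sup>+t. \<integral>\<^sup>+x. ennreal (h t x) * indicator A (t, x) \<partial>m \<partial>I01)"
      by (subst m.nn_integral_fst[symmetric]) auto
    also have "\<dots> = (\<integral>\<^sup>+ t. emeasure (density m (\<lambda>x. ennreal (h t x))) {x. (t, x) \<in> A} \<partial>I01)"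
    proof (rule nn_integral_cong)
      fix t assume "t \<in> space I01"
      then have t: "t \<in> {0..1}" by simp
      have "{x. (t, x) \<in> A} = Pair t -` A" by auto
      then have "{x. (t, x) \<in> A} \<in> sets m" using sets_Pair1[OF A] by simp
      from emeasure_density[OF ht[OF t] this]
      show "(\<integral>\<^sup>+x. ennreal (h t x) * indicator A (t, x) \<partial>m)
          = emeasure (density m (\<lambda>x. ennreal (h t x))) {x. (t, x) \<in> A}"
        by (simp add: indicator_def)
    qed
    finally show ?thesis .
  qed
  show ?thesis
    unfolding disintegration_def sets_I01[symmetric]
    using fin meas int m(1) by (intro conjI ballI) (auto simp only: sets_density)
qed

text \<open>For each fixed b the slice masses of the interval from 0 to b agree for almost every t,
  since they have the same integral over every set of times. Countably many b combine into one null
  set, and these intervals determine a finite measure.\<close>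

lemma disintegration_AE_unique:
  assumes \<Delta>: "\<Delta> \<in> pos_measures" and K: "disintegration \<Delta> K" and L: "disintegration \<Delta> L"
  shows "AE t in I01. K t = L t"
proof -
  note P = pos_measuresD[OF \<Delta>]
  have "AE t in I01. \<forall>b\<in>\<rat> \<inter> {0..1}. emeasure (K t) {0..b} = emeasure (L t) {0..b}"
  proof (rule AE_ball_countable')
    show "countable (\<rat> \<inter> {0..1} :: real set)" by (rule countable_subset[OF _ countable_rat]) auto
    fix b :: real assume b: "b \<in> \<rat> \<inter> {0..1}"
    then have B: "{0..b} \<in> sets I01" by (auto simp: sets_restrict_space_iff)
    have meas: "(\<lambda>t. emeasure (M t) {0..b}) \<in> borel_measurable I01" if "disintegration \<Delta> M" for M
      using that B unfolding disintegration_def sets_I01[symmetric] by blast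
    have eq: "(\<integral>\<^sup>+t\<in>A. emeasure (M t) {0..b} \<partial>I01) = emeasure \<Delta> (A \<times> {0..b})"
      if M: "disintegration \<Delta> M" and A: "A \<in> sets I01" for M A
    proof -
      have "A \<times> {0..b} \<in> sets \<Delta>" using A B by (auto simp: P(1) intro!: pair_measureI)
      then have "emeasure \<Delta> (A \<times> {0..b}) = (\<integral>\<^sup>+t. emeasure (M t) {x. (t, x) \<in> A \<times> {0..b}} \<partial>I01)"
        using M unfolding disintegration_def by blast
      also have "\<dots> = (\<integral>\<^sup>+t\<in>A. emeasure (M t) {0..b} \<partial>I01)"
      proof (rule nn_integral_cong)
        fix t :: real
        have "{x. (t, x) \<in> A \<times> {0..b}} = (if t \<in> A then {0..b} else {})" by auto
        then show "emeasure (M t) {x. (t, x) \<in> A \<times> {0..b}} = emeasure (M t) {0..b} * indicator A t"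
          by simp
      qed
      finally show ?thesis by simp
    qed
    show "AE t in I01. emeasure (K t) {0..b} = emeasure (L t) {0..b}"
      by (rule I01.density_unique2[OF meas[OF K] meas[OF L]]) (simp add: eq[OF K] eq[OF L])
  qed
  then show ?thesis
    using AE_space
  proof eventually_elim
    case (elim t)
    then have t: "t \<in> {0..1}" by simp
    then have "sets (K t) = sets I01" "finite_measure (K t)" "sets (L t) = sets I01"
      using K L unfolding disintegration_def sets_I01[symmetric] by blast+
    then show ?case by (rule measure_eqI_I01) (use elim in auto)
  qed
qed

text \<open>\<open>slice\<close> is some disintegration, picked by choice, so it can be identified
  with the explicit one only for almost every t.\<close>

lemma slice_density:
  assumes \<Delta>: "\<Delta> \<in> pos_measures" and m: "sets m = sets I01" "finite_measure m"
    and h: "case_prod h \<in> borel_measurable (I01 \<Otimes>\<^sub>M m)" "\<And>t x. h t x \<le> (1 :: real)"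
    and eq: "\<Delta> = density (I01 \<Otimes>\<^sub>M m) (\<lambda>(t, x). ennreal (h t x))"
  shows "AE t in I01. slice \<Delta> t = density m (\<lambda>x. ennreal (h t x))"
proof -
  note K = disintegration_density[OF m h, folded eq]
  have "disintegration \<Delta> (slice \<Delta>)"
    unfolding slice_def by (rule someI[where P = "disintegration \<Delta>", OF K])
  then show ?thesis by (rule disintegration_AE_unique[OF \<Delta> _ K])
qed

section \<open>Duality for the Fisher-Rao functional\<close>

text \<open>\<open>measure_of\<close> returns the given set function only when that is countably
  additive, so the sum of four measures has to be checked to be one.\<close>

lemma dominating_props:
  assumes \<mu>: "\<mu> \<in> signed_measures" and \<nu>: "\<nu> \<in> signed_measures"
  shows "sets (dominating \<mu> \<nu>) = sets I01sq"
    and "A \<in> sets I01sq \<Longrightarrow> emeasure (dominating \<mu> \<nu>) A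
      = emeasure (fst \<mu>) A + emeasure (snd \<mu>) A + emeasure (fst \<nu>) A + emeasure (snd \<nu>) A"
    and "finite_measure (dominating \<mu> \<nu>)"
proof -
  have P: "fst \<mu> \<in> pos_measures" "snd \<mu> \<in> pos_measures" "fst \<nu> \<in> pos_measures" "snd \<nu> \<in> pos_measures"
    using \<mu> \<nu> by (auto simp: signed_measures_def)
  note S = P[THEN pos_measuresD(1)]
  show s: "sets (dominating \<mu> \<nu>) = sets I01sq"
    unfolding S(1)[symmetric] by (simp add: dominating_def)
  show em: "emeasure (dominating \<mu> \<nu>) A
      = emeasure (fst \<mu>) A + emeasure (snd \<mu>) A + emeasure (fst \<nu>) A + emeasure (snd \<nu>) A"
    if A: "A \<in> sets I01sq" for A
    unfolding dominating_def
  proof (rule emeasure_measure_of_sigma)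
    show "sigma_algebra (space (fst \<mu>)) (sets (fst \<mu>))" by (rule sets.sigma_algebra_axioms)
    show "A \<in> sets (fst \<mu>)" using A S by simp
    show "positive (sets (fst \<mu>)) (\<lambda>A. emeasure (fst \<mu>) A + emeasure (snd \<mu>) A + emeasure (fst \<nu>) A + emeasure (snd \<nu>) A)"
      by (simp add: positive_def)
    show "countably_additive (sets (fst \<mu>)) (\<lambda>A. emeasure (fst \<mu>) A + emeasure (snd \<mu>) A + emeasure (fst \<nu>) A + emeasure (snd \<nu>) A)"
      unfolding countably_additive_def
    proof (intro allI impI)
      fix F :: "nat \<Rightarrow> (real \<times> real) set"
      assume F: "range F \<subseteq> sets (fst \<mu>)" and d: "disjoint_family F"
      have "(\<Sum>i. emeasure M (F i)) = emeasure M (\<Union>i. F i)" if "sets M = sets (fst \<mu>)" for M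
        using F d that by (intro suminf_emeasure) auto
      note sums = this[of "fst \<mu>"] this[of "snd \<mu>"] this[of "fst \<nu>"] this[of "snd \<nu>"]
      show "(\<Sum>i. emeasure (fst \<mu>) (F i) + emeasure (snd \<mu>) (F i) + emeasure (fst \<nu>) (F i) + emeasure (snd \<nu>) (F i))
        = emeasure (fst \<mu>) (\<Union>i. F i) + emeasure (snd \<mu>) (\<Union>i. F i) + emeasure (fst \<nu>) (\<Union>i. F i) + emeasure (snd \<nu>) (\<Union>i. F i)"
        using sums S by (simp add: suminf_add[symmetric])
    qed
  qed
  show "finite_measure (dominating \<mu> \<nu>)"
  proof (rule finite_measureI)
    have sp: "space (dominating \<mu> \<nu>) = space I01sq" by (rule sets_eq_imp_space_eq[OF s])
    have "emeasure (fst \<mu>) A \<noteq> \<infinity>" "emeasure (snd \<mu>) A \<noteq> \<infinity>" "emeasure (fst \<nu>) A \<noteq> \<infinity>"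
      "emeasure (snd \<nu>) A \<noteq> \<infinity>" for A
      using P[THEN pos_measuresD(3)] by (simp_all add: finite_measure.emeasure_finite)
    then show "emeasure (dominating \<mu> \<nu>) (space (dominating \<mu> \<nu>)) \<noteq> \<infinity>"
      unfolding sp by (subst em) (simp_all add: ennreal_add_eq_top)
  qed
qed

text \<open>Each measure entering \<open>dominating\<close> lies below the sum. This gives absolute
  continuity, and finiteness makes the derivative finite almost everywhere, so
  \<open>enn2real\<close> loses nothing.\<close>

lemma integral_RN_deriv:
  fixes f :: "'a \<Rightarrow> real"
  assumes "finite_measure M" "finite_measure N" and s: "sets N = sets M"
    and le: "\<And>A. A \<in> sets M \<Longrightarrow> emeasure N A \<le> emeasure M A"
    and f: "f \<in> borel_measurable M" "\<And>x. x \<in> space M \<Longrightarrow> \<bar>f x\<bar> \<le> C"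
  shows "integrable M (\<lambda>x. enn2real (RN_deriv M N x) * f x)"
    and "integral\<^sup>L N f = (\<integral>x. enn2real (RN_deriv M N x) * f x \<partial>M)"
proof -
  interpret M: finite_measure M by fact
  interpret N: finite_measure N by fact
  have ac: "absolutely_continuous M N"
    unfolding absolutely_continuous_def
  proof
    fix A assume "A \<in> null_sets M"
    then have "A \<in> sets M" "emeasure M A = 0" by auto
    then show "A \<in> null_sets N" using le[of A] s by (simp add: null_sets_def)
  qed
  have sp: "space N = space M" by (rule sets_eq_imp_space_eq[OF s])
  have "AE x in M. RN_deriv M N x \<noteq> \<infinity>"
    by (rule M.RN_deriv_finite[OF _ ac s]) unfold_locales
  then have d: "AE x in M. RN_deriv M N x = ennreal (enn2real (RN_deriv M N x))"
    by eventually_elim (simp add: less_top)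
  have "density M (\<lambda>x. ennreal (enn2real (RN_deriv M N x))) = density M (RN_deriv M N)"
    by (rule density_cong) (use d in auto)
  also have "\<dots> = N" by (rule M.density_RN_deriv[OF ac s])
  finally have N: "density M (\<lambda>x. ennreal (enn2real (RN_deriv M N x))) = N" .
  have "integrable N f"
    using f s by (intro N.integrable_const_bound[of _ C]) (auto simp: sp cong: measurable_cong_sets)
  then have "integrable (density M (\<lambda>x. ennreal (enn2real (RN_deriv M N x)))) f" by (simp only: N)
  then show "integrable M (\<lambda>x. enn2real (RN_deriv M N x) * f x)"
    by (subst (asm) integrable_density) (use f in \<open>auto intro!: AE_I2\<close>)
  have "integral\<^sup>L N f = integral\<^sup>L (density M (\<lambda>x. ennreal (enn2real (RN_deriv M N x)))) f" by (simp only: N)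
  also have "\<dots> = (\<integral>x. enn2real (RN_deriv M N x) * f x \<partial>M)"
    by (subst integral_density) (use f in \<open>auto intro!: AE_I2\<close>)
  finally show "integral\<^sup>L N f = (\<integral>x. enn2real (RN_deriv M N x) * f x \<partial>M)" .
qed

lemma ennreal_integral_le_nn_integral:
  assumes "integrable M f"
  shows "ennreal (\<integral>x. f x \<partial>M) \<le> (\<integral>\<^sup>+x. ennreal (f x) \<partial>M)"
proof -
  have fin: "(\<integral>\<^sup>+x. ennreal (f x) \<partial>M) < \<infinity>"
    using assms by (simp add: real_integrable_def less_top)
  have "integral\<^sup>L M f \<le> enn2real (\<integral>\<^sup>+x. ennreal (f x) \<partial>M)"
    using real_lebesgue_integral_def[OF assms] by simp
  then have "ennreal (integral\<^sup>L M f) \<le> ennreal (enn2real (\<integral>\<^sup>+x. ennreal (f x) \<partial>M))"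
    by (rule ennreal_leI)
  also have "\<dots> = (\<integral>\<^sup>+x. ennreal (f x) \<partial>M)"
    by (rule ennreal_enn2real) (use fin in simp)
  finally show ?thesis .
qed

text \<open>The convex conjugate of \<open>r\<close>: by AM-GM, \<open>g y \<le> g\<^sup>2 x / e + e y\<^sup>2 / (4 x)\<close>.\<close>

lemma r_ge_dual:
  assumes "0 < e" "0 \<le> x"
  shows "ennreal (g * y - g\<^sup>2 / e * x) \<le> r x y * ennreal e"
proof (cases "x = 0")
  case True
  then show ?thesis using assms by (auto simp: r_def ennreal_top_mult)
next
  case False
  then have x: "x > 0" using assms by simp
  have "0 \<le> (g * x - e * y / 2)\<^sup>2 / (e * x)" using assms x by simp
  also have "\<dots> = g\<^sup>2 / e * x - g * y + e * (1/4 * (y\<^sup>2 / x))"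
    using assms x by (simp add: field_simps power2_eq_square)
  finally have "g * y - g\<^sup>2 / e * x \<le> (1/4 * (y\<^sup>2 / x)) * e" by (simp add: mult.commute)
  then have "ennreal (g * y - g\<^sup>2 / e * x) \<le> ennreal ((1/4 * (y\<^sup>2 / x)) * e)" by (rule ennreal_leI)
  also have "\<dots> = ennreal (1/4 * (y\<^sup>2 / x)) * ennreal e"
    by (rule ennreal_mult) (use x assms in auto)
  also have "\<dots> = r x y * ennreal e" using x by (simp add: r_def)
  finally show ?thesis .
qed

text \<open>The pointwise inequality \<open>r_ge_dual\<close>, with multiplier g at each point,
  integrated against the common dominating measure. The bounds on g and \<open>g^2 / e\<close> make
  every term on the left integrable.\<close>

lemma FR_lower_bound:
  fixes e g :: "real \<times> real \<Rightarrow> real"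
  assumes \<mu>: "\<mu> \<in> pos_measures" and \<delta>: "\<delta> \<in> signed_measures"
    and e: "e \<in> borel_measurable I01sq" "\<And>z. z \<in> D \<Longrightarrow> 0 < e z"
    and g: "g \<in> borel_measurable I01sq" "\<And>z. z \<in> D \<Longrightarrow> \<bar>g z\<bar> \<le> A"
    and ge: "\<And>z. z \<in> D \<Longrightarrow> \<bar>(g z)\<^sup>2 / e z\<bar> \<le> B"
  shows "ennreal (signed_integral \<delta> g - (\<integral>z. (g z)\<^sup>2 / e z \<partial>\<mu>)) \<le> FR e (of_pos \<mu>) \<delta>"
proof -
  have nul: "null_measure \<mu> \<in> pos_measures"
    using \<mu> by (auto simp: pos_measures_def intro!: finite_measureI)
  have \<mu>': "of_pos \<mu> \<in> signed_measures"
    using \<mu> nul by (simp add: of_pos_def signed_measures_def)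
  define \<rho> where "\<rho> = dominating (of_pos \<mu>) \<delta>"
  note R = dominating_props[OF \<mu>' \<delta>, folded \<rho>_def]
  interpret \<rho>: finite_measure \<rho> by (rule R(3))
  have sp: "space \<rho> = D" using sets_eq_imp_space_eq[OF R(1)] by (simp add: space_pair_measure)
  have \<delta>': "fst \<delta> \<in> pos_measures" "snd \<delta> \<in> pos_measures" using \<delta> by (auto simp: signed_measures_def)
  have meas: "g \<in> borel_measurable \<rho>" "(\<lambda>z. (g z)\<^sup>2 / e z) \<in> borel_measurable \<rho>"
    using g(1) e(1) by (simp_all add: measurable_cong_sets[OF R(1) refl])
  define d0 where "d0 z = enn2real (RN_deriv \<rho> \<mu> z)" for z
  define dn where "dn z = enn2real (RN_deriv \<rho> (null_measure \<mu>) z)" for z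
  define d1 where "d1 z = enn2real (RN_deriv \<rho> (fst \<delta>) z)" for z
  define d2 where "d2 z = enn2real (RN_deriv \<rho> (snd \<delta>) z)" for z
  have em: "emeasure \<rho> X = emeasure \<mu> X + 0 + emeasure (fst \<delta>) X + emeasure (snd \<delta>) X"
    if "X \<in> sets \<rho>" for X
    using R(2) that unfolding R(1) by (simp add: of_pos_def)
  have le: "emeasure \<mu> X \<le> emeasure \<rho> X" "emeasure (null_measure \<mu>) X \<le> emeasure \<rho> X"
    "emeasure (fst \<delta>) X \<le> emeasure \<rho> X" "emeasure (snd \<delta>) X \<le> emeasure \<rho> X" if "X \<in> sets \<rho>" for X
    unfolding em[OF that] by (simp_all add: add_increasing add_increasing2)
  have s: "sets \<mu> = sets \<rho>" "sets (null_measure \<mu>) = sets \<rho>" "sets (fst \<delta>) = sets \<rho>" "sets (snd \<delta>) = sets \<rho>"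
    using pos_measuresD(1)[OF \<mu>] pos_measuresD(1)[OF \<delta>'(1)] pos_measuresD(1)[OF \<delta>'(2)] R(1) by simp_all
  note RN = integral_RN_deriv[OF R(3)]
  note I0 = RN[OF pos_measuresD(3)[OF \<mu>] s(1) le(1) meas(2) ge, unfolded sp, folded d0_def]
  note I1 = RN[OF pos_measuresD(3)[OF \<delta>'(1)] s(3) le(3) meas(1) g(2), unfolded sp, folded d1_def]
  note I2 = RN[OF pos_measuresD(3)[OF \<delta>'(2)] s(4) le(4) meas(1) g(2), unfolded sp, folded d2_def]
  \<comment> \<open>\<open>of_pos\<close> carries a zero negative part, whose Radon-Nikodym
    derivative is known to vanish only almost everywhere.\<close>
  have dn: "AE z in \<rho>. dn z = 0"
  proof -
    have "(\<integral>z. 1 \<partial>null_measure \<mu>) = (\<integral>z. dn z * 1 \<partial>\<rho>)" "integrable \<rho> (\<lambda>z. dn z * 1)"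
      unfolding dn_def using RN[OF pos_measuresD(3)[OF nul] s(2) le(2), of "\<lambda>_. 1" 1] by auto
    moreover have "(\<integral>z. 1 \<partial>null_measure \<mu>) = (0 :: real)" by (simp add: measure_def)
    ultimately have "(\<integral>z. dn z \<partial>\<rho>) = 0" "integrable \<rho> dn" by simp_all
    then show ?thesis
      by (subst (asm) integral_nonneg_eq_0_iff_AE) (auto simp: dn_def)
  qed
  have "signed_integral \<delta> g - (\<integral>z. (g z)\<^sup>2 / e z \<partial>\<mu>)
      = (\<integral>z. d1 z * g z - d2 z * g z - d0 z * ((g z)\<^sup>2 / e z) \<partial>\<rho>)"
    using I0 I1 I2 by (simp add: signed_integral_def)
  then have "ennreal (signed_integral \<delta> g - (\<integral>z. (g z)\<^sup>2 / e z \<partial>\<mu>))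
      \<le> (\<integral>\<^sup>+z. ennreal (d1 z * g z - d2 z * g z - d0 z * ((g z)\<^sup>2 / e z)) \<partial>\<rho>)"
    using ennreal_integral_le_nn_integral[of \<rho> "\<lambda>z. d1 z * g z - d2 z * g z - d0 z * ((g z)\<^sup>2 / e z)"]
      I0 I1 I2 by simp
  also have "\<dots> \<le> (\<integral>\<^sup>+z. r (d0 z - dn z) (d1 z - d2 z) * ennreal (e z) \<partial>\<rho>)"
  proof (rule nn_integral_mono_AE)
    show "AE z in \<rho>. ennreal (d1 z * g z - d2 z * g z - d0 z * ((g z)\<^sup>2 / e z))
        \<le> r (d0 z - dn z) (d1 z - d2 z) * ennreal (e z)"
      using dn AE_space
    proof eventually_elim
      case (elim z)
      then have "z \<in> D" using sp by simp
      from r_ge_dual[OF e(2)[OF this], of "d0 z" "g z" "d1 z - d2 z"]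
      show ?case using elim by (simp add: d0_def algebra_simps)
    qed
  qed
  also have "\<dots> = FR e (of_pos \<mu>) \<delta>"
    unfolding FR_def Let_def \<rho>_def[symmetric]
    by (simp add: signed_density_def of_pos_def d0_def dn_def d1_def d2_def)
  finally show ?thesis .
qed

section \<open>The first variation of the residual\<close>

definition density_rep :: "(real \<times> real) measure \<Rightarrow> real measure \<Rightarrow> (real \<Rightarrow> real \<Rightarrow> real) \<Rightarrow> bool" where
  "density_rep \<Delta> m h \<longleftrightarrow> \<Delta> \<in> pos_measures \<and> sets m = sets I01 \<and> finite_measure m \<and>
     case_prod h \<in> borel_measurable (I01 \<Otimes>\<^sub>M m) \<and> (\<forall>t x. 0 \<le> h t x \<and> h t x \<le> 1) \<and>
     \<Delta> = density (I01 \<Otimes>\<^sub>M m) (\<lambda>(t, x). ennreal (h t x))"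

lemma density_repD:
  assumes "density_rep \<Delta> m h"
  shows "\<Delta> \<in> pos_measures" "sets m = sets I01" "finite_measure m" "space m = {0..1}"
    "case_prod h \<in> borel_measurable (I01 \<Otimes>\<^sub>M m)" "\<And>t x. 0 \<le> h t x" "\<And>t x. h t x \<le> 1"
    "\<Delta> = density (I01 \<Otimes>\<^sub>M m) (\<lambda>(t, x). ennreal (h t x))"
    "\<And>t. t \<in> {0..1} \<Longrightarrow> h t \<in> borel_measurable m"
    "AE t in I01. slice \<Delta> t = density m (\<lambda>x. ennreal (h t x))"
proof -
  show D: "\<Delta> \<in> pos_measures" and m: "sets m = sets I01" "finite_measure m"
    and h: "case_prod h \<in> borel_measurable (I01 \<Otimes>\<^sub>M m)" "\<And>t x. 0 \<le> h t x" "\<And>t x. h t x \<le> 1"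
    and eq: "\<Delta> = density (I01 \<Otimes>\<^sub>M m) (\<lambda>(t, x). ennreal (h t x))"
    using assms unfolding density_rep_def by blast+
  show "space m = {0..1}" using sets_eq_imp_space_eq[OF m(1)] by simp
  show "h t \<in> borel_measurable m" if "t \<in> {0..1}" for t
    using measurable_Pair2[OF h(1), of t] that by simp
  show "AE t in I01. slice \<Delta> t = density m (\<lambda>x. ennreal (h t x))"
    by (rule slice_density[OF D m h(1) h(3) eq])
qed

lemma density_rep_ex:
  assumes "\<Delta> \<in> pos_measures" "has_time_deriv \<Delta> \<delta>"
  obtains m h where "density_rep \<Delta> m h"
proof -
  obtain m h where "sets m = sets I01" "finite_measure m"
    "case_prod h \<in> borel_measurable (I01 \<Otimes>\<^sub>M m)" "\<And>t x. 0 \<le> h t x" "\<And>t x. h t x \<le> 1"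
    "\<Delta> = density (I01 \<Otimes>\<^sub>M m) (\<lambda>(t, x). ennreal (h t x))"
    by (rule time_deriv_density[OF assms]) blast
  then have "density_rep \<Delta> m h" using assms(1) unfolding density_rep_def by blast
  then show thesis by (rule that)
qed

lemma measurable_I01_cong: "sets m = sets I01 \<Longrightarrow> borel_measurable m = borel_measurable I01"
  by (rule measurable_cong_sets) simp_all

lemma measurable_I01_pair_cong:
  "sets m = sets I01 \<Longrightarrow> borel_measurable (I01 \<Otimes>\<^sub>M m) = borel_measurable I01sq"
  by (intro measurable_cong_sets sets_pair_measure_cong) simp_all

lemma abs_eta [simp]: "\<bar>eta q x\<bar> = eta q x"
  by (rule abs_of_pos) simp

lemma abs_integral_I01_le:
  fixes f :: "real \<Rightarrow> real"
  assumes "\<And>x. x \<in> {0..1} \<Longrightarrow> \<bar>f x\<bar> \<le> B"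
  shows "\<bar>\<integral>x. f x \<partial>I01\<bar> \<le> B"
proof (cases "integrable I01 f")
  case True
  have "\<bar>\<integral>x. f x \<partial>I01\<bar> \<le> (\<integral>x. \<bar>f x\<bar> \<partial>I01)" by (rule integral_abs_bound)
  also have "\<dots> \<le> (\<integral>x. B \<partial>I01)"
    using True assms by (intro integral_mono integrable_abs) auto
  finally show ?thesis by (simp add: measure_def emeasure_I01_UNIV)
next
  case False
  then show ?thesis using assms[of 0] by (simp add: not_integrable_integral_eq)
qed

text \<open>28 = 4 + 6 + 12 + 6 is the sum of the absolute values of the entries of the inverse of
  \<open>H2\<close>; phi contributes a factor of at most 1.\<close>

lemma abs_diff_row_le:
  fixes s a b k M B :: real
  assumes "\<bar>s\<bar> \<le> \<bar>12 * b - 6 * a\<bar>" "\<bar>a\<bar> \<le> M" "\<bar>b\<bar> \<le> M" "\<bar>k\<bar> \<le> B"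
  shows "\<bar>k - (4 * a - 6 * b + s)\<bar> \<le> B + 28 * M"
  using assms by linarith

lemma pi_star_cong:
  assumes "\<And>y. y \<in> {0..1} \<Longrightarrow> f y = g y" "x \<in> {0..1}"
  shows "pi_star q f x = pi_star q g x"
proof -
  have "inner_eta q f k = inner_eta q g k" for k
    unfolding inner_eta_eq by (rule Bochner_Integration.integral_cong) (use assms in auto)
  then show ?thesis using assms by (simp add: pi_star_def)
qed

text \<open>\<open>U_meas\<close> with the slice replaced by its explicit density, so that joint
  measurability and bounds can be read off. The two agree for almost every t.\<close>

definition U_dens :: "(real \<Rightarrow> real \<Rightarrow> real) \<Rightarrow> real measure \<Rightarrow> (real \<Rightarrow> real \<Rightarrow> real) \<Rightarrow> real \<Rightarrow> real \<Rightarrow> real" where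
  "U_dens q m h t x = 1/2 * (\<integral>y. h t y * (indicator {x..1} y * eta (q t) y) \<partial>m)"

section \<open>Joint measurability and bounds along the curve\<close>

context curve
begin

lemma eta_measurable [measurable]: "case_prod (\<lambda>t. eta (q t)) \<in> borel_measurable I01sq"
  by (rule ac_multD(1)[OF ac_mult_eta])

lemma phi_measurable [measurable]: "case_prod (\<lambda>t. phi (q t)) \<in> borel_measurable I01sq"
  by (rule ac_multD(1)[OF ac_mult_phi])

lemma eta_t_measurable: "t \<in> {0..1} \<Longrightarrow> eta (q t) \<in> borel_measurable I01"
  by (rule QD(8)[OF q_Q])

lemma phi_bound: "\<bar>phi (q t) x\<bar> \<le> 1" if "t \<in> {0..1}" "x \<in> {0..1}"
  using imageI[OF that(2), of "phi (q t)"] unfolding phi_strict_mono(2)[OF q_Q[OF that(1)]] by simp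

lemma inner_eta_measurable:
  assumes [measurable]: "case_prod f \<in> borel_measurable I01sq" "case_prod g \<in> borel_measurable I01sq"
  shows "(\<lambda>t. inner_eta (q t) (f t) (g t)) \<in> borel_measurable I01"
  unfolding inner_eta_eq by measurable

lemma pi_star_measurable:
  assumes k[measurable]: "case_prod k \<in> borel_measurable I01sq"
  shows "case_prod (\<lambda>t. pi_star (q t) (k t)) \<in> borel_measurable I01sq"
proof -
  have [measurable]: "(\<lambda>t. inner_eta (q t) (k t) (\<lambda>_. 1)) \<in> borel_measurable I01"
    "(\<lambda>t. inner_eta (q t) (k t) (phi (q t))) \<in> borel_measurable I01"
    using inner_eta_measurable[OF k, of "\<lambda>_ _. 1"] inner_eta_measurable[OF k phi_measurable] by simp_all
  show ?thesis unfolding pi_star_def[abs_def] row_H2_eq by measurable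
qed

lemma pi_star_bounded:
  assumes k: "\<And>t x. t \<in> {0..1} \<Longrightarrow> x \<in> {0..1} \<Longrightarrow> \<bar>k t x\<bar> \<le> B"
  shows "\<exists>B'. \<forall>t\<in>{0..1}. \<forall>x\<in>{0..1}. \<bar>pi_star (q t) (k t) x\<bar> \<le> B'"
proof -
  obtain C where C: "0 < C" "\<And>t x. t \<in> {0..1} \<Longrightarrow> x \<in> {0..1} \<Longrightarrow> eta (q t) x \<le> C"
    using eta_le by blast
  have B: "0 \<le> B" using k[of 0 0] by simp
  show ?thesis
  proof (intro exI ballI)
    fix t x :: real assume t: "t \<in> {0..1}" and x: "x \<in> {0..1}"
    have i: "\<bar>inner_eta (q t) (k t) f\<bar> \<le> B * C" if "\<And>x. x \<in> {0..1} \<Longrightarrow> \<bar>f x\<bar> \<le> 1" for f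
      unfolding inner_eta_eq
    proof (rule abs_integral_I01_le)
      fix y :: real assume y: "y \<in> {0..1}"
      have "\<bar>k t y * f y\<bar> \<le> B * 1" unfolding abs_mult using k[OF t y] that[OF y] B by (intro mult_mono) auto
      then show "\<bar>k t y * f y * eta (q t) y\<bar> \<le> B * C"
        unfolding abs_mult[of "k t y * f y"] using C(2)[OF t y] B eta_pos[of "q t" y]
        by (intro mult_mono) (auto simp: less_imp_le)
    qed
    define a where "a = inner_eta (q t) (k t) (\<lambda>_. 1)"
    define b where "b = inner_eta (q t) (k t) (phi (q t))"
    have a: "\<bar>a\<bar> \<le> B * C" and b: "\<bar>b\<bar> \<le> B * C"
      unfolding a_def b_def by (rule i; use phi_bound[OF t] in simp)+
    have "\<bar>phi (q t) x * (12 * b - 6 * a)\<bar> \<le> 1 * \<bar>12 * b - 6 * a\<bar>"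
      unfolding abs_mult[of "phi (q t) x"] using phi_bound[OF t x] by (intro mult_right_mono) auto
    then show "\<bar>pi_star (q t) (k t) x\<bar> \<le> B + 28 * (B * C)"
      unfolding pi_star_def row_H2_eq a_def[symmetric] b_def[symmetric]
      by (intro abs_diff_row_le a b k[OF t x]) simp
  qed
qed

text \<open>The uniform bound comes from \<open>h <= 1\<close>, the bound on eta and the finite mass
  of m. A measure on the square without such a density could have unbounded slice masses.\<close>

lemma U_dens_props:
  assumes rep: "density_rep \<Delta> m h"
  shows "case_prod (U_dens q m h) \<in> borel_measurable I01sq"
    and "\<exists>B. \<forall>t\<in>{0..1}. \<forall>x\<in>{0..1}. \<bar>U_dens q m h t x\<bar> \<le> B"
    and "AE t in I01. \<forall>x\<in>{0..1}. U_meas \<Delta> q t x = U_dens q m h t x"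
proof -
  note R = density_repD[OF rep]
  interpret m: finite_measure m by (rule R(3))
  note [measurable] = R(5)
  have [measurable]: "case_prod (\<lambda>t. eta (q t)) \<in> borel_measurable (I01 \<Otimes>\<^sub>M m)"
    "(\<lambda>x. x) \<in> borel_measurable m"
    using eta_measurable by (simp_all add: measurable_I01_pair_cong[OF R(2)] measurable_I01_cong[OF R(2)])
  show "case_prod (U_dens q m h) \<in> borel_measurable I01sq"
    unfolding U_dens_def[abs_def] by measurable
  obtain C where C: "0 < C" "\<And>t x. t \<in> {0..1} \<Longrightarrow> x \<in> {0..1} \<Longrightarrow> eta (q t) x \<le> C"
    using eta_le by blast
  have hb: "\<bar>h t y * (indicator {x..1} y * eta (q t) y)\<bar> \<le> C"
    if "t \<in> {0..1}" "y \<in> {0..1}" for t x y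
  proof -
    have "\<bar>indicator {x..1} y * eta (q t) y\<bar> \<le> C"
      using C(1) C(2)[OF that] by (cases "y \<in> {x..1}") simp_all
    then have "\<bar>h t y\<bar> * \<bar>indicator {x..1} y * eta (q t) y\<bar> \<le> 1 * C"
      using R(6,7)[of t y] by (intro mult_mono) auto
    then show ?thesis by (simp add: abs_mult)
  qed
  have i: "integrable m (\<lambda>y. h t y * (indicator {x..1} y * eta (q t) y))" if t: "t \<in> {0..1}" for t x
  proof (rule m.integrable_const_bound[of _ C])
    show "AE y in m. norm (h t y * (indicator {x..1} y * eta (q t) y)) \<le> C"
      using hb[OF t] R(4) by (auto intro!: AE_I2)
    have [measurable]: "h t \<in> borel_measurable m" "eta (q t) \<in> borel_measurable m"
      using R(9)[OF t] eta_t_measurable[OF t] by (simp_all add: measurable_I01_cong[OF R(2)])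
    show "(\<lambda>y. h t y * (indicator {x..1} y * eta (q t) y)) \<in> borel_measurable m" by measurable
  qed
  show "\<exists>B. \<forall>t\<in>{0..1}. \<forall>x\<in>{0..1}. \<bar>U_dens q m h t x\<bar> \<le> B"
  proof (intro exI ballI)
    fix t x :: real assume t: "t \<in> {0..1}" and x: "x \<in> {0..1}"
    have "\<bar>\<integral>y. h t y * (indicator {x..1} y * eta (q t) y) \<partial>m\<bar>
        \<le> (\<integral>y. \<bar>h t y * (indicator {x..1} y * eta (q t) y)\<bar> \<partial>m)" by (rule integral_abs_bound)
    also have "\<dots> \<le> (\<integral>y. C \<partial>m)"
      using i[OF t] hb[OF t] R(4) by (intro integral_mono integrable_abs) auto
    also have "\<dots> = measure m {0..1} * C" using R(4) by simp
    finally show "\<bar>U_dens q m h t x\<bar> \<le> measure m {0..1} * C"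
      unfolding U_dens_def by (simp add: abs_mult)
  qed
  show "AE t in I01. \<forall>x\<in>{0..1}. U_meas \<Delta> q t x = U_dens q m h t x"
    using R(10) AE_space
  proof eventually_elim
    case (elim t)
    then have t: "t \<in> {0..1}" by simp
    have [measurable]: "h t \<in> borel_measurable m" "eta (q t) \<in> borel_measurable m"
      using R(9)[OF t] eta_t_measurable[OF t] by (simp_all add: measurable_I01_cong[OF R(2)])
    show ?case
    proof
      fix x :: real
      have "(LINT y:{x..1}|slice \<Delta> t. eta (q t) y) = (\<integral>y. h t y *\<^sub>R (indicator {x..1} y *\<^sub>R eta (q t) y) \<partial>m)"
        unfolding set_lebesgue_integral_def elim(1)
        by (rule integral_density) (auto simp: R(6))
      then show "U_meas \<Delta> q t x = U_dens q m h t x"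
        unfolding U_meas_def U_dens_def by simp
    qed
  qed
qed

text \<open>The terms of the covariant derivative that are bounded on the square. Only
  \<open>H1_deriv p\<close>, which is merely square integrable, is left outside.\<close>

definition base_flat :: "real \<Rightarrow> real \<Rightarrow> real" where
  "base_flat t x = pi_star (q t) (U (\<lambda>y. (p t y)\<^sup>2) (q t)) x - row_H2 (q t) 0 (b_coeff (p t) (q t)) x"

lemma cov_flat_eq: "cov_flat p q t x = H1_deriv p t x + base_flat t x"
  by (simp add: cov_flat_def base_flat_def Let_def)

text \<open>p need not be jointly measurable, so the integrand is built from its representative. The
  bound comes from the time-independent integrable majorant of the square.\<close>

lemma U_p_props:
  obtains k B where "case_prod k \<in> borel_measurable I01sq"
    "\<And>t x. t \<in> {0..1} \<Longrightarrow> x \<in> {0..1} \<Longrightarrow> \<bar>k t x\<bar> \<le> B"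
    "\<And>t x. t \<in> {0..1} \<Longrightarrow> x \<in> {0..1} \<Longrightarrow> U (\<lambda>y. (p t y)\<^sup>2) (q t) x = k t x"
proof -
  note D = has_H1_derivD[OF p_H1] and R = representative_props[OF p_H1]
  define P where "P = representative p (H1_deriv p)"
  note [measurable] = R(1)[folded P_def]
  obtain C where C: "0 < C" "\<And>t x. t \<in> {0..1} \<Longrightarrow> x \<in> {0..1} \<Longrightarrow> eta (q t) x \<le> C"
    using eta_le by blast
  obtain B where B: "integrable I01 B" "\<And>t. t \<in> {0..1} \<Longrightarrow> AE x in I01. (P t x)\<^sup>2 \<le> B x"
    using R(4) unfolding P_def by blast
  define k where "k t x = 1/2 * (\<integral>y. indicator {x..1} y * (eta (q t) y * (P t y)\<^sup>2) \<partial>I01)" for t x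
  show thesis
  proof (rule that[of k "C * (\<integral>x. \<bar>B x\<bar> \<partial>I01)"])
    show "case_prod k \<in> borel_measurable I01sq" unfolding k_def[abs_def] by measurable
    fix t x :: real assume t: "t \<in> {0..1}" and x: "x \<in> {0..1}"
    have Pt[measurable]: "P t \<in> borel_measurable I01" using R(3)[OF t] by (simp add: P_def)
    note [measurable] = eta_t_measurable[OF t] D(2)[OF t]
    let ?f = "\<lambda>y. indicator {x..1} y * (eta (q t) y * (P t y)\<^sup>2)"
    have bd: "AE y in I01. \<bar>?f y\<bar> \<le> C * \<bar>B y\<bar>"
      using B(2)[OF t] AE_space
    proof eventually_elim
      case (elim y)
      then have y: "y \<in> {0..1}" by simp
      have "eta (q t) y * (P t y)\<^sup>2 \<le> C * \<bar>B y\<bar>"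
        using C(2)[OF t y] elim(1) C(1) by (intro mult_mono) auto
      moreover have "0 \<le> C * \<bar>B y\<bar>" using C(1) by simp
      moreover have "0 \<le> eta (q t) y * (P t y)\<^sup>2" by (simp add: less_imp_le)
      ultimately show ?case by (auto simp: indicator_def)
    qed
    have "\<bar>\<integral>y. ?f y \<partial>I01\<bar> \<le> (\<integral>y. \<bar>?f y\<bar> \<partial>I01)" by (rule integral_abs_bound)
    also have "\<dots> \<le> (\<integral>y. C * \<bar>B y\<bar> \<partial>I01)"
    proof (rule integral_mono_AE)
      show iB: "integrable I01 (\<lambda>y. C * \<bar>B y\<bar>)" using B(1) by simp
      show "integrable I01 (\<lambda>y. \<bar>?f y\<bar>)"
      proof (rule Bochner_Integration.integrable_bound[OF iB])
        show "AE y in I01. norm \<bar>?f y\<bar> \<le> norm (C * \<bar>B y\<bar>)"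
          using bd by eventually_elim (use C(1) in \<open>simp add: abs_mult\<close>)
      qed measurable
    qed (rule bd)
    also have "\<dots> = C * (\<integral>y. \<bar>B y\<bar> \<partial>I01)" by simp
    finally show "\<bar>k t x\<bar> \<le> C * (\<integral>x. \<bar>B x\<bar> \<partial>I01)" unfolding k_def by (simp add: abs_mult)
    have "(\<integral>y. indicator {x..1} y * (eta (q t) y * (p t y)\<^sup>2) \<partial>I01) = (\<integral>y. ?f y \<partial>I01)"
    proof (rule integral_cong_AE)
      show "AE y in I01. indicator {x..1} y * (eta (q t) y * (p t y)\<^sup>2) = ?f y"
        using R(2)[OF t] by eventually_elim (simp add: P_def)
    qed measurable
    then show "U (\<lambda>y. (p t y)\<^sup>2) (q t) x = k t x"
      unfolding U_def k_def set_integral_tail[OF x] by simp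
  qed
qed

lemma base_flat_props:
  "case_prod base_flat \<in> borel_measurable I01sq"
  "\<exists>B. \<forall>t\<in>{0..1}. \<forall>x\<in>{0..1}. \<bar>base_flat t x\<bar> \<le> B"
proof -
  obtain k B where k[measurable]: "case_prod k \<in> borel_measurable I01sq"
    and B: "\<And>t x. t \<in> {0..1} \<Longrightarrow> x \<in> {0..1} \<Longrightarrow> \<bar>k t x\<bar> \<le> B"
    and eq: "\<And>t x. t \<in> {0..1} \<Longrightarrow> x \<in> {0..1} \<Longrightarrow> U (\<lambda>y. (p t y)\<^sup>2) (q t) x = k t x"
    using U_p_props by blast
  define b where "b t = 3/2 * (\<integral>x. eta (q t) x * (V t x)\<^sup>2 \<partial>I01)" for t
  have b: "b_coeff (p t) (q t) = b t" if "t \<in> {0..1}" for t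
    using that by (simp add: b_def b_coeff_eq[OF q_Q p_L2] V_eq)
  note V[measurable] = cum_H1_props(2)[OF q_H1]
  have [measurable]: "b \<in> borel_measurable I01" unfolding b_def[abs_def] by measurable
  note [measurable] = pi_star_measurable[OF k]
  define c where "c t x = pi_star (q t) (k t) x - (4 * 0 - 6 * b t + phi (q t) x * (12 * b t - 6 * 0))" for t x
  have c: "base_flat t x = c t x" if "t \<in> {0..1}" "x \<in> {0..1}" for t x
    unfolding base_flat_def c_def row_H2_eq b[OF that(1)] using pi_star_cong[OF eq[OF that(1)] that(2)] by simp
  have "case_prod c \<in> borel_measurable I01sq" unfolding c_def[abs_def] by measurable
  then show "case_prod base_flat \<in> borel_measurable I01sq"
    by (rule measurable_cong[THEN iffD1, rotated]) (auto simp: space_pair_measure c)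
  obtain B1 where B1: "\<forall>t\<in>{0..1}. \<forall>x\<in>{0..1}. \<bar>pi_star (q t) (k t) x\<bar> \<le> B1"
    using pi_star_bounded[of k B] B by blast
  obtain B2 where B2: "\<forall>t\<in>{0..1}. \<forall>x\<in>{0..1}. \<bar>V t x\<bar> \<le> B2"
    using cum_H1_props(3)[OF v_H1] by blast
  obtain C where C: "0 < C" "\<And>t x. t \<in> {0..1} \<Longrightarrow> x \<in> {0..1} \<Longrightarrow> eta (q t) x \<le> C"
    using eta_le by blast
  show "\<exists>B. \<forall>t\<in>{0..1}. \<forall>x\<in>{0..1}. \<bar>base_flat t x\<bar> \<le> B"
  proof (intro exI ballI)
    fix t x :: real assume t: "t \<in> {0..1}" and x: "x \<in> {0..1}"
    have "\<bar>\<integral>x. eta (q t) x * (V t x)\<^sup>2 \<partial>I01\<bar> \<le> C * B2\<^sup>2"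
    proof (rule abs_integral_I01_le)
      fix y :: real assume y: "y \<in> {0..1}"
      have "(V t y)\<^sup>2 \<le> B2\<^sup>2" using B2 t y power_mono[of "\<bar>V t y\<bar>" B2 2] by simp
      then show "\<bar>eta (q t) y * (V t y)\<^sup>2\<bar> \<le> C * B2\<^sup>2"
        unfolding abs_mult using C(2)[OF t y] by (intro mult_mono) (auto intro: less_imp_le[OF C(1)])
    qed
    then have bb: "\<bar>b t\<bar> \<le> 3/2 * (C * B2\<^sup>2)" unfolding b_def abs_mult by simp
    have "\<bar>phi (q t) x * (12 * b t - 6 * 0)\<bar> \<le> 1 * \<bar>12 * b t - 6 * 0\<bar>"
      unfolding abs_mult[of "phi (q t) x"] using phi_bound[OF t x] by (intro mult_right_mono) auto
    moreover have "\<bar>pi_star (q t) (k t) x\<bar> \<le> B1" using B1 t x by blast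
    moreover have "0 \<le> 3/2 * (C * B2\<^sup>2)" using C(1) by simp
    ultimately show "\<bar>base_flat t x\<bar> \<le> B1 + 28 * (3/2 * (C * B2\<^sup>2))"
      unfolding c[OF t x] c_def using bb by (intro abs_diff_row_le) simp_all
  qed
qed

lemma U_p_integrable: "integrable I01 (U (\<lambda>y. (p t y)\<^sup>2) (q t))" if t: "t \<in> {0..1}"
proof -
  obtain k B where k: "case_prod k \<in> borel_measurable I01sq"
    and B: "\<And>t x. t \<in> {0..1} \<Longrightarrow> x \<in> {0..1} \<Longrightarrow> \<bar>k t x\<bar> \<le> B"
    and eq: "\<And>t x. t \<in> {0..1} \<Longrightarrow> x \<in> {0..1} \<Longrightarrow> U (\<lambda>y. (p t y)\<^sup>2) (q t) x = k t x"
    using U_p_props by blast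
  have "integrable I01 (k t)"
    using measurable_section(1)[OF k t] B[OF t] by (intro I01.integrable_const_bound[of _ B]) (auto intro!: AE_I2)
  then show ?thesis
    by (subst Bochner_Integration.integrable_cong[OF refl]) (use eq[OF t] in auto)
qed

end

section \<open>Orthogonality of the residual and its first variation\<close>

context curve
begin

definition residual :: "(real \<times> real) measure \<Rightarrow> real \<Rightarrow> real \<Rightarrow> real" where
  "residual \<Delta> t x = cov_flat p q t x + pi_star (q t) (U_meas \<Delta> q t) x"

text \<open>The explicit counterpart of \<open>residual\<close>, equal to it for almost every t.
  Only the last term depends on the measure.\<close>

definition residual_dens :: "real measure \<Rightarrow> (real \<Rightarrow> real \<Rightarrow> real) \<Rightarrow> real \<Rightarrow> real \<Rightarrow> real" where
  "residual_dens m h t x = H1_deriv p t x + (base_flat t x + pi_star (q t) (U_dens q m h t) x)"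

definition residual_norm :: "real measure \<Rightarrow> (real \<Rightarrow> real \<Rightarrow> real) \<Rightarrow> real \<Rightarrow> real" where
  "residual_norm m h t = (\<integral>x. eta (q t) x * (residual_dens m h t x)\<^sup>2 \<partial>I01)"

lemma residual_dens_props:
  assumes rep: "density_rep \<Delta> m h"
  shows "case_prod (residual_dens m h) \<in> borel_measurable I01sq"
    and "integrable I01sq (\<lambda>(t, x). (residual_dens m h t x)\<^sup>2)"
    and "AE t in I01. \<forall>x\<in>{0..1}. residual \<Delta> t x = residual_dens m h t x"
proof -
  note Um = U_dens_props[OF rep] and D = has_H1_derivD[OF p_H1]
  note [measurable] = pi_star_measurable[OF Um(1)] base_flat_props(1) D(5)
  show meas: "case_prod (residual_dens m h) \<in> borel_measurable I01sq"
    unfolding residual_dens_def[abs_def] by measurable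
  obtain B where B: "\<forall>t\<in>{0..1}. \<forall>x\<in>{0..1}. \<bar>U_dens q m h t x\<bar> \<le> B" using Um(2) by blast
  obtain B1 where B1: "\<forall>t\<in>{0..1}. \<forall>x\<in>{0..1}. \<bar>pi_star (q t) (U_dens q m h t) x\<bar> \<le> B1"
    using pi_star_bounded[of "U_dens q m h" B] B by blast
  obtain B2 where B2: "\<forall>t\<in>{0..1}. \<forall>x\<in>{0..1}. \<bar>base_flat t x\<bar> \<le> B2" using base_flat_props(2) by blast
  interpret P: finite_measure "I01sq"
    by (intro finite_measure_pair_measure finite_measure_I01)
  show "integrable I01sq (\<lambda>(t, x). (residual_dens m h t x)\<^sup>2)"
  proof (rule Bochner_Integration.integrable_bound)
    show "integrable I01sq (\<lambda>z. 2 * (\<lambda>(t, x). (H1_deriv p t x)\<^sup>2) z + 2 * (B2 + B1)\<^sup>2)"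
      using D(6) by (intro Bochner_Integration.integrable_add integrable_mult_right P.integrable_const) auto
    show "(\<lambda>(t, x). (residual_dens m h t x)\<^sup>2) \<in> borel_measurable I01sq"
      using meas by measurable
    have "(residual_dens m h t x)\<^sup>2 \<le> 2 * (H1_deriv p t x)\<^sup>2 + 2 * (B2 + B1)\<^sup>2"
      if "t \<in> {0..1}" "x \<in> {0..1}" for t x
    proof -
      define c where "c = base_flat t x + pi_star (q t) (U_dens q m h t) x"
      have "\<bar>base_flat t x\<bar> \<le> B2" "\<bar>pi_star (q t) (U_dens q m h t) x\<bar> \<le> B1"
        using B1 B2 that by blast+
      then have "\<bar>c\<bar> \<le> B2 + B1" unfolding c_def by linarith
      then have "c\<^sup>2 \<le> (B2 + B1)\<^sup>2" using power_mono[of "\<bar>c\<bar>" "B2 + B1" 2] by simp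
      moreover have "(H1_deriv p t x + c)\<^sup>2 \<le> 2 * (H1_deriv p t x)\<^sup>2 + 2 * c\<^sup>2"
        using zero_le_power2[of "H1_deriv p t x - c"] unfolding power2_sum power2_diff by simp
      ultimately show ?thesis unfolding residual_dens_def c_def[symmetric] by linarith
    qed
    then show "AE z in I01sq. norm (case z of (t, x) \<Rightarrow> (residual_dens m h t x)\<^sup>2)
        \<le> norm (2 * (\<lambda>(t, x). (H1_deriv p t x)\<^sup>2) z + 2 * (B2 + B1)\<^sup>2)"
      by (intro AE_I2) (auto simp: space_pair_measure)
  qed
  show "AE t in I01. \<forall>x\<in>{0..1}. residual \<Delta> t x = residual_dens m h t x"
    using Um(3)
  proof eventually_elim
    case (elim t)
    then have "pi_star (q t) (U_meas \<Delta> q t) x = pi_star (q t) (U_dens q m h t) x" if "x \<in> {0..1}" for x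
      by (intro pi_star_cong that) auto
    then show ?case by (simp add: residual_def residual_dens_def cov_flat_eq)
  qed
qed

lemma U_dens_integrable:
  assumes rep: "density_rep \<Delta> m h" and t: "t \<in> {0..1}"
  shows "integrable I01 (U_dens q m h t)"
proof -
  note Um = U_dens_props[OF rep]
  obtain B where B: "\<forall>t\<in>{0..1}. \<forall>x\<in>{0..1}. \<bar>U_dens q m h t x\<bar> \<le> B" using Um(2) by blast
  show ?thesis
    using measurable_section(1)[OF Um(1) t] B t
    by (intro I01.integrable_const_bound[of _ B]) (auto intro!: AE_I2)
qed

text \<open>Two of the terms are images of \<open>pi_star\<close>. The remaining difference of the
  derivative of p and \<open>row_H2\<close> with data 0 and b has inner products 0 - 0 with 1 and b
  - b with phi, by the differentiated constraints.\<close>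

lemma residual_dens_orthogonal:
  assumes rep: "density_rep \<Delta> m h"
  shows "AE t in I01. integrable I01 (residual_dens m h t) \<and> integrable I01 (\<lambda>x. (residual_dens m h t x)\<^sup>2)
    \<and> inner_eta (q t) (residual_dens m h t) (\<lambda>_. 1) = 0
    \<and> inner_eta (q t) (residual_dens m h t) (phi (q t)) = 0"
  using AE_inner_eta_deriv_1 AE_inner_eta_deriv_phi
    integrable_abs_section(3)[OF has_H1_derivD(7)[OF p_H1]]
    I01I01.AE_integrable_fst[OF residual_dens_props(2)[OF rep]] AE_space
proof eventually_elim
  case (elim t)
  then have t: "t \<in> {0..1}" by simp
  note Q = q_Q[OF t]
  define R where "R = row_H2 (q t) 0 (b_coeff (p t) (q t))"
  define S where "S = pi_star (q t) (U (\<lambda>y. (p t y)\<^sup>2) (q t))"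
  define T where "T = pi_star (q t) (U_dens q m h t)"
  note iu = U_p_integrable[OF t] and ud = U_dens_integrable[OF rep t]
  have S: "integrable I01 S" and T: "integrable I01 T"
    unfolding S_def T_def by (rule inner_eta_pi_star(3)[OF Q] iu ud)+
  have R: "integrable I01 R" unfolding R_def by (rule continuous_imp_integrable_I01[OF inner_eta_row_H2(3)[OF Q]])
  have eq: "residual_dens m h t = (\<lambda>x. (H1_deriv p t x - R x) + (S x + T x))"
    by (simp add: residual_dens_def base_flat_def R_def S_def T_def fun_eq_iff)
  have H: "integrable I01 (H1_deriv p t)" by (rule elim)
  have inner: "inner_eta (q t) (residual_dens m h t) k
      = (inner_eta (q t) (H1_deriv p t) k - inner_eta (q t) R k) + (inner_eta (q t) S k + inner_eta (q t) T k)"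
    if k: "continuous_on {0..1} k" for k
  proof -
    note i = integrable_inner_eta[OF Q _ k]
    have i1: "integrable I01 (\<lambda>x. (H1_deriv p t x - R x) * k x * eta (q t) x)"
      "integrable I01 (\<lambda>x. (S x + T x) * k x * eta (q t) x)"
      using H R S T by (auto intro!: i)
    show ?thesis
      unfolding eq inner_eta_diff(2)[OF i1] inner_eta_diff(1)[OF i[OF H] i[OF R]] inner_eta_diff(2)[OF i[OF S] i[OF T]] ..
  qed
  have "integrable I01 (residual_dens m h t)" unfolding eq using H R S T by simp
  moreover have "inner_eta (q t) (residual_dens m h t) (\<lambda>_. 1) = 0"
    using elim inner_eta_pi_star(1)[OF Q iu] inner_eta_pi_star(1)[OF Q ud] inner_eta_row_H2(1)[OF Q]
    by (subst inner) (simp_all add: R_def S_def T_def)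
  moreover have "inner_eta (q t) (residual_dens m h t) (phi (q t)) = 0"
    using elim inner_eta_pi_star(2)[OF Q iu] inner_eta_pi_star(2)[OF Q ud] inner_eta_row_H2(2)[OF Q]
    by (subst inner) (simp_all add: R_def S_def T_def QD(4)[OF Q])
  moreover have "integrable I01 (\<lambda>x. (residual_dens m h t x)\<^sup>2)" using elim by simp
  ultimately show ?case by simp
qed

lemma residual_norm_props:
  assumes rep: "density_rep \<Delta> m h"
  shows "integrable I01 (residual_norm m h)"
    and "AE t in I01. norm_sq (q t) (residual \<Delta> t) = ennreal (residual_norm m h t)"
proof -
  note A = residual_dens_props[OF rep]
  obtain C where C: "0 < C" "\<And>t x. t \<in> {0..1} \<Longrightarrow> x \<in> {0..1} \<Longrightarrow> eta (q t) x \<le> C"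
    using eta_le by blast
  have "integrable I01sq (\<lambda>z. (\<lambda>(t, x). (residual_dens m h t x)\<^sup>2) z * (case z of (t, x) \<Rightarrow> eta (q t) x))"
    by (rule integrable_mult_bounded[OF A(2), of _ C]) (use C(2) in \<open>auto simp: space_pair_measure\<close>)
  then have i: "integrable I01sq (\<lambda>(t, x). eta (q t) x * (residual_dens m h t x)\<^sup>2)"
    by (rule Bochner_Integration.integrable_cong[OF refl, THEN iffD1, rotated]) auto
  show "integrable I01 (residual_norm m h)"
    unfolding residual_norm_def[abs_def] by (rule I01I01.integrable_fst[OF i])
  show "AE t in I01. norm_sq (q t) (residual \<Delta> t) = ennreal (residual_norm m h t)"
    using A(3) I01I01.AE_integrable_fst[OF i]
  proof eventually_elim
    case (elim t)
    have "norm_sq (q t) (residual \<Delta> t) = (\<integral>\<^sup>+x. ennreal (eta (q t) x * (residual_dens m h t x)\<^sup>2) \<partial>I01)"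
      unfolding norm_sq_def by (rule nn_integral_cong) (use elim(1) in simp)
    also have "\<dots> = ennreal (residual_norm m h t)"
      unfolding residual_norm_def by (rule nn_integral_eq_integral) (use elim(2) in \<open>auto simp: less_imp_le intro!: AE_I2\<close>)
    finally show ?case .
  qed
qed

text \<open>
  The derivative of the square norm of the residual of \<open>(m, h)\<close>, applied to \<open>(m', h')\<close>.
\<close>

definition variation ::
    "real measure \<Rightarrow> (real \<Rightarrow> real \<Rightarrow> real) \<Rightarrow> real measure \<Rightarrow> (real \<Rightarrow> real \<Rightarrow> real) \<Rightarrow> real \<Rightarrow> real" where
  "variation m h m' h' t = 2 * inner_eta (q t) (residual_dens m h t) (U_dens q m' h' t)"

lemma variation_integrable:
  assumes rep: "density_rep \<Delta> m h" and rep': "density_rep \<Delta>' m' h'"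
  shows "integrable I01 (variation m h m' h')"
    and "AE t in I01. integrable I01 (\<lambda>x. residual_dens m h t x * U_dens q m' h' t x * eta (q t) x)"
proof -
  note A = residual_dens_props[OF rep] and Um = U_dens_props[OF rep']
  obtain C where C: "0 < C" "\<And>t x. t \<in> {0..1} \<Longrightarrow> x \<in> {0..1} \<Longrightarrow> eta (q t) x \<le> C"
    using eta_le by blast
  obtain B where B: "\<forall>t\<in>{0..1}. \<forall>x\<in>{0..1}. \<bar>U_dens q m' h' t x\<bar> \<le> B" using Um(2) by blast
  interpret P: finite_measure "I01sq"
    by (intro finite_measure_pair_measure finite_measure_I01)
  have "integrable I01sq (\<lambda>z. (case_prod (residual_dens m h) z)\<^sup>2)"
    using A(2) by (simp add: case_prod_unfold)
  then have i1: "integrable I01sq (case_prod (residual_dens m h))"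
    by (rule integrable_of_square[OF P.finite_measure_axioms A(1)])
  have i2: "integrable I01sq (\<lambda>z. case_prod (residual_dens m h) z * case_prod (U_dens q m' h') z)"
    by (rule integrable_mult_bounded[OF i1 Um(1), of B]) (use B in \<open>auto simp: space_pair_measure\<close>)
  have "integrable I01sq (\<lambda>z. case_prod (residual_dens m h) z * case_prod (U_dens q m' h') z * (case z of (t, x) \<Rightarrow> eta (q t) x))"
    by (rule integrable_mult_bounded[OF i2, of _ C]) (use C(2) in \<open>auto simp: space_pair_measure\<close>)
  then have i: "integrable I01sq (\<lambda>(t, x). residual_dens m h t x * U_dens q m' h' t x * eta (q t) x)"
    by (rule Bochner_Integration.integrable_cong[OF refl, THEN iffD1, rotated]) auto
  show "integrable I01 (variation m h m' h')"
    unfolding variation_def[abs_def] inner_eta_eq using I01I01.integrable_fst[OF i] by simp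
  show "AE t in I01. integrable I01 (\<lambda>x. residual_dens m h t x * U_dens q m' h' t x * eta (q t) x)"
    by (rule I01I01.AE_integrable_fst[OF i])
qed

text \<open>The two residuals differ by d, the image under \<open>pi_star\<close> of the difference
  of the two \<open>U_dens\<close>, and the gap in the inequality is the integral of
  \<open>eta * d^2\<close>. Orthogonality of the first residual removes \<open>pi_star\<close> from
  the cross term, which becomes the difference of the variations.\<close>

lemma residual_norm_convex:
  assumes rep: "density_rep \<Delta> m h" and rep': "density_rep \<Delta>' m' h'"
  shows "AE t in I01. residual_norm m h t + (variation m h m' h' t - variation m h m h t)
    \<le> residual_norm m' h' t"
  using residual_dens_orthogonal[OF rep] residual_dens_orthogonal[OF rep']
    variation_integrable(2)[OF rep rep'] variation_integrable(2)[OF rep rep] AE_space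
proof eventually_elim
  case (elim t)
  then have t: "t \<in> {0..1}" by simp
  note Q = q_Q[OF t]
  define a where "a = residual_dens m h t"
  define b where "b = (\<lambda>x. pi_star (q t) (U_dens q m' h' t) x)"
  define c where "c = (\<lambda>x. pi_star (q t) (U_dens q m h t) x)"
  define d where "d = (\<lambda>x. b x - c x)"
  note ud = U_dens_integrable[OF rep t] and ud' = U_dens_integrable[OF rep' t]
  have a: "integrable I01 a" "integrable I01 (\<lambda>x. (a x)\<^sup>2)"
    and o: "inner_eta (q t) a (\<lambda>_. 1) = 0" "inner_eta (q t) a (phi (q t)) = 0"
    using elim(1) by (auto simp: a_def)
  have a': "residual_dens m' h' t x = a x + d x" for x
    by (simp add: a_def residual_dens_def d_def b_def c_def)
  have a'2: "integrable I01 (\<lambda>x. (a x + d x)\<^sup>2)" using elim(2) unfolding a' by simp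
  obtain B1 where B1: "\<forall>t\<in>{0..1}. \<forall>x\<in>{0..1}. \<bar>pi_star (q t) (U_dens q m h t) x\<bar> \<le> B1"
    using pi_star_bounded[of "U_dens q m h"] U_dens_props(2)[OF rep] by meson
  obtain B2 where B2: "\<forall>t\<in>{0..1}. \<forall>x\<in>{0..1}. \<bar>pi_star (q t) (U_dens q m' h' t) x\<bar> \<le> B2"
    using pi_star_bounded[of "U_dens q m' h'"] U_dens_props(2)[OF rep'] by meson
  have b: "integrable I01 b" and c: "integrable I01 c"
    unfolding b_def c_def by (rule inner_eta_pi_star(3)[OF Q] ud ud')+
  have iab: "integrable I01 (\<lambda>x. a x * b x * eta (q t) x)" and iac: "integrable I01 (\<lambda>x. a x * c x * eta (q t) x)"
  proof -
    have *: "integrable I01 (\<lambda>x. a x * b x)" "integrable I01 (\<lambda>x. a x * c x)"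
      by (rule integrable_mult_bounded[OF a(1), of _ B2] integrable_mult_bounded[OF a(1), of _ B1];
          use b c B1 B2 t in \<open>auto simp: b_def c_def\<close>)+
    show "integrable I01 (\<lambda>x. a x * b x * eta (q t) x)" "integrable I01 (\<lambda>x. a x * c x * eta (q t) x)"
      by (rule integrable_mult_continuous[OF *(1) QD(2)[OF Q]] integrable_mult_continuous[OF *(2) QD(2)[OF Q]])+
  qed
  have var: "variation m h m' h' t = 2 * (\<integral>x. a x * b x * eta (q t) x \<partial>I01)"
    "variation m h m h t = 2 * (\<integral>x. a x * c x * eta (q t) x \<partial>I01)"
    using inner_eta_pi_star_orthogonal[OF Q a(1) o, of "U_dens q m' h' t"]
      inner_eta_pi_star_orthogonal[OF Q a(1) o, of "U_dens q m h t"] elim(3,4)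
    unfolding variation_def a_def[symmetric] b_def c_def by (simp_all add: inner_eta_eq)
  have i1: "integrable I01 (\<lambda>x. eta (q t) x * (a x)\<^sup>2)" "integrable I01 (\<lambda>x. eta (q t) x * (a x + d x)\<^sup>2)"
    using integrable_mult_continuous[OF a(2) QD(2)[OF Q]] integrable_mult_continuous[OF a'2 QD(2)[OF Q]]
    by (simp_all add: mult.commute)
  have "residual_norm m h t + (variation m h m' h' t - variation m h m h t)
      = (\<integral>x. eta (q t) x * (a x)\<^sup>2 + (2 * (a x * b x * eta (q t) x) - 2 * (a x * c x * eta (q t) x)) \<partial>I01)"
    unfolding var residual_norm_def a_def[symmetric] using i1 iab iac by simp
  also have "\<dots> \<le> (\<integral>x. eta (q t) x * (a x + d x)\<^sup>2 \<partial>I01)"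
  proof (rule integral_mono)
    show "integrable I01 (\<lambda>x. eta (q t) x * (a x)\<^sup>2 + (2 * (a x * b x * eta (q t) x) - 2 * (a x * c x * eta (q t) x)))"
      using i1 iab iac by simp
    fix x
    have "0 \<le> eta (q t) x * (d x)\<^sup>2" by (simp add: less_imp_le)
    also have "\<dots> = eta (q t) x * (a x + d x)\<^sup>2
        - (eta (q t) x * (a x)\<^sup>2 + (2 * (a x * b x * eta (q t) x) - 2 * (a x * c x * eta (q t) x)))"
      unfolding d_def by (simp add: power2_eq_square algebra_simps)
    finally show "eta (q t) x * (a x)\<^sup>2 + (2 * (a x * b x * eta (q t) x) - 2 * (a x * c x * eta (q t) x))
        \<le> eta (q t) x * (a x + d x)\<^sup>2" by simp
  qed (rule i1)
  also have "\<dots> = residual_norm m' h' t" unfolding residual_norm_def a' ..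
  finally show ?case .
qed

lemma DG_eq:
  assumes "AE t in I01. \<forall>x\<in>{0..1}. residual \<Delta> t x = a t x"
  shows "AE t in I01. \<forall>x\<in>{0..1}. DG \<Delta> p q (t, x) = eta (q t) x * cum (\<lambda>y. eta (q t) y * a t y) x"
  using assms
proof eventually_elim
  case (elim t)
  show ?case
  proof
    fix x :: real assume x: "x \<in> {0..1}"
    have "(LINT y:{0..x}|lborel. cov p q t y + eta (q t) y * pi_star (q t) (U_meas \<Delta> q t) y)
        = cum (\<lambda>y. eta (q t) y * a t y) x"
      unfolding set_integral_eq_cum[OF x]
    proof (rule cum_cong)
      fix y assume "y \<in> {0..x}" "y \<le> 1"
      then have "residual \<Delta> t y = a t y" using elim by simp
      then show "cov p q t y + eta (q t) y * pi_star (q t) (U_meas \<Delta> q t) y = eta (q t) y * a t y"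
        by (simp add: cov_def residual_def flip: distrib_left)
    qed
    then show "DG \<Delta> p q (t, x) = eta (q t) x * cum (\<lambda>y. eta (q t) y * a t y) x"
      by (simp add: DG_def)
  qed
qed

text \<open>Fubini over the pairs with y below x. The form with \<open>h'\<close> and
  \<open>m'\<close> is used to integrate the differential inequality against a competitor, the form
  with \<open>slice\<close> to evaluate \<open>pairing\<close>.\<close>

lemma integral_DG:
  assumes rep: "density_rep \<Delta> m h" and rep': "density_rep \<Delta>' m' h'"
  shows "AE t in I01. integrable m' (\<lambda>x. h' t x * DG \<Delta> p q (t, x))
    \<and> (\<integral>x. h' t x * DG \<Delta> p q (t, x) \<partial>m') = variation m h m' h' t
    \<and> (\<integral>x. DG \<Delta> p q (t, x) \<partial>slice \<Delta>' t) = variation m h m' h' t"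
  using DG_eq[OF residual_dens_props(3)[OF rep]] residual_dens_orthogonal[OF rep] density_repD(10)[OF rep'] AE_space
proof eventually_elim
  case (elim t)
  then have t: "t \<in> {0..1}" by simp
  note R = density_repD[OF rep'] and Q = q_Q[OF t]
  interpret m': finite_measure m' by (rule R(3))
  interpret X: pair_sigma_finite I01 m' ..
  obtain C where C: "0 < C" "\<And>t x. t \<in> {0..1} \<Longrightarrow> x \<in> {0..1} \<Longrightarrow> eta (q t) x \<le> C"
    using eta_le by blast
  define f where "f = (\<lambda>y. eta (q t) y * residual_dens m h t y)"
  have f: "integrable I01 f"
    unfolding f_def using integrable_mult_continuous[OF conjunct1[OF elim(2)] QD(2)[OF Q]]
    by (simp add: mult.commute)
  have [measurable]: "f \<in> borel_measurable I01" using f by auto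
  have ht[measurable]: "h' t \<in> borel_measurable m'" by (rule R(9)[OF t])
  have [measurable]: "(\<lambda>x. x) \<in> borel_measurable m'" "eta (q t) \<in> borel_measurable m'"
    using eta_t_measurable[OF t] by (simp_all add: measurable_I01_cong[OF R(2)])
  have cum[measurable]: "cum f \<in> borel_measurable m'"
    using continuous_imp_integrable_I01[OF continuous_on_cum[OF f]]
    by (simp add: measurable_I01_cong[OF R(2)] borel_measurable_integrable)
  define k where "k x = eta (q t) x * cum f x" for x
  have [measurable]: "k \<in> borel_measurable m'" unfolding k_def[abs_def] by measurable
  have DGk: "DG \<Delta> p q (t, x) = k x" if "x \<in> {0..1}" for x
    using elim(1) that by (simp add: k_def f_def)
  have hk: "h' t x * k x = (\<integral>y. (h' t x * eta (q t) x) * (indicator {0..x} y * f y) \<partial>I01)" for x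
    unfolding k_def cum_def by simp
  have iF: "integrable (I01 \<Otimes>\<^sub>M m') (\<lambda>(y, x). (h' t x * eta (q t) x) * (indicator {0..x} y * f y))"
  proof (rule Bochner_Integration.integrable_bound)
    show "integrable (I01 \<Otimes>\<^sub>M m') (\<lambda>(y, x). f y * C)"
      by (rule X.Fubini_integrable) (use f in \<open>auto intro!: AE_I2 simp: abs_mult\<close>)
    show "(\<lambda>(y, x). (h' t x * eta (q t) x) * (indicator {0..x} y * f y)) \<in> borel_measurable (I01 \<Otimes>\<^sub>M m')"
      by measurable
    have "\<bar>(h' t x * eta (q t) x) * (indicator {0..x} y * f y)\<bar> \<le> \<bar>f y * C\<bar>" if x: "x \<in> {0..1}" for x y
    proof -
      have "\<bar>h' t x * eta (q t) x\<bar> \<le> 1 * C"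
        unfolding abs_mult using R(6,7)[of t x] C(2)[OF t x] by (intro mult_mono) (auto simp: less_imp_le)
      moreover have "\<bar>indicator {0..x} y * f y\<bar> \<le> \<bar>f y\<bar>" by (simp add: indicator_def)
      ultimately have "\<bar>h' t x * eta (q t) x\<bar> * \<bar>indicator {0..x} y * f y\<bar> \<le> (1 * C) * \<bar>f y\<bar>"
        using C(1) by (intro mult_mono) auto
      then show ?thesis using C(1) by (simp add: abs_mult mult.commute)
    qed
    then show "AE z in I01 \<Otimes>\<^sub>M m'. norm (case z of (y, x) \<Rightarrow> (h' t x * eta (q t) x) * (indicator {0..x} y * f y))
        \<le> norm (case z of (y, x) \<Rightarrow> f y * C)"
      by (intro AE_I2) (auto simp: space_pair_measure R(4))
  qed
  have ihk: "integrable m' (\<lambda>x. h' t x * k x)"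
    unfolding hk using X.integrable_snd[OF iF] by simp
  have "(\<integral>x. h' t x * k x \<partial>m')
      = (\<integral>x. (\<integral>y. (h' t x * eta (q t) x) * (indicator {0..x} y * f y) \<partial>I01) \<partial>m')"
    unfolding hk ..
  also have "\<dots> = (\<integral>y. (\<integral>x. (h' t x * eta (q t) x) * (indicator {0..x} y * f y) \<partial>m') \<partial>I01)"
    by (rule X.Fubini_integral[OF iF])
  also have "\<dots> = (\<integral>y. 2 * (residual_dens m h t y * U_dens q m' h' t y * eta (q t) y) \<partial>I01)"
  proof (rule Bochner_Integration.integral_cong[OF refl])
    fix y assume "y \<in> space I01"
    then have y: "y \<in> {0..1}" by simp
    \<comment> \<open>On the square, y in \<open>{0..x}\<close> means x in \<open>{y..1}\<close>:
      the primitive in \<open>DG\<close> turns into the tail integral of \<open>U_dens\<close>,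
      whose factor 1/2 leaves the 2 of \<open>variation\<close>.\<close>
    have "(\<integral>x. (h' t x * eta (q t) x) * (indicator {0..x} y * f y) \<partial>m')
        = (\<integral>x. h' t x * (indicator {y..1} x * eta (q t) x) * f y \<partial>m')"
      by (rule Bochner_Integration.integral_cong) (use y R(4) in \<open>auto simp: indicator_def\<close>)
    also have "\<dots> = 2 * (U_dens q m' h' t y * f y)" by (simp add: U_dens_def)
    finally show "(\<integral>x. (h' t x * eta (q t) x) * (indicator {0..x} y * f y) \<partial>m')
        = 2 * (residual_dens m h t y * U_dens q m' h' t y * eta (q t) y)"
      by (simp add: f_def)
  qed
  also have "\<dots> = variation m h m' h' t" unfolding variation_def inner_eta_eq by simp
  finally have v: "(\<integral>x. h' t x * k x \<partial>m') = variation m h m' h' t" .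
  have "(\<integral>x. DG \<Delta> p q (t, x) \<partial>slice \<Delta>' t) = (\<integral>x. k x \<partial>slice \<Delta>' t)"
    by (rule Bochner_Integration.integral_cong) (auto simp: elim(3) R(4) DGk)
  also have "\<dots> = (\<integral>x. h' t x *\<^sub>R k x \<partial>m')"
    unfolding elim(3) by (rule integral_density) (auto simp: R(6))
  finally have "(\<integral>x. DG \<Delta> p q (t, x) \<partial>slice \<Delta>' t) = variation m h m' h' t" using v by simp
  moreover have "integrable m' (\<lambda>x. h' t x * DG \<Delta> p q (t, x))"
    using ihk by (subst Bochner_Integration.integrable_cong[OF refl]) (auto simp: R(4) DGk)
  moreover have "(\<integral>x. h' t x * DG \<Delta> p q (t, x) \<partial>m') = (\<integral>x. h' t x * k x \<partial>m')"
    by (rule Bochner_Integration.integral_cong) (auto simp: R(4) DGk)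
  ultimately show ?case using v by simp
qed

end

section \<open>Optimality\<close>

text \<open>
  The space \<open>I01\<close> is not complete, and the Bochner integral of a non-measurable function is \<open>0\<close>. So it
  is not enough to know the inner integral of \<open>pairing\<close> for almost every \<open>t\<close>: its measurability in \<open>t\<close>
  has to come from the slices being a measurable kernel.
\<close>

definition finite_kernel :: "'a measure \<Rightarrow> 'b measure \<Rightarrow> ('a \<Rightarrow> 'b measure) \<Rightarrow> bool" where
  "finite_kernel M N \<kappa> \<longleftrightarrow>
     (\<forall>\<omega>\<in>space M. sets (\<kappa> \<omega>) = sets N \<and> finite_measure (\<kappa> \<omega>)) \<and>
     (\<forall>B\<in>sets N. (\<lambda>\<omega>. emeasure (\<kappa> \<omega>) B) \<in> borel_measurable M)"

lemma finite_kernelD: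
  assumes "finite_kernel M N \<kappa>"
  shows "\<And>\<omega>. \<omega> \<in> space M \<Longrightarrow> sets (\<kappa> \<omega>) = sets N" "\<And>\<omega>. \<omega> \<in> space M \<Longrightarrow> finite_measure (\<kappa> \<omega>)"
    "\<And>\<omega>. \<omega> \<in> space M \<Longrightarrow> space (\<kappa> \<omega>) = space N"
    "\<And>B. B \<in> sets N \<Longrightarrow> (\<lambda>\<omega>. emeasure (\<kappa> \<omega>) B) \<in> borel_measurable M"
proof -
  show *: "\<And>\<omega>. \<omega> \<in> space M \<Longrightarrow> sets (\<kappa> \<omega>) = sets N"
    and "\<And>\<omega>. \<omega> \<in> space M \<Longrightarrow> finite_measure (\<kappa> \<omega>)"
    and "\<And>B. B \<in> sets N \<Longrightarrow> (\<lambda>\<omega>. emeasure (\<kappa> \<omega>) B) \<in> borel_measurable M"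
    using assms unfolding finite_kernel_def by simp_all
  show "\<And>\<omega>. \<omega> \<in> space M \<Longrightarrow> space (\<kappa> \<omega>) = space N"
    by (rule sets_eq_imp_space_eq[OF *])
qed

text \<open>Dynkin induction from rectangles. Finiteness of each kernel measure justifies the
  subtraction in the complement step.\<close>

lemma finite_kernel_emeasure_measurable:
  assumes K: "finite_kernel M N \<kappa>" and A: "A \<in> sets (M \<Otimes>\<^sub>M N)"
  shows "(\<lambda>\<omega>. emeasure (\<kappa> \<omega>) (Pair \<omega> -` A)) \<in> borel_measurable M"
proof -
  note D = finite_kernelD[OF K]
  have "A \<in> sigma_sets (space M \<times> space N) {a \<times> b |a b. a \<in> sets M \<and> b \<in> sets N}"
    using A by (simp add: sets_pair_measure)
  with Int_stable_pair_measure_generator pair_measure_closed show ?thesis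
  proof (induction rule: sigma_sets_induct_disjoint)
    case (basic A)
    then obtain a b where A: "A = a \<times> b" and a: "a \<in> sets M" and b: "b \<in> sets N" by auto
    have "(\<lambda>\<omega>. emeasure (\<kappa> \<omega>) (Pair \<omega> -` A)) = (\<lambda>\<omega>. emeasure (\<kappa> \<omega>) b * indicator a \<omega>)"
      by (auto simp: A indicator_def fun_eq_iff)
    then show ?case using D(4)[OF b] a by simp
  next
    case empty
    then show ?case by simp
  next
    case (compl A)
    then have A: "A \<in> sets (M \<Otimes>\<^sub>M N)" by (simp add: sets_pair_measure)
    have "(\<lambda>\<omega>. emeasure (\<kappa> \<omega>) (space N) - emeasure (\<kappa> \<omega>) (Pair \<omega> -` A)) \<in> borel_measurable M"
      using compl.IH D(4)[of "space N"] by (intro borel_measurable_minus_ennreal) auto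
    then show ?case
    proof (rule measurable_cong[THEN iffD1, rotated])
      fix \<omega> assume \<omega>: "\<omega> \<in> space M"
      interpret finite_measure "\<kappa> \<omega>" by (rule D(2)[OF \<omega>])
      have "Pair \<omega> -` A \<in> sets (\<kappa> \<omega>)" using sets_Pair1[OF A] D(1)[OF \<omega>] by simp
      moreover have "Pair \<omega> -` (space M \<times> space N - A) = space (\<kappa> \<omega>) - Pair \<omega> -` A"
        using \<omega> D(3)[OF \<omega>] by auto
      ultimately show "emeasure (\<kappa> \<omega>) (space N) - emeasure (\<kappa> \<omega>) (Pair \<omega> -` A)
          = emeasure (\<kappa> \<omega>) (Pair \<omega> -` (space M \<times> space N - A))"
        using emeasure_compl[of "Pair \<omega> -` A" "\<kappa> \<omega>"] D(3)[OF \<omega>] by (simp add: emeasure_finite)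
    qed
  next
    case (union A)
    have A: "A i \<in> sets (M \<Otimes>\<^sub>M N)" for i using union(2) by (auto simp: sets_pair_measure)
    have "(\<lambda>\<omega>. \<Sum>i. emeasure (\<kappa> \<omega>) (Pair \<omega> -` A i)) \<in> borel_measurable M"
      using union.IH by (intro borel_measurable_suminf_order) auto
    then show ?case
    proof (rule measurable_cong[THEN iffD1, rotated])
      fix \<omega> assume \<omega>: "\<omega> \<in> space M"
      have "range (\<lambda>i. Pair \<omega> -` A i) \<subseteq> sets (\<kappa> \<omega>)" using sets_Pair1[OF A] D(1)[OF \<omega>] by auto
      moreover have "disjoint_family (\<lambda>i. Pair \<omega> -` A i)"
        using union(1) unfolding disjoint_family_on_def by blast
      ultimately have "(\<Sum>i. emeasure (\<kappa> \<omega>) (Pair \<omega> -` A i)) = emeasure (\<kappa> \<omega>) (\<Union>i. Pair \<omega> -` A i)"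
        by (rule suminf_emeasure)
      then show "(\<Sum>i. emeasure (\<kappa> \<omega>) (Pair \<omega> -` A i)) = emeasure (\<kappa> \<omega>) (Pair \<omega> -` (\<Union>i. A i))"
        by (simp add: vimage_UN)
    qed
  qed
qed

lemma finite_kernel_nn_integral_measurable:
  assumes K: "finite_kernel M N \<kappa>" and f: "f \<in> borel_measurable (M \<Otimes>\<^sub>M N)"
  shows "(\<lambda>\<omega>. \<integral>\<^sup>+x. f (\<omega>, x) \<partial>\<kappa> \<omega>) \<in> borel_measurable M"
  using f
proof (induction rule: borel_measurable_induct)
  note D = finite_kernelD[OF K]
  have sec: "(\<lambda>x. u (\<omega>, x)) \<in> borel_measurable (\<kappa> \<omega>)"
    if "u \<in> borel_measurable (M \<Otimes>\<^sub>M N)" "\<omega> \<in> space M" for u :: "_ \<Rightarrow> ennreal" and \<omega>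
    using measurable_Pair2[OF that] D(1)[OF that(2)] by (simp cong: measurable_cong_sets)
  {
    case (cong f g)
    show ?case
      by (rule measurable_cong[THEN iffD1, OF _ cong(4)], rule nn_integral_cong)
         (use cong(3) D(3) in \<open>auto simp: space_pair_measure\<close>)
  next
    case (set A)
    show ?case
    proof (rule measurable_cong[THEN iffD1, OF _ finite_kernel_emeasure_measurable[OF K set]])
      fix \<omega> assume \<omega>: "\<omega> \<in> space M"
      have "Pair \<omega> -` A \<in> sets (\<kappa> \<omega>)" using sets_Pair1[OF set] D(1)[OF \<omega>] by simp
      then have "emeasure (\<kappa> \<omega>) (Pair \<omega> -` A) = (\<integral>\<^sup>+x. indicator (Pair \<omega> -` A) x \<partial>\<kappa> \<omega>)" by simp
      also have "\<dots> = (\<integral>\<^sup>+x. indicator A (\<omega>, x) \<partial>\<kappa> \<omega>)"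
        by (rule nn_integral_cong) (simp add: indicator_def)
      finally show "emeasure (\<kappa> \<omega>) (Pair \<omega> -` A) = (\<integral>\<^sup>+x. indicator A (\<omega>, x) \<partial>\<kappa> \<omega>)" .
    qed
  next
    case (mult u c)
    have "(\<lambda>\<omega>. c * (\<integral>\<^sup>+x. u (\<omega>, x) \<partial>\<kappa> \<omega>)) \<in> borel_measurable M" using mult(4) by simp
    then show ?case
      by (rule measurable_cong[THEN iffD1, rotated]) (simp add: nn_integral_cmult sec[OF mult(2)])
  next
    case (add u v)
    have "(\<lambda>\<omega>. (\<integral>\<^sup>+x. v (\<omega>, x) \<partial>\<kappa> \<omega>) + (\<integral>\<^sup>+x. u (\<omega>, x) \<partial>\<kappa> \<omega>)) \<in> borel_measurable M"
      using add.IH by simp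
    then show ?case
      by (rule measurable_cong[THEN iffD1, rotated]) (use add.hyps in \<open>simp add: nn_integral_add sec\<close>)
  next
    case (seq F)
    have "(\<lambda>\<omega>. SUP i. \<integral>\<^sup>+x. F i (\<omega>, x) \<partial>\<kappa> \<omega>) \<in> borel_measurable M" using seq.IH by simp
    then show ?case
    proof (rule measurable_cong[THEN iffD1, rotated])
      fix \<omega> assume \<omega>: "\<omega> \<in> space M"
      have "(\<integral>\<^sup>+x. (SUP i. F i (\<omega>, x)) \<partial>\<kappa> \<omega>) = (SUP i. \<integral>\<^sup>+x. F i (\<omega>, x) \<partial>\<kappa> \<omega>)"
        using seq sec[OF _ \<omega>] by (intro nn_integral_monotone_convergence_SUP) (auto simp: incseq_def le_fun_def)
      then show "(SUP i. \<integral>\<^sup>+x. F i (\<omega>, x) \<partial>\<kappa> \<omega>) = (\<integral>\<^sup>+x. (SUP i. F i) (\<omega>, x) \<partial>\<kappa> \<omega>)"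
        by (simp add: image_image)
    qed
  }
qed

lemma finite_kernel_integral_measurable:
  fixes f :: "'a \<times> 'b \<Rightarrow> real"
  assumes K: "finite_kernel M N \<kappa>" and f: "f \<in> borel_measurable (M \<Otimes>\<^sub>M N)"
  shows "(\<lambda>\<omega>. \<integral>x. f (\<omega>, x) \<partial>\<kappa> \<omega>) \<in> borel_measurable M"
proof -
  note D = finite_kernelD[OF K]
  define P where "P \<omega> = (\<integral>\<^sup>+x. ennreal (f (\<omega>, x)) \<partial>\<kappa> \<omega>)" for \<omega>
  define R where "R \<omega> = (\<integral>\<^sup>+x. ennreal (- f (\<omega>, x)) \<partial>\<kappa> \<omega>)" for \<omega>
  have [measurable]: "P \<in> borel_measurable M" "R \<in> borel_measurable M"
    unfolding P_def[abs_def] R_def[abs_def]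
    using f by (auto intro!: finite_kernel_nn_integral_measurable[OF K])
  \<comment> \<open>Where the positive or the negative part has infinite integral, the Bochner
    integral is 0 by default, so the measurable formula must return 0 there too.\<close>
  have "(\<lambda>\<omega>. if P \<omega> \<noteq> \<infinity> \<and> R \<omega> \<noteq> \<infinity> then enn2real (P \<omega>) - enn2real (R \<omega>) else 0) \<in> borel_measurable M"
    by measurable
  then show ?thesis
  proof (rule measurable_cong[THEN iffD1, rotated])
    fix \<omega> assume \<omega>: "\<omega> \<in> space M"
    have m: "(\<lambda>x. f (\<omega>, x)) \<in> borel_measurable (\<kappa> \<omega>)"
      using measurable_Pair2[OF f \<omega>] D(1)[OF \<omega>] by (simp cong: measurable_cong_sets)
    show "(if P \<omega> \<noteq> \<infinity> \<and> R \<omega> \<noteq> \<infinity> then enn2real (P \<omega>) - enn2real (R \<omega>) else 0) = (\<integral>x. f (\<omega>, x) \<partial>\<kappa> \<omega>)"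
    proof (cases "P \<omega> \<noteq> \<infinity> \<and> R \<omega> \<noteq> \<infinity>")
      case True
      then have "integrable (\<kappa> \<omega>) (\<lambda>x. f (\<omega>, x))" using m by (simp add: real_integrable_def P_def R_def)
      from real_lebesgue_integral_def[OF this] True show ?thesis by (simp add: P_def R_def)
    next
      case False
      then have "\<not> integrable (\<kappa> \<omega>) (\<lambda>x. f (\<omega>, x))" by (auto simp: real_integrable_def P_def R_def)
      then show ?thesis using False by (auto simp: not_integrable_integral_eq)
    qed
  qed
qed

lemma finite_kernel_slice:
  assumes rep: "density_rep \<Delta> m h"
  shows "finite_kernel I01 I01 (slice \<Delta>)"
proof -
  note R = density_repD[OF rep]
  have "disintegration \<Delta> (slice \<Delta>)"
    unfolding slice_def
    by (rule someI[where P = "disintegration \<Delta>"], subst R(8), rule disintegration_density[OF R(2,3,5,7)])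
  then show ?thesis
    unfolding disintegration_def finite_kernel_def sets_I01[symmetric] by simp
qed

section \<open>The pairing and the comparison of energies\<close>

context curve
begin

text \<open>Concerns \<open>residual\<close> itself: it may differ from \<open>residual_dens\<close>
  on a null set of times, and there the measurability can only come from the chosen slices being a
  kernel.\<close>

lemma residual_measurable:
  assumes rep: "density_rep \<Delta> m h"
  shows "case_prod (residual \<Delta>) \<in> borel_measurable I01sq"
proof -
  note K = finite_kernel_slice[OF rep]
  \<comment> \<open>The lower limit x of the integral in \<open>U_meas\<close> is a parameter as
    well, so the kernel is pulled back from times to points of the square.\<close>
  have K2: "finite_kernel I01sq I01 (\<lambda>z. slice \<Delta> (fst z))"
    unfolding finite_kernel_def
  proof (intro conjI ballI)
    show "(\<lambda>z. emeasure (slice \<Delta> (fst z)) B) \<in> borel_measurable I01sq" if "B \<in> sets I01" for B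
      by (rule measurable_compose[OF measurable_fst finite_kernelD(4)[OF K that]])
  qed (use finite_kernelD(1,2)[OF K] in \<open>auto simp: space_pair_measure\<close>)
  have "(\<lambda>z. \<integral>y. (\<lambda>(z, y). indicator {snd z..1} y *\<^sub>R eta (q (fst z)) y) (z, y) \<partial>slice \<Delta> (fst z))
      \<in> borel_measurable I01sq"
    by (rule finite_kernel_integral_measurable[OF K2]) measurable
  then have [measurable]: "case_prod (U_meas \<Delta> q) \<in> borel_measurable I01sq"
    unfolding U_meas_def[abs_def] set_lebesgue_integral_def case_prod_unfold by simp
  note [measurable] = pi_star_measurable[OF this] base_flat_props(1) has_H1_derivD(5)[OF p_H1]
  show ?thesis unfolding residual_def[abs_def] cov_flat_eq by measurable
qed

lemma DG_slice_measurable: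
  assumes rep: "density_rep \<Delta> m h"
  shows "(\<lambda>t. \<integral>x. DG \<Delta> p q (t, x) \<partial>slice \<Delta> t) \<in> borel_measurable I01"
proof -
  note K = finite_kernel_slice[OF rep]
  note [measurable] = residual_measurable[OF rep]
  have "(\<lambda>t. \<integral>x. (\<lambda>(t, x). eta (q t) x * cum (\<lambda>y. eta (q t) y * residual \<Delta> t y) x) (t, x) \<partial>slice \<Delta> t)
      \<in> borel_measurable I01"
    by (rule finite_kernel_integral_measurable[OF K]) measurable
  then show ?thesis
  proof (rule measurable_cong[THEN iffD1, rotated])
    fix t assume t: "t \<in> space I01"
    show "(\<integral>x. (\<lambda>(t, x). eta (q t) x * cum (\<lambda>y. eta (q t) y * residual \<Delta> t y) x) (t, x) \<partial>slice \<Delta> t)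
        = (\<integral>x. DG \<Delta> p q (t, x) \<partial>slice \<Delta> t)"
    proof (rule Bochner_Integration.integral_cong[OF refl])
      fix x assume "x \<in> space (slice \<Delta> t)"
      then have "x \<in> {0..1}" using finite_kernelD(3)[OF K t] by simp
      then show "(\<lambda>(t, x). eta (q t) x * cum (\<lambda>y. eta (q t) y * residual \<Delta> t y) x) (t, x) = DG \<Delta> p q (t, x)"
        by (simp add: DG_def set_integral_eq_cum cov_def residual_def distrib_left)
    qed
  qed
qed

lemma pairing_DG:
  assumes rep: "density_rep \<Delta> m h"
  shows "pairing (\<lambda>z. - DG \<Delta> p q z) \<Delta> = - (\<integral>t. variation m h m h t \<partial>I01)"
proof -
  have "pairing (\<lambda>z. - DG \<Delta> p q z) \<Delta> = (\<integral>t. (\<integral>x. - DG \<Delta> p q (t, x) \<partial>slice \<Delta> t) \<partial>I01)"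
    unfolding pairing_def integral_I01 ..
  also have "\<dots> = - (\<integral>t. (\<integral>x. DG \<Delta> p q (t, x) \<partial>slice \<Delta> t) \<partial>I01)" by simp
  also have "(\<integral>t. (\<integral>x. DG \<Delta> p q (t, x) \<partial>slice \<Delta> t) \<partial>I01) = (\<integral>t. variation m h m h t \<partial>I01)"
  proof (rule integral_cong_AE[OF DG_slice_measurable[OF rep]])
    show "variation m h m h \<in> borel_measurable I01" using variation_integrable(1)[OF rep rep] by auto
    show "AE t in I01. (\<integral>x. DG \<Delta> p q (t, x) \<partial>slice \<Delta> t) = variation m h m h t"
      using integral_DG[OF rep rep] by eventually_elim simp
  qed
  finally show ?thesis .
qed

text \<open>\<open>FR_lower_bound\<close> with multiplier g; the weak time derivative replaces the
  integral of g against it by minus that of \<open>dt g\<close>, which leaves minus the integral of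
  F. Since \<open>h'\<close> is nonnegative, \<open>F <= DG\<close> can be integrated slice by
  slice, for almost every t, against the competitor.\<close>

lemma FR_time_ge:
  assumes rep: "density_rep \<Delta> m h" and rep': "density_rep \<Delta>' m' h'" and d: "has_time_deriv \<Delta>' \<delta>"
    and g: "g \<in> C10" "\<forall>x\<in>{0..1}. g (1, x) = 0"
    and le: "AE t in I01. \<forall>x\<in>{0..1}. dt g (t, x) + 1 / eta (q t) x * (g (t, x))\<^sup>2 \<le> DG \<Delta> p q (t, x)"
  shows "ennreal (- (\<integral>t. variation m h m' h' t \<partial>I01)) \<le> FR_time q \<Delta>'"
proof -
  note R = density_repD[OF rep'] and P = pos_measuresD[OF density_repD(1)[OF rep']]
  interpret m': finite_measure m' by (rule R(3))
  interpret X: pair_sigma_finite I01 m' ..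
  interpret D': finite_measure \<Delta>' by (rule P(3))
  define e where "e = (\<lambda>(t, x). eta (q t) x)"
  have e[measurable]: "e \<in> borel_measurable I01sq" unfolding e_def by measurable
  have epos: "0 < e z" for z by (simp add: e_def case_prod_unfold)
  \<comment> \<open>\<open>time_deriv\<close> is chosen among all weak derivatives; the weak
    identity for the chosen one is all that enters.\<close>
  have td: "has_time_deriv \<Delta>' (time_deriv \<Delta>')"
    unfolding time_deriv_def by (rule someI[where P = "has_time_deriv \<Delta>'", OF d])
  have FR: "FR_time q \<Delta>' = FR e (of_pos \<Delta>') (time_deriv \<Delta>')"
  proof -
    have "\<exists>\<delta>. has_time_deriv \<Delta>' \<delta>" using d ..
    then show ?thesis by (simp only: FR_time_def e_def if_True)
  qed
  have cont_meas: "f \<in> borel_measurable I01sq" if "continuous_on D f" for f :: "real \<times> real \<Rightarrow> real"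
    using borel_measurable_continuous_on_restrict[OF that] by (simp add: measurable_cong_sets[OF sets_D refl])
  have cont_bdd: "\<exists>B. \<forall>z\<in>D. \<bar>f z\<bar> \<le> B" if "continuous_on D f" for f :: "real \<times> real \<Rightarrow> real"
  proof -
    have "compact (f ` D)" by (intro compact_continuous_image that compact_Times) simp_all
    then have "bounded (f ` D)" by (rule compact_imp_bounded)
    then show ?thesis unfolding bounded_real by blast
  qed
  have gc: "continuous_on D g" "continuous_on D (dt g)" using g(1) by (auto simp: C10_def)
  note gm[measurable] = cont_meas[OF gc(1)] cont_meas[OF gc(2)]
  obtain A where A: "\<forall>z\<in>D. \<bar>g z\<bar> \<le> A" using cont_bdd[OF gc(1)] by blast
  obtain A' where A': "\<forall>z\<in>D. \<bar>dt g z\<bar> \<le> A'" using cont_bdd[OF gc(2)] by blast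
  obtain C where C: "0 < C" "\<And>t x. t \<in> {0..1} \<Longrightarrow> x \<in> {0..1} \<Longrightarrow> eta (q t) x \<le> C"
    "\<And>t x. t \<in> {0..1} \<Longrightarrow> x \<in> {0..1} \<Longrightarrow> inverse (eta (q t) x) \<le> C"
    using eta_bounds by blast
  have ge: "\<bar>(g z)\<^sup>2 / e z\<bar> \<le> A\<^sup>2 * C" if z: "z \<in> D" for z
  proof -
    have "\<bar>g z\<bar> \<le> A" using A z by blast
    then have "(g z)\<^sup>2 \<le> A\<^sup>2" using power_mono[of "\<bar>g z\<bar>" A 2] by simp
    moreover have "inverse (e z) \<le> C" using C(3)[of "fst z" "snd z"] z by (auto simp: e_def case_prod_unfold)
    ultimately have "(g z)\<^sup>2 * inverse (e z) \<le> A\<^sup>2 * C"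
      using epos[of z] by (intro mult_mono) (auto simp: less_imp_le)
    then show ?thesis using epos[of z] by (simp add: divide_inverse abs_mult)
  qed
  define F where "F = (\<lambda>z. dt g z + (g z)\<^sup>2 / e z)"
  have F[measurable]: "F \<in> borel_measurable I01sq" unfolding F_def by measurable
  have Fb: "\<bar>F z\<bar> \<le> A' + A\<^sup>2 * C" if "z \<in> D" for z
  proof -
    have "\<bar>dt g z\<bar> \<le> A'" using A' that by blast
    then show ?thesis unfolding F_def using ge[OF that] by linarith
  qed
  have int: "integrable \<Delta>' f" if "f \<in> borel_measurable I01sq" "\<And>z. z \<in> D \<Longrightarrow> \<bar>f z\<bar> \<le> B"
    for f :: "real \<times> real \<Rightarrow> real" and B :: real
    using that by (intro D'.integrable_const_bound[of _ B])
      (auto intro!: AE_I2 simp: P(2) measurable_cong_sets[OF P(1) refl])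
  have i1: "integrable \<Delta>' (dt g)" by (rule int[OF gm(2), of A']) (use A' in blast)
  have i2: "integrable \<Delta>' (\<lambda>z. (g z)\<^sup>2 / e z)" by (rule int[OF _ ge]) measurable
  have "integral\<^sup>L \<Delta>' (dt g) + signed_integral (time_deriv \<Delta>') g = 0"
    using td g unfolding has_time_deriv_def by blast
  then have eq: "signed_integral (time_deriv \<Delta>') g - (\<integral>z. (g z)\<^sup>2 / e z \<partial>\<Delta>') = - integral\<^sup>L \<Delta>' F"
    unfolding F_def using i1 i2 by simp
  have "ennreal (- integral\<^sup>L \<Delta>' F) \<le> FR_time q \<Delta>'"
    unfolding FR eq[symmetric]
  proof (rule FR_lower_bound[OF R(1) _ e epos gm(1) _ ge])
    show "time_deriv \<Delta>' \<in> signed_measures" using td by (simp add: has_time_deriv_def)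
    show "\<bar>g z\<bar> \<le> A" if "z \<in> D" for z using A that by blast
  qed
  moreover have "integral\<^sup>L \<Delta>' F \<le> (\<integral>t. variation m h m' h' t \<partial>I01)"
  proof -
    note [measurable] = R(5)
    have Fm[measurable]: "F \<in> borel_measurable (I01 \<Otimes>\<^sub>M m')" using F by (simp add: measurable_I01_pair_cong[OF R(2)])
    interpret Y: finite_measure "I01 \<Otimes>\<^sub>M m'" by (rule finite_measure_pair_measure) unfold_locales
    have hF: "integrable (I01 \<Otimes>\<^sub>M m') (\<lambda>(t, x). h' t x * F (t, x))"
    proof (rule Y.integrable_const_bound)
      have "\<bar>h' t x * F (t, x)\<bar> \<le> 1 * (A' + A\<^sup>2 * C)" if "t \<in> {0..1}" "x \<in> {0..1}" for t x
        unfolding abs_mult using R(6,7)[of t x] Fb[of "(t, x)"] that by (intro mult_mono) auto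
      then show "AE z in I01 \<Otimes>\<^sub>M m'. norm (case z of (t, x) \<Rightarrow> h' t x * F (t, x)) \<le> A' + A\<^sup>2 * C"
        by (intro AE_I2) (auto simp: space_pair_measure R(4))
    qed measurable
    have "integral\<^sup>L \<Delta>' F = integral\<^sup>L (density (I01 \<Otimes>\<^sub>M m') (\<lambda>z. ennreal (case_prod h' z))) F"
      by (subst R(8)) (simp add: case_prod_unfold)
    also have "\<dots> = (\<integral>z. case_prod h' z *\<^sub>R F z \<partial>(I01 \<Otimes>\<^sub>M m'))"
      by (rule integral_density) (auto intro!: AE_I2 simp: R(6) case_prod_unfold)
    also have "\<dots> = (\<integral>z. (\<lambda>(t, x). h' t x * F (t, x)) z \<partial>(I01 \<Otimes>\<^sub>M m'))"
      by (simp add: case_prod_unfold)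
    also have "\<dots> = (\<integral>t. (\<integral>x. h' t x * F (t, x) \<partial>m') \<partial>I01)"
      by (rule X.integral_fst[OF hF, symmetric])
    also have "\<dots> \<le> (\<integral>t. variation m h m' h' t \<partial>I01)"
    proof (rule integral_mono_AE)
      show "integrable I01 (\<lambda>t. \<integral>x. h' t x * F (t, x) \<partial>m')" by (rule X.integrable_fst[OF hF])
      show "integrable I01 (variation m h m' h')" by (rule variation_integrable(1)[OF rep rep'])
      show "AE t in I01. (\<integral>x. h' t x * F (t, x) \<partial>m') \<le> variation m h m' h' t"
        using le integral_DG[OF rep rep'] X.AE_integrable_fst[OF hF]
      proof eventually_elim
        case (elim t)
        have "(\<integral>x. h' t x * F (t, x) \<partial>m') \<le> (\<integral>x. h' t x * DG \<Delta> p q (t, x) \<partial>m')"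
        proof (rule integral_mono)
          fix x assume "x \<in> space m'"
          then have "F (t, x) \<le> DG \<Delta> p q (t, x)"
            using elim(1) R(4) by (simp add: F_def e_def)
          then show "h' t x * F (t, x) \<le> h' t x * DG \<Delta> p q (t, x)" using R(6) by (rule mult_left_mono)
        qed (use elim in auto)
        then show ?case using elim(2) by simp
      qed
    qed
    finally show ?thesis .
  qed
  ultimately show ?thesis by (meson ennreal_leI neg_le_iff_le order_trans)
qed

text \<open>The residual is square integrable on the square, so this part of the energy is a real
  number and the final comparison can be done in the reals.\<close>

lemma G_fun_eq:
  assumes rep: "density_rep \<Delta> m h"
  shows "G_fun P \<Delta> p q = ereal ((\<integral>t. residual_norm m h t \<partial>I01) + P (p 1) (q 1))"
proof -
  note N = residual_norm_props[OF rep]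
  have nn: "0 \<le> residual_norm m h t" for t
    unfolding residual_norm_def by (simp add: less_imp_le)
  have "(\<integral>\<^sup>+ t. norm_sq (q t) (residual \<Delta> t) \<partial>I01) = (\<integral>\<^sup>+ t. ennreal (residual_norm m h t) \<partial>I01)"
    by (rule nn_integral_cong_AE[OF N(2)])
  also have "\<dots> = ennreal (\<integral>t. residual_norm m h t \<partial>I01)"
    by (rule nn_integral_eq_integral[OF N(1)]) (simp add: nn)
  finally show ?thesis
    unfolding G_fun_def residual_def[abs_def] using nn by (simp add: enn2ereal_ennreal)
qed

lemma optimality:
  assumes \<Delta>: "\<Delta> \<in> M0"
    and g: "g \<in> C10" "\<forall>x\<in>{0..1}. g (1, x) = 0"
    and le: "AE t in I01. \<forall>x\<in>{0..1}. dt g (t, x) + 1 / eta (q t) x * (g (t, x))\<^sup>2 \<le> DG \<Delta> p q (t, x)"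
    and eq: "ereal (pairing (\<lambda>z. - DG \<Delta> p q z) \<Delta>) = enn2ereal (FR_time q \<Delta>)"
  shows "optimal P \<Delta> p q"
  unfolding optimal_def
proof (intro conjI ballI)
  show "\<Delta> \<in> M0" by fact
  fix \<Delta>' assume \<Delta>': "\<Delta>' \<in> M0"
  \<comment> \<open>The pairing is a real number, so by \<open>eq\<close> the Fisher-Rao energy is
    finite.\<close>
  have "\<exists>\<delta>. has_time_deriv \<Delta> \<delta>"
  proof (rule ccontr)
    assume "\<not> ?thesis"
    then show False using eq by (simp add: FR_time_def)
  qed
  then obtain m h where rep: "density_rep \<Delta> m h"
    using density_rep_ex \<Delta> unfolding M0_def by blast
  show "F_fun P \<Delta> p q \<le> F_fun P \<Delta>' p q"
  proof (cases "\<exists>\<delta>. has_time_deriv \<Delta>' \<delta>")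
    case False
    then have "FR_time q \<Delta>' = \<infinity>" by (simp add: FR_time_def)
    \<comment> \<open>Excluded so that the sum with an infinite Fisher-Rao energy is again infinite:
      the integral is nonnegative and P is real-valued.\<close>
    moreover have "G_fun P \<Delta>' p q \<noteq> - \<infinity>"
      unfolding G_fun_def using enn2ereal_nonneg by (auto simp: ereal_plus_eq_MInfty)
    ultimately have "F_fun P \<Delta>' p q = \<infinity>" by (simp add: F_fun_def)
    then show ?thesis by simp
  next
    case True
    then obtain \<delta> where d: "has_time_deriv \<Delta>' \<delta>" ..
    obtain m' h' where rep': "density_rep \<Delta>' m' h'"
      using density_rep_ex[OF _ d] \<Delta>' unfolding M0_def by blast
    define v v' where "v = (\<integral>t. variation m h m h t \<partial>I01)" and "v' = (\<integral>t. variation m h m' h' t \<partial>I01)"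
    define n n' where "n = (\<integral>t. residual_norm m h t \<partial>I01)" and "n' = (\<integral>t. residual_norm m' h' t \<partial>I01)"
    have "(\<integral>t. residual_norm m h t + (variation m h m' h' t - variation m h m h t) \<partial>I01) \<le> n'"
      unfolding n'_def
      using residual_norm_props(1)[OF rep] residual_norm_props(1)[OF rep']
        variation_integrable(1)[OF rep rep'] variation_integrable(1)[OF rep rep]
      by (intro integral_mono_AE residual_norm_convex[OF rep rep']) auto
    then have n: "n + (v' - v) \<le> n'"
      unfolding n_def v_def v'_def
      using residual_norm_props(1)[OF rep] variation_integrable(1)[OF rep rep'] variation_integrable(1)[OF rep rep]
      by simp
    have FR: "enn2ereal (FR_time q \<Delta>) = ereal (- v)"
      using eq unfolding pairing_DG[OF rep] v_def by simp
    have "ennreal (- v') \<le> FR_time q \<Delta>'"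
      unfolding v'_def by (rule FR_time_ge[OF rep rep' d g le])
    then have "enn2ereal (ennreal (- v')) \<le> enn2ereal (FR_time q \<Delta>')" by (simp add: less_eq_ennreal.rep_eq)
    \<comment> \<open>\<open>ennreal\<close> truncates negative numbers to 0, so the passage to
      \<open>ereal\<close> can only increase the value.\<close>
    moreover have "ereal (- v') \<le> enn2ereal (ennreal (- v'))"
      by (cases "0 \<le> - v'") (simp_all add: enn2ereal_ennreal ennreal_neg zero_ennreal.rep_eq)
    ultimately have FR': "ereal (- v') \<le> enn2ereal (FR_time q \<Delta>')" by (rule order_trans[rotated])
    \<comment> \<open>\<open>FR\<close> is exact for the given measure and \<open>FR'\<close> is a
      bound from below for the competitor. The difference of variations in \<open>n\<close> bridges
      -v and -v', and the end cost P is the same on both sides.\<close>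
    have "F_fun P \<Delta> p q = ereal (- v + (n + P (p 1) (q 1)))"
      unfolding F_fun_def FR G_fun_eq[OF rep] n_def by simp
    also have "\<dots> \<le> ereal (- v' + (n' + P (p 1) (q 1)))" using n by simp
    also have "\<dots> = ereal (- v') + G_fun P \<Delta>' p q" unfolding G_fun_eq[OF rep'] n'_def by simp
    also have "\<dots> \<le> F_fun P \<Delta>' p q" unfolding F_fun_def by (rule add_right_mono[OF FR'])
    finally show ?thesis .
  qed
qed

end

theorem proposition7p5:
  fixes p q :: "real \<Rightarrow> real \<Rightarrow> real"
    and q0 p0 q1 p1 :: "real \<Rightarrow> real"
    and \<C> :: "((real \<Rightarrow> real \<Rightarrow> real) \<times> (real \<Rightarrow> real \<Rightarrow> real)) set"
    and P :: "(real \<Rightarrow> real) \<Rightarrow> (real \<Rightarrow> real) \<Rightarrow> real"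
    and \<Delta> :: "(real \<times> real) measure"
  assumes "q0 \<in> Q" and "p0 \<in> TstarQ q0"
    and "q1 \<in> Q" and "p1 \<in> TstarQ q1"
    and "\<C> = C0 q0 p0 \<or> \<C> = C01 q0 p0 q1 p1"
    and "(p, q) \<in> \<C>"
    and "\<Delta> \<in> M0"
    and "\<exists>g\<in>C10. (\<forall>x\<in>{0..1}. g (1, x) = 0) \<and>
      (AE t in I01. \<forall>x\<in>{0..1}.
        dt g (t, x) + 1 / eta (q t) x * (g (t, x))\<^sup>2
          \<le> eta (q t) x * (LINT y:{0..x}|lborel.
              cov p q t y + eta (q t) y * pi_star (q t) (U_meas \<Delta> q t) y))"
    and "ereal (pairing (\<lambda>z. - DG \<Delta> p q z) \<Delta>) = enn2ereal (FR_time q \<Delta>)"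
  shows "optimal P \<Delta> p q"
proof -
  have "(p, q) \<in> C0 q0 p0" using assms(5,6) by (auto simp: C01_def)
  then obtain v where Q: "\<And>t. t \<in> {0..1} \<Longrightarrow> q t \<in> Q" "\<And>t. t \<in> {0..1} \<Longrightarrow> p t \<in> TstarQ (q t)"
    and v: "has_H2_deriv q v" "\<And>t. t \<in> {0..1} \<Longrightarrow> AE x in I01. v t x = eta (q t) x * p t x"
    unfolding C0_def by blast
  then obtain w where w: "has_H1_deriv q v" "has_H1_deriv v w" unfolding has_H2_deriv_def by blast
  interpret curve p q v w by unfold_locales (use Q v w in auto)
  obtain g where g: "g \<in> C10" "\<forall>x\<in>{0..1}. g (1, x) = 0"
    and le: "AE t in I01. \<forall>x\<in>{0..1}. dt g (t, x) + 1 / eta (q t) x * (g (t, x))\<^sup>2 \<le> DG \<Delta> p q (t, x)"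
    using assms(8) unfolding DG_def by auto
  show ?thesis by (rule optimality[OF assms(7) g le assms(9)])
qed

end
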